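(* Let $\{X_{n,j}: 1\le j\le n,\ n\in\mathbb{N}\}$ be a triangular array of independent non-negative random variables, and suppose that the distribution $\mathcal{P}_{n,j}$ of $X_{n,j}$ is non-atomic for all $n,j$. Let $\{c_{n,j}: 1\le j\le n,\ n\in\mathbb{N}\}$ be a triangular array of positive constants and put $d_n=\sum_{j=1}^n c_{n,j}$. Suppose the following. (1) As $n\to\infty$, $d_n\to\infty$ and $\frac{\max_{j\le n} c_{n,j}}{d_n}\to 0$, and the measures $\mu_n=\sum_{j=1}^n \frac{c_{n,j}}{d_n}\delta_{\{j/n\}}$ on $[0,1]$ converge weakly to a measure $\mu$. (2) There is a non-atomic measure $\gamma$ on $\mathbb{R}_+=(0,\infty]$ such that for every $j$, $\frac{d_n}{c_{n,j}}\mathcal{P}_{n,j}\to\gamma$ vaguely on $\mathbb{R}_+$ as $n\to\infty$, and this convergence is uniform in the sense that, for every $t>0$, $$\Delta_n(t):=\sup_{f\in \mathbb{C}^+_{K,t}}\ \max_{j\le n}\left|\frac{d_n}{c_{n,j}}\int f\,d\mathcal{P}_{n,j}-\int f\,d\gamma\right|\to 0\quad (n\to\infty).$$ Let $\zeta_n=\sum_{j=1}^n\delta_{\{(j/n,\,X_{n,j})\}}$ and let $\zeta$ be a Poisson point process on $[0,1]\times\mathbb{R}_+$ with intensity measure $\mu\times\gamma$. Then, as $n\to\infty$, the following convergences in distribution hold: (i) $\frac1n\,\mathrm{argmax}_{j\le n}\{X_{n,j}\}\Longrightarrow A(\zeta)$; (ii) $\max_{j\le n}\{X_{n,j}\}\Longrightarrow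 M(\zeta)$; (iii) $L(\zeta_n)\Longrightarrow L(\zeta)$ in the Skorokhod space $\mathbb{D}[0,1]$.
   Context: $\mathbb{R}_+=(0,\infty]$ is the half-line with the point $+\infty$ added, with metric $\rho(x,y)=|1/x-1/y|$ (where $1/\infty=0$); a subset is compact iff it is closed and separated from $0$. $\delta_{\{a\}}$ is the unit mass at $a$. $\mathbb{C}^+_{K,t}$ is the set of non-negative $\rho$-continuous functions on $\mathbb{R}_+$ with compact support contained in $[t,\infty]$, and $\mathbb{C}_K^+=\bigcup_{t>0}\mathbb{C}^+_{K,t}$. Measures $\tau_n$ on $\mathbb{R}_+$ converge vaguely to $\tau$ if $\int f\,d\tau_n\to\int f\,d\tau$ for every $f\in\mathbb{C}_K^+$. All measures considered on $\mathbb{R}_+$ are finite on $[t,\infty]$ for every $t>0$ and have no atom at $+\infty$; the $\mathcal{P}_{n,j}$ are regarded as measures on $\mathbb{R}_+$ (being non-atomic, they give no mass to $0$). $\mathbb{K}$ is the space of locally finite configurations $\varkappa$ in $[0,1]\times\mathbb{R}_+$ (finitely many points in $[0,1]\times[t,\infty]$ for every $t>0$); a point process is identified with its random configuration. For $\varkappa\in\mathbb{K}$: $A(\varkappa)=\mathrm{argmax}\{x : (t,x)\in\varkappa\}$, that is, the first coordinate $t\in[0,1]$ of the point $(t,x)\in\varkappa$ with the largest second coordinate $x$; $M(\varkappa)=\max\{x : (t,x)\in\varkappa\}$; and $L(\varkappa)(t)=\max\{x: (s,x)\in\varkappa,\ s\ge t\}$ for $t\in[0,1]$. In $M$ and $L$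 the maximum over the empty set is taken to be $0$. $\mathrm{argmax}_{j\le n}\{X_{n,j}\}$ is the (a.s. unique) index $j$ at which $\max_{j\le n}X_{n,j}$ is attained. The paths of $L(\zeta_n)$, $L(\zeta)$ are non-increasing and left-continuous with right limits; $\mathbb{D}[0,1]$ is the corresponding space of left-continuous functions with right limits on $[0,1]$, with the Skorokhod topology.
   Formalization: (i) is claimed only when ζ is a.s. non-empty (γ(R_+)=∞), since otherwise A(ζ) is undefined with positive probability; (iii) is claimed only when μ has no atoms, since for μ with an atom and γ≠0 Skorokhod convergence fails (e.g. μ=δ_{1/2}, γ Pareto). *)

theory Defs
  imports "HOL-Probability.Probability"
begin

section \<open>The half-line with infinity added\<close>

definition Rplus :: "ennreal set" where
  "Rplus = {0<..}"

definition rho :: "ennreal \<Rightarrow> ennreal \<Rightarrow> real" where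
  "rho x y = \<bar>enn2real (inverse x) - enn2real (inverse y)\<bar>"

abbreviation Rplus_top :: "ennreal topology" where
  "Rplus_top \<equiv> Metric_space.mtopology Rplus rho"

lemma ennreal_inverse_inverse': "inverse (inverse x) = x" for x :: ennreal
proof (cases x)
  case (real r)
  then show ?thesis by (cases "r = 0") (auto simp: inverse_ennreal)
qed simp

lemma Metric_space_rho: "Metric_space Rplus rho"
proof
  fix x y assume "x \<in> Rplus" "y \<in> Rplus"
  then have "inverse x \<noteq> \<top>" "inverse y \<noteq> \<top>"
    by (auto simp: Rplus_def)
  then have "enn2real (inverse x) = enn2real (inverse y) \<longleftrightarrow> inverse x = inverse y"
    by (metis ennreal_enn2real_if)
  also have "\<dots> \<longleftrightarrow> x = y"
    by (metis ennreal_inverse_inverse')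
  finally show "rho x y = 0 \<longleftrightarrow> x = y"
    by (simp add: rho_def)
qed (auto simp: rho_def)

text \<open>The metric topology is the subspace topology inherited from \<^typ>\<open>ennreal\<close>, so the Borel
  sets are the usual ones.\<close>

lemma Rplus_top_eq: "Rplus_top = top_of_set Rplus"
proof -
  interpret Metric_space Rplus rho by (rule Metric_space_rho)
  define h where "h = (\<lambda>x::ennreal. enn2real (inverse x))"
  define g where "g = (\<lambda>y::real. inverse (ennreal y))"
  have fin: "inverse x < \<top>" if "x \<in> Rplus" for x :: ennreal
    using that by (simp add: Rplus_def less_top[symmetric])
  have gh: "g (h x) = x" if "x \<in> Rplus" for x
    using fin[OF that] by (simp add: g_def h_def ennreal_enn2real ennreal_inverse_inverse')
  have h0: "0 \<le> h x" for x by (simp add: h_def)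
  have ch: "continuous_on Rplus h"
    unfolding h_def continuous_on_def
  proof
    fix x assume x: "x \<in> Rplus"
    have "continuous_on Rplus (\<lambda>x::ennreal. inverse x)"
      by (intro continuous_on_inverse_ennreal continuous_on_id)
    then have "((\<lambda>x. inverse x) \<longlongrightarrow> ennreal (enn2real (inverse x))) (at x within Rplus)"
      using x fin[OF x] by (simp add: continuous_on_def ennreal_enn2real)
    then show "((\<lambda>x. enn2real (inverse x)) \<longlongrightarrow> enn2real (inverse x)) (at x within Rplus)"
      by (rule tendsto_enn2real) simp
  qed
  have cg: "continuous_on UNIV g"
    unfolding g_def by (intro continuous_on_inverse_ennreal continuous_on_ennreal continuous_on_id)
  show ?thesis
  proof (rule topology_eq[THEN iffD2], intro allI iffI)
    fix U assume U: "openin mtopology U"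
    show "openin (top_of_set Rplus) U"
    proof (subst openin_subopen, intro ballI)
      fix x assume "x \<in> U"
      with U obtain r where r: "r > 0" "mball x r \<subseteq> U" and x: "x \<in> Rplus"
        unfolding openin_mtopology by blast
      have "mball x r = Rplus \<inter> h -` ball (h x) r"
        using x by (auto simp: rho_def h_def dist_real_def)
      moreover have "openin (top_of_set Rplus) (Rplus \<inter> h -` ball (h x) r)"
        by (rule continuous_openin_preimage_gen[OF ch]) auto
      ultimately show "\<exists>T. openin (top_of_set Rplus) T \<and> x \<in> T \<and> T \<subseteq> U"
        using r x by (intro exI[of _ "mball x r"]) auto
    qed
  next
    fix U assume "openin (top_of_set Rplus) U"
    then obtain V where V: "open V" "U = Rplus \<inter> V" by (auto simp: openin_open)
    show "openin mtopology U"
      unfolding openin_mtopology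
    proof (intro conjI allI impI)
      show "U \<subseteq> Rplus" using V by auto
      fix x assume x: "x \<in> U"
      have "open (g -` V)" using cg V(1) by (simp add: continuous_on_open_vimage)
      moreover have "h x \<in> g -` V" using x V(2) by (simp add: gh)
      ultimately obtain r where r: "r > 0" "ball (h x) r \<subseteq> g -` V"
        by (meson open_contains_ball)
      have "mball x r \<subseteq> U"
      proof
        fix y assume y: "y \<in> mball x r"
        then have "h y \<in> ball (h x) r" by (auto simp: rho_def h_def dist_real_def)
        then have "g (h y) \<in> V" using r by auto
        then show "y \<in> U" using y V(2) by (simp add: gh)
      qed
      then show "\<exists>r>0. mball x r \<subseteq> U" using r by blast
    qed
  qed
qed

abbreviation Rplus_borel :: "ennreal measure" where
  "Rplus_borel \<equiv> restrict_space borel Rplus"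

text \<open>\<open>CK_plus_from t\<close> is the class of non-negative continuous functions on the half-line with
  compact support in \<open>[t, \<infinity>]\<close>; values at the excluded point 0 are irrelevant.\<close>

definition CK_plus_from :: "real \<Rightarrow> (ennreal \<Rightarrow> real) set" where
  "CK_plus_from t = {f. continuous_map Rplus_top euclideanreal f \<and> (\<forall>x\<in>Rplus. 0 \<le> f x) \<and>
     compactin Rplus_top (Rplus_top closure_of {x \<in> Rplus. f x \<noteq> 0}) \<and>
     Rplus_top closure_of {x \<in> Rplus. f x \<noteq> 0} \<subseteq> {ennreal t..}}"

definition CK_plus :: "(ennreal \<Rightarrow> real) set" where
  "CK_plus = (\<Union>t\<in>{0<..}. CK_plus_from t)"

definition vague_conv :: "(nat \<Rightarrow> ennreal measure) \<Rightarrow> ennreal measure \<Rightarrow> bool" where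
  "vague_conv \<tau>s \<tau> \<longleftrightarrow>
     (\<forall>f\<in>CK_plus. (\<lambda>n. \<integral>x. f x \<partial>\<tau>s n) \<longlonglongrightarrow> (\<integral>x. f x \<partial>\<tau>))"

definition nonatomic :: "'a measure \<Rightarrow> bool" where
  "nonatomic \<nu> \<longleftrightarrow> (\<forall>x\<in>space \<nu>. emeasure \<nu> {x} = 0)"


section \<open>Weak convergence and convergence in distribution\<close>

definition borel_of :: "'a topology \<Rightarrow> 'a measure" where
  "borel_of T = sigma (topspace T) {U. openin T U}"

definition weak_conv_top :: "'a topology \<Rightarrow> (nat \<Rightarrow> 'a measure) \<Rightarrow> 'a measure \<Rightarrow> bool" where
  "weak_conv_top T \<nu>s \<nu> \<longleftrightarrow>
     (\<forall>f. continuous_map T euclideanreal f \<and> bounded (f ` topspace T) \<longrightarrow>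
        (\<lambda>n. \<integral>x. f x \<partial>\<nu>s n) \<longlonglongrightarrow> (\<integral>x. f x \<partial>\<nu>))"

text \<open>The random elements \<open>Y n\<close> and \<open>Z\<close> may live on different probability spaces.\<close>

definition conv_in_distribution ::
  "'a topology \<Rightarrow> (nat \<Rightarrow> 'b measure) \<Rightarrow> (nat \<Rightarrow> 'b \<Rightarrow> 'a) \<Rightarrow> 'c measure \<Rightarrow> ('c \<Rightarrow> 'a) \<Rightarrow> bool"
where
  "conv_in_distribution T M Y N Z \<longleftrightarrow>
     (\<forall>n. Y n \<in> M n \<rightarrow>\<^sub>M borel_of T) \<and> Z \<in> N \<rightarrow>\<^sub>M borel_of T \<and>
     weak_conv_top T (\<lambda>n. distr (M n) (borel_of T) (Y n)) (distr N (borel_of T) Z)"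


section \<open>Quantities of the triangular array\<close>

definition row_sum :: "(nat \<Rightarrow> nat \<Rightarrow> real) \<Rightarrow> nat \<Rightarrow> real" where
  "row_sum c n = (\<Sum>j=1..n. c n j)"

text \<open>The measure \<open>\<Sum>j\<le>n. (c n j / row_sum c n) \<delta>(j/n)\<close> on \<open>[0, 1]\<close>, as the image of a
  weighted counting measure on the indices.\<close>

definition position_measure :: "(nat \<Rightarrow> nat \<Rightarrow> real) \<Rightarrow> nat \<Rightarrow> real measure" where
  "position_measure c n =
     distr (point_measure {1..n} (\<lambda>j. ennreal (c n j / row_sum c n)))
       (restrict_space borel {0..1}) (\<lambda>j. real j / real n)"

definition Rplus_law :: "'b measure \<Rightarrow> ('b \<Rightarrow> real) \<Rightarrow> ennreal measure" where
  "Rplus_law M Y = restrict_space (distr M borel (\<lambda>\<omega>. ennreal (Y \<omega>))) Rplus"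

text \<open>The supremum is taken in \<^typ>\<open>ennreal\<close> because it may be infinite.\<close>

definition Delta ::
  "(nat \<Rightarrow> 'b measure) \<Rightarrow> (nat \<Rightarrow> nat \<Rightarrow> 'b \<Rightarrow> real) \<Rightarrow> (nat \<Rightarrow> nat \<Rightarrow> real) \<Rightarrow> ennreal measure \<Rightarrow>
   nat \<Rightarrow> real \<Rightarrow> ennreal" where
  "Delta M X c \<gamma> n t =
     (SUP f\<in>CK_plus_from t. MAX j\<in>{1..n}.
        ennreal \<bar>row_sum c n / c n j * (\<integral>x. f x \<partial>Rplus_law (M n) (X n j)) - (\<integral>x. f x \<partial>\<gamma>)\<bar>)"


section \<open>Configurations and Poisson processes\<close>

type_synonym config = "(real \<times> ennreal) set"

definition configs :: "config set" where
  "configs = {\<kappa>. \<kappa> \<subseteq> {0..1} \<times> Rplus \<and> (\<forall>t>0. finite (\<kappa> \<inter> {0..1} \<times> {ennreal t..}))}"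

text \<open>Number of points of \<open>\<kappa>\<close> in \<open>B\<close>, possibly infinite.\<close>

definition npoints :: "'p set \<Rightarrow> 'p set \<Rightarrow> ennreal" where
  "npoints \<kappa> B = emeasure (count_space UNIV) (\<kappa> \<inter> B)"

text \<open>Sets suffice as configurations (no multiplicities): a Poisson process whose intensity measure
  has no atoms is almost surely simple.\<close>

definition poisson_process ::
  "'b measure \<Rightarrow> (real \<times> ennreal) measure \<Rightarrow> ('b \<Rightarrow> config) \<Rightarrow> bool" where
  "poisson_process N \<Lambda> \<zeta> \<longleftrightarrow>
     (\<forall>\<omega>\<in>space N. \<zeta> \<omega> \<in> configs) \<and>
     (\<forall>B\<in>sets \<Lambda>. (\<lambda>\<omega>. npoints (\<zeta> \<omega>) B) \<in> borel_measurable N) \<and>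
     (\<forall>B\<in>sets \<Lambda>. emeasure \<Lambda> B < \<infinity> \<longrightarrow>
        (\<forall>k::nat. measure N {\<omega>\<in>space N. npoints (\<zeta> \<omega>) B = of_nat k} =
           measure \<Lambda> B ^ k / fact k * exp (- measure \<Lambda> B))) \<and>
     (\<forall>(m::nat) B. (\<forall>i<m. B i \<in> sets \<Lambda>) \<and> disjoint_family_on B {..<m} \<longrightarrow>
        prob_space.indep_vars N (\<lambda>_. borel) (\<lambda>i \<omega>. npoints (\<zeta> \<omega>) (B i)) {..<m})"

text \<open>The point process \<open>\<Sum>j\<le>n. \<delta>(j/n, x j)\<close>; points of height 0 do not belong to the state space.\<close>

definition row_config :: "nat \<Rightarrow> (nat \<Rightarrow> real) \<Rightarrow> config" where
  "row_config n x = (\<lambda>j. (real j / real n, ennreal (x j))) ` {1..n} \<inter> {0..1} \<times> Rplus"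


section \<open>The functionals of a configuration\<close>

text \<open>Where there is no unique highest point, the value 0 is a placeholder.\<close>

definition is_top :: "config \<Rightarrow> real \<times> ennreal \<Rightarrow> bool" where
  "is_top \<kappa> p \<longleftrightarrow> p \<in> \<kappa> \<and> (\<forall>q\<in>\<kappa>. snd q \<le> snd p)"

definition argmax_config :: "config \<Rightarrow> real" where
  "argmax_config \<kappa> = (if \<exists>!p. is_top \<kappa> p then fst (THE p. is_top \<kappa> p) else 0)"

text \<open>For locally finite configurations the suprema below are attained as soon as there are points,
  and the supremum of the empty set is 0 in \<^typ>\<open>ennreal\<close>. The conversion to \<^typ>\<open>real\<close> alters only
  the value \<open>\<infinity>\<close>, which requires a point at height \<open>\<infinity>\<close>.\<close>

definition max_config :: "config \<Rightarrow> real" where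
  "max_config \<kappa> = enn2real (Sup {x. \<exists>t. (t, x) \<in> \<kappa>})"

definition path_config :: "config \<Rightarrow> real \<Rightarrow> real" where
  "path_config \<kappa> = (\<lambda>t\<in>{0..1}. enn2real (Sup {x. \<exists>s\<ge>t. (s, x) \<in> \<kappa>}))"


section \<open>The Skorokhod space of left-continuous functions\<close>

definition D01 :: "(real \<Rightarrow> real) set" where
  "D01 = {f \<in> extensional {0..1}.
     (\<forall>t\<in>{0<..1}. (f \<longlongrightarrow> f t) (at_left t)) \<and>
     (\<forall>t\<in>{0..<1}. \<exists>l. (f \<longlongrightarrow> l) (at_right t))}"

definition time_changes :: "(real \<Rightarrow> real) set" where
  "time_changes = {\<theta>. strict_mono_on {0..1} \<theta> \<and> continuous_on {0..1} \<theta> \<and> \<theta> ` {0..1} = {0..1}}"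

definition skorokhod_dist :: "(real \<Rightarrow> real) \<Rightarrow> (real \<Rightarrow> real) \<Rightarrow> real" where
  "skorokhod_dist f g =
     (if f \<in> D01 \<and> g \<in> D01
      then Inf {e. 0 < e \<and> (\<exists>\<theta>\<in>time_changes. \<forall>t\<in>{0..1}. \<bar>\<theta> t - t\<bar> \<le> e \<and> \<bar>f t - g (\<theta> t)\<bar> \<le> e)}
      else 0)"

abbreviation skorokhod_top :: "(real \<Rightarrow> real) topology" where
  "skorokhod_top \<equiv> Metric_space.mtopology D01 skorokhod_dist"

text \<open>\<open>skorokhod_dist\<close> is a metric on \<open>D01\<close>.\<close>

lemma D01_bounded:
  assumes "f \<in> D01"
  shows "\<exists>B. \<forall>t\<in>{0..1}. \<bar>f t\<bar> \<le> B"
proof -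
  have loc: "\<exists>U B. open U \<and> t \<in> U \<and> (\<forall>s\<in>U \<inter> {0..1}. \<bar>f s\<bar> \<le> B)" if t: "t \<in> {0..1}" for t
  proof -
    have "\<exists>B. \<forall>\<^sub>F s in at_left t. s \<in> {0..1} \<longrightarrow> \<bar>f s\<bar> \<le> B"
    proof (cases "t = 0")
      case True
      have "\<forall>\<^sub>F s in at_left t. s < t" by (simp add: eventually_at_filter)
      then have "\<forall>\<^sub>F s in at_left t. s \<in> {0..1} \<longrightarrow> \<bar>f s\<bar> \<le> 0"
        by eventually_elim (use True in auto)
      then show ?thesis ..
    next
      case False
      then have "(f \<longlongrightarrow> f t) (at_left t)" using assms t by (auto simp: D01_def)
      then have "\<forall>\<^sub>F s in at_left t. dist (f s) (f t) < 1" by (rule tendstoD) simp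
      then have "\<forall>\<^sub>F s in at_left t. s \<in> {0..1} \<longrightarrow> \<bar>f s\<bar> \<le> \<bar>f t\<bar> + 1"
        by eventually_elim (auto simp: dist_real_def)
      then show ?thesis ..
    qed
    then obtain B1 where B1: "\<forall>\<^sub>F s in at_left t. s \<in> {0..1} \<longrightarrow> \<bar>f s\<bar> \<le> B1" ..
    have "\<exists>B. \<forall>\<^sub>F s in at_right t. s \<in> {0..1} \<longrightarrow> \<bar>f s\<bar> \<le> B"
    proof (cases "t = 1")
      case True
      have "\<forall>\<^sub>F s in at_right t. s > t" by (simp add: eventually_at_filter)
      then have "\<forall>\<^sub>F s in at_right t. s \<in> {0..1} \<longrightarrow> \<bar>f s\<bar> \<le> 0"
        by eventually_elim (use True in auto)
      then show ?thesis ..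
    next
      case False
      then obtain l where "(f \<longlongrightarrow> l) (at_right t)" using assms t by (force simp: D01_def)
      then have "\<forall>\<^sub>F s in at_right t. dist (f s) l < 1" by (rule tendstoD) simp
      then have "\<forall>\<^sub>F s in at_right t. s \<in> {0..1} \<longrightarrow> \<bar>f s\<bar> \<le> \<bar>l\<bar> + 1"
        by eventually_elim (auto simp: dist_real_def)
      then show ?thesis ..
    qed
    then obtain B2 where B2: "\<forall>\<^sub>F s in at_right t. s \<in> {0..1} \<longrightarrow> \<bar>f s\<bar> \<le> B2" ..
    define B where "B = max \<bar>f t\<bar> (max B1 B2)"
    have "\<forall>\<^sub>F s in at_left t. s \<in> {0..1} \<longrightarrow> \<bar>f s\<bar> \<le> B"
      using B1 by eventually_elim (auto simp: B_def)
    moreover have "\<forall>\<^sub>F s in at_right t. s \<in> {0..1} \<longrightarrow> \<bar>f s\<bar> \<le> B"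
      using B2 by eventually_elim (auto simp: B_def)
    ultimately have "\<forall>\<^sub>F s in at t. s \<in> {0..1} \<longrightarrow> \<bar>f s\<bar> \<le> B"
      by (simp add: eventually_at_split)
    then have "\<forall>\<^sub>F s in nhds t. s \<in> {0..1} \<longrightarrow> \<bar>f s\<bar> \<le> B"
      unfolding eventually_at_filter by eventually_elim (auto simp: B_def)
    then show ?thesis unfolding eventually_nhds by blast
  qed
  then obtain U b where Ub: "\<And>t. t \<in> {0..1} \<Longrightarrow> open (U t) \<and> t \<in> U t \<and> (\<forall>s\<in>U t \<inter> {0..1}. \<bar>f s\<bar> \<le> b t)"
    by metis
  obtain C where C: "C \<subseteq> {0..1}" "finite C" "{0..1} \<subseteq> (\<Union>t\<in>C. U t)"
    by (rule compactE_image[of "{0..1::real}" "{0..1}" U]) (use Ub in auto)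
  show ?thesis
  proof (intro exI ballI)
    fix s :: real assume s: "s \<in> {0..1}"
    then obtain t where t: "t \<in> C" "s \<in> U t" using C by blast
    then have "\<bar>f s\<bar> \<le> b t" using Ub[of t] C(1) s by blast
    also have "\<dots> \<le> \<bar>b t\<bar>" by simp
    also have "\<dots> \<le> (\<Sum>t\<in>C. \<bar>b t\<bar>)"
      using C(2) t(1) by (intro member_le_sum) auto
    finally show "\<bar>f s\<bar> \<le> (\<Sum>t\<in>C. \<bar>b t\<bar>)" .
  qed
qed

definition sk_close :: "(real \<Rightarrow> real) \<Rightarrow> (real \<Rightarrow> real) \<Rightarrow> real \<Rightarrow> bool" where
  "sk_close f g e \<longleftrightarrow> 0 < e \<and>
     (\<exists>\<theta>\<in>time_changes. \<forall>t\<in>{0..1}. \<bar>\<theta> t - t\<bar> \<le> e \<and> \<bar>f t - g (\<theta> t)\<bar> \<le> e)"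

lemma time_changes_id: "(\<lambda>t. t) \<in> time_changes"
  by (auto simp: time_changes_def strict_mono_on_def)

lemma sk_close_refl: "0 < e \<Longrightarrow> sk_close f f e"
  unfolding sk_close_def using time_changes_id by (intro conjI bexI[of _ "\<lambda>t. t"]) auto

lemma sk_close_sym: "sk_close g f e" if "sk_close f g e"
proof -
  from that obtain \<theta> where \<theta>: "\<theta> \<in> time_changes" "0 < e"
    "\<And>t. t \<in> {0..1} \<Longrightarrow> \<bar>\<theta> t - t\<bar> \<le> e \<and> \<bar>f t - g (\<theta> t)\<bar> \<le> e"
    by (auto simp: sk_close_def)
  have mono: "strict_mono_on {0..1} \<theta>" and im: "\<theta> ` {0..1} = {0..1}"
    and cont: "continuous_on {0..1} \<theta>"
    using \<theta>(1) by (auto simp: time_changes_def)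
  have inj: "inj_on \<theta> {0..1}" using mono by (rule strict_mono_on_imp_inj_on)
  define \<eta> where "\<eta> = inv_into {0..1} \<theta>"
  have \<eta>1: "\<theta> (\<eta> t) = t" "\<eta> t \<in> {0..1}" if "t \<in> {0..1}" for t
    using that im by (auto simp: \<eta>_def f_inv_into_f inv_into_into simp del: atLeastAtMost_iff)
  have \<eta>2: "\<eta> (\<theta> t) = t" if "t \<in> {0..1}" for t
    using that inj by (simp add: \<eta>_def)
  have "strict_mono_on {0..1} \<eta>"
  proof (rule strict_mono_onI)
    fix r s :: real assume rs: "r \<in> {0..1}" "s \<in> {0..1}" "r < s"
    show "\<eta> r < \<eta> s"
    proof (rule ccontr)
      assume "\<not> \<eta> r < \<eta> s"
      then have "\<theta> (\<eta> s) \<le> \<theta> (\<eta> r)"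
        using \<eta>1(2)[OF rs(1)] \<eta>1(2)[OF rs(2)] mono
        by (metis less_eq_real_def not_less strict_mono_onD)
      then show False using \<eta>1(1) rs by auto
    qed
  qed
  moreover have "continuous_on {0..1} \<eta>"
    using continuous_on_inv[OF cont, of \<eta>] \<eta>2 im by simp
  moreover have "\<eta> ` {0..1} = {0..1}"
  proof (intro subset_antisym subsetI)
    fix t :: real assume t: "t \<in> {0..1}"
    then have "\<theta> t \<in> {0..1}" using im by blast
    then show "t \<in> \<eta> ` {0..1}" using \<eta>2[OF t] by (intro image_eqI[of _ _ "\<theta> t"]) auto
  qed (use \<eta>1(2) in blast)
  ultimately have "\<eta> \<in> time_changes" by (simp add: time_changes_def)
  moreover have "\<bar>\<eta> t - t\<bar> \<le> e \<and> \<bar>g t - f (\<eta> t)\<bar> \<le> e" if "t \<in> {0..1}" for t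
    using \<theta>(3)[OF \<eta>1(2)[OF that]] \<eta>1(1)[OF that] by (simp add: abs_minus_commute)
  ultimately show ?thesis using \<theta>(2) unfolding sk_close_def by blast
qed

lemma sk_close_trans: "sk_close f h (a + b)" if "sk_close f g a" "sk_close g h b"
proof -
  from that(1) obtain \<theta> where \<theta>: "\<theta> \<in> time_changes" "0 < a"
    "\<And>t. t \<in> {0..1} \<Longrightarrow> \<bar>\<theta> t - t\<bar> \<le> a \<and> \<bar>f t - g (\<theta> t)\<bar> \<le> a"
    by (auto simp: sk_close_def)
  from that(2) obtain \<eta> where \<eta>: "\<eta> \<in> time_changes" "0 < b"
    "\<And>t. t \<in> {0..1} \<Longrightarrow> \<bar>\<eta> t - t\<bar> \<le> b \<and> \<bar>g t - h (\<eta> t)\<bar> \<le> b"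
    by (auto simp: sk_close_def)
  have im: "\<theta> ` {0..1} = {0..1}" "\<eta> ` {0..1} = {0..1}"
    using \<theta>(1) \<eta>(1) by (auto simp: time_changes_def)
  then have in01: "\<theta> t \<in> {0..1}" if "t \<in> {0..1}" for t using that by blast
  have "strict_mono_on {0..1} (\<lambda>t. \<eta> (\<theta> t))"
  proof (rule strict_mono_onI)
    fix r s :: real assume rs: "r \<in> {0..1}" "s \<in> {0..1}" "r < s"
    have "\<theta> r < \<theta> s"
      using \<theta>(1) rs by (intro strict_mono_onD[of "{0..1}" \<theta>]) (simp_all add: time_changes_def)
    then show "\<eta> (\<theta> r) < \<eta> (\<theta> s)"
      using \<eta>(1) in01[OF rs(1)] in01[OF rs(2)]
      by (intro strict_mono_onD[of "{0..1}" \<eta>]) (simp_all add: time_changes_def)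
  qed
  moreover have "continuous_on {0..1} (\<lambda>t. \<eta> (\<theta> t))"
  proof (rule continuous_on_compose2[of "{0..1}" \<eta> _ \<theta>])
    show "continuous_on {0..1} \<eta>" "continuous_on {0..1} \<theta>"
      using \<theta>(1) \<eta>(1) by (simp_all add: time_changes_def)
    show "\<theta> ` {0..1} \<subseteq> {0..1}" by (rule equalityD1[OF im(1)])
  qed
  moreover have "(\<lambda>t. \<eta> (\<theta> t)) ` {0..1} = {0..1}"
    using im image_image[of \<eta> \<theta> "{0..1}"] by simp
  ultimately have "(\<lambda>t. \<eta> (\<theta> t)) \<in> time_changes" by (simp add: time_changes_def)
  moreover have "\<bar>\<eta> (\<theta> t) - t\<bar> \<le> a + b \<and> \<bar>f t - h (\<eta> (\<theta> t))\<bar> \<le> a + b" if "t \<in> {0..1}" for t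
    using \<theta>(3)[OF that] \<eta>(3)[OF in01[OF that]] by linarith
  ultimately show ?thesis using \<theta>(2) \<eta>(2)
    unfolding sk_close_def by (intro conjI bexI[of _ "\<lambda>t. \<eta> (\<theta> t)"]) simp_all
qed

lemma sk_close_ex: "\<exists>e. sk_close f g e" if f: "f \<in> D01" and g: "g \<in> D01"
proof -
  obtain B where B: "\<And>t. t \<in> {0..1} \<Longrightarrow> \<bar>f t\<bar> \<le> B" using D01_bounded[OF f] by blast
  obtain C where C: "\<And>t. t \<in> {0..1} \<Longrightarrow> \<bar>g t\<bar> \<le> C" using D01_bounded[OF g] by blast
  have "\<bar>f t - g t\<bar> \<le> \<bar>B\<bar> + \<bar>C\<bar> + 1" if "t \<in> {0..1}" for t
    using B[OF that] C[OF that] by linarith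
  then have "sk_close f g (\<bar>B\<bar> + \<bar>C\<bar> + 1)"
    unfolding sk_close_def using time_changes_id by (intro conjI bexI[of _ "\<lambda>t. t"]) auto
  then show ?thesis ..
qed

lemma sk_close_imp_eq:
  assumes f: "f \<in> D01" and g: "g \<in> D01" and close: "\<And>e. 0 < e \<Longrightarrow> sk_close f g e"
  shows "f = g"
proof -
  have near: "\<exists>s\<in>{0..1}. \<bar>s - t\<bar> \<le> e \<and> \<bar>f t - g s\<bar> \<le> e \<and> (t = 0 \<longrightarrow> s = 0)"
    if t: "t \<in> {0..1}" and "0 < e" for t e
  proof -
    from close[OF \<open>0 < e\<close>] obtain \<theta> where \<theta>: "\<theta> \<in> time_changes"
      "\<And>t. t \<in> {0..1} \<Longrightarrow> \<bar>\<theta> t - t\<bar> \<le> e \<and> \<bar>f t - g (\<theta> t)\<bar> \<le> e"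
      by (auto simp: sk_close_def)
    have im: "\<theta> ` {0..1} = {0..1}" using \<theta>(1) by (auto simp: time_changes_def)
    have "\<theta> 0 = 0"
    proof -
      have "0 \<in> \<theta> ` {0..1}" using im by simp
      then obtain u where u: "u \<in> {0..1}" "\<theta> u = 0" by (metis imageE)
      have z: "0 \<le> \<theta> 0" using im by (metis atLeastAtMost_iff imageI order_refl zero_le_one)
      show ?thesis
      proof (cases "u = 0")
        case False
        then have "\<theta> 0 < \<theta> u"
          using \<theta>(1) u(1) by (intro strict_mono_onD[of "{0..1}" \<theta>]) (auto simp: time_changes_def)
        then show ?thesis using u z by simp
      qed (use u in simp)
    qed
    moreover have "\<theta> t \<in> {0..1}" using im t by blast
    ultimately show ?thesis using \<theta>(2)[OF t] by (intro bexI[of _ "\<theta> t"]) auto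
  qed
  have "f t = g t" if t: "t \<in> {0..1}" for t
  proof (cases "t = 0")
    case True
    have "\<bar>f 0 - g 0\<bar> \<le> 0 + e" if "0 < e" for e
    proof -
      obtain s where "\<bar>f 0 - g s\<bar> \<le> e" "s = 0"
        using near[of 0 e] \<open>0 < e\<close> by auto
      then show ?thesis by simp
    qed
    then have "\<bar>f 0 - g 0\<bar> \<le> 0" by (rule field_le_epsilon)
    then show ?thesis using True by simp
  next
    case False
    with t have t': "t \<in> {0<..1}" by auto
    have "\<bar>f t - g t\<bar> \<le> 0 + e" if e: "0 < e" for e
    proof -
      have "(f \<longlongrightarrow> f t) (at_left t)" "(g \<longlongrightarrow> g t) (at_left t)"
        using f g t' by (auto simp: D01_def)
      then have "\<forall>\<^sub>F s in at_left t. dist (f s) (f t) < e / 3 \<and> dist (g s) (g t) < e / 3"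
        using e by (intro eventually_conj tendstoD) auto
      then obtain a where a: "a < t"
        "\<And>s. a < s \<Longrightarrow> s < t \<Longrightarrow> dist (f s) (f t) < e / 3 \<and> dist (g s) (g t) < e / 3"
        unfolding eventually_at_left_field by blast
      define b where "b = max a 0"
      have b: "b < t" using a t' by (auto simp: b_def)
      define r where "r = (b + t) / 2"
      define d where "d = min (e / 3) ((t - b) / 4)"
      have r: "r \<in> {0..1}" "b < r" "r < t" using b t' by (auto simp: r_def b_def)
      have "0 < d" using e b by (auto simp: d_def)
      then obtain s where s: "\<bar>s - r\<bar> \<le> d" "\<bar>f r - g s\<bar> \<le> d"
        using near[OF r(1)] by blast
      have "b < s" "s < t"
      proof -
        have "d \<le> (t - b) / 4" unfolding d_def by (rule min.cobounded2)
        with s(1) b show "b < s" "s < t" by (simp_all add: r_def abs_le_iff field_simps)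
      qed
      then have "dist (g s) (g t) < e / 3" "dist (f r) (f t) < e / 3"
        using a(2) r by (auto simp: b_def)
      moreover have "\<bar>f r - g s\<bar> \<le> e / 3" using s(2) by (simp add: d_def)
      ultimately show ?thesis unfolding dist_real_def by linarith
    qed
    then have "\<bar>f t - g t\<bar> \<le> 0" by (rule field_le_epsilon)
    then show ?thesis by simp
  qed
  then show ?thesis
    using f g by (intro extensionalityI[of f "{0..1}" g]) (auto simp: D01_def)
qed

lemma skorokhod_dist_eq: "skorokhod_dist f g = Inf {e. sk_close f g e}" if "f \<in> D01" "g \<in> D01"
  using that by (simp add: skorokhod_dist_def sk_close_def)

lemma sk_close_bdd: "bdd_below {e. sk_close f g e}"
  by (rule bdd_belowI[of _ 0]) (auto simp: sk_close_def)

lemma skorokhod_dist_nonneg: "0 \<le> skorokhod_dist f g"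
proof (cases "f \<in> D01 \<and> g \<in> D01")
  case True
  then have D: "f \<in> D01" "g \<in> D01" by auto
  show ?thesis
    unfolding skorokhod_dist_eq[OF D]
  proof (rule cInf_greatest)
    show "{e. sk_close f g e} \<noteq> {}" using sk_close_ex[OF D] by blast
    show "0 \<le> e" if "e \<in> {e. sk_close f g e}" for e using that by (simp add: sk_close_def)
  qed
qed (auto simp: skorokhod_dist_def)

lemma sk_close_less: "\<exists>e'<e. sk_close f g e'"
  if "f \<in> D01" "g \<in> D01" "skorokhod_dist f g < e"
  using that sk_close_ex[OF that(1,2)] cInf_lessD[of "{e. sk_close f g e}" e]
  by (auto simp: skorokhod_dist_eq)

lemma sk_close_le: "skorokhod_dist f g \<le> e"
  if "f \<in> D01" "g \<in> D01" "sk_close f g e"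
  using that by (auto simp: skorokhod_dist_eq intro!: cInf_lower sk_close_bdd)

lemma sk_close_mono: "sk_close f g e'" if "sk_close f g e" "e \<le> e'"
proof -
  from that(1) obtain \<theta> where \<theta>: "\<theta> \<in> time_changes" "0 < e"
    "\<And>t. t \<in> {0..1} \<Longrightarrow> \<bar>\<theta> t - t\<bar> \<le> e \<and> \<bar>f t - g (\<theta> t)\<bar> \<le> e"
    by (auto simp: sk_close_def)
  have "\<bar>\<theta> t - t\<bar> \<le> e' \<and> \<bar>f t - g (\<theta> t)\<bar> \<le> e'" if "t \<in> {0..1}" for t
    using \<theta>(3)[OF that] \<open>e \<le> e'\<close> by linarith
  then show ?thesis
    using \<theta>(1,2) that(2) unfolding sk_close_def by (intro conjI bexI[of _ \<theta>]) auto
qed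

lemma Metric_space_skorokhod: "Metric_space D01 skorokhod_dist"
proof
  fix f g :: "real \<Rightarrow> real"
  show "0 \<le> skorokhod_dist f g" by (rule skorokhod_dist_nonneg)
  show "skorokhod_dist f g = skorokhod_dist g f"
  proof (cases "f \<in> D01 \<and> g \<in> D01")
    case True
    have "{e. sk_close f g e} = {e. sk_close g f e}" using sk_close_sym by blast
    with True show ?thesis by (simp add: skorokhod_dist_eq)
  qed (auto simp: skorokhod_dist_def)
next
  fix f g assume fg: "f \<in> D01" "g \<in> D01"
  show "skorokhod_dist f g = 0 \<longleftrightarrow> f = g"
  proof
    assume "skorokhod_dist f g = 0"
    have "sk_close f g e" if "0 < e" for e
    proof -
      obtain e' where "e' < e" "sk_close f g e'"
        using sk_close_less[OF fg, of e] \<open>skorokhod_dist f g = 0\<close> \<open>0 < e\<close> by auto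
      then show ?thesis using sk_close_mono[of f g e' e] by simp
    qed
    then show "f = g" by (rule sk_close_imp_eq[OF fg])
  next
    assume "f = g"
    then have "skorokhod_dist f g \<le> 0 + e" if "0 < e" for e
      using sk_close_le[OF fg, of e] sk_close_refl[OF that, of f] by simp
    then have "skorokhod_dist f g \<le> 0" by (rule field_le_epsilon)
    with skorokhod_dist_nonneg[of f g] show "skorokhod_dist f g = 0" by simp
  qed
next
  fix f g h assume D: "f \<in> D01" "g \<in> D01" "h \<in> D01"
  show "skorokhod_dist f h \<le> skorokhod_dist f g + skorokhod_dist g h"
  proof (rule field_le_epsilon)
    fix e :: real assume "0 < e"
    then have e2: "x < x + e / 2" for x by simp
    obtain a where a: "a < skorokhod_dist f g + e / 2" "sk_close f g a"
      using sk_close_less[OF D(1,2) e2] by blast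
    obtain b where b: "b < skorokhod_dist g h + e / 2" "sk_close g h b"
      using sk_close_less[OF D(2,3) e2] by blast
    have "skorokhod_dist f h \<le> a + b"
      by (rule sk_close_le[OF D(1,3) sk_close_trans[OF a(2) b(2)]])
    then show "skorokhod_dist f h \<le> skorokhod_dist f g + skorokhod_dist g h + e"
      using a(1) b(1) by linarith
  qed
qed

end

theory Submission
  imports Defs
begin

text \<open>
  The functions in \<open>CK_plus_from t\<close> form a cone, so \<open>Delta\<close> can only take the values 0 and infinity. From
  some row on, therefore, every law of that row, scaled by \<open>row_sum c n / c n j\<close>, coincides with \<open>\<gamma>\<close>
  above \<open>t\<close>. Hence the mean number of points of row \<open>n\<close> in a rectangle is the mass of the base under
  \<open>position_measure c n\<close> times the \<open>\<gamma>\<close>-mass of the height interval, and weak convergence of the position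
  measures makes it converge to the intensity of the Poisson process when the base has a \<open>\<mu>\<close>-null
  boundary (\<open>regular_rectangle\<close>).

  A row avoids a set \<open>B\<close> with probability \<open>\<Prod>j. 1 - p j\<close>, where the hitting probabilities \<open>p j\<close> are
  uniformly small and add up to the mean. In the limit this is \<open>exp (- \<Lambda> B)\<close>, the avoidance probability
  of the Poisson process (\<open>regular_avoids_limit\<close>). By inclusion-exclusion the avoidance probabilities of
  unions of grid cells determine the joint law of the set of occupied cells, which therefore converges
  for every finite grid (\<open>occ_convergence\<close>).

  It remains to see that the occupied cells of a fine grid determine each functional up to a small error
  outside an event of small probability (\<open>functional_convergence\<close>). Every point is replaced by a fixed
  point of its cell. Points below a level \<open>t\<close> change the maximum and the path by at most \<open>t\<close>; points above
  the grid are rare. The maximum then moves by at most the height of a grid row (\<open>max_config_snap\<close>). The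
  position of the maximum is determined up to the width of a grid column if there is a point above \<open>t\<close>
  and no grid row contains two points (\<open>argmax_config_snap\<close>); if the process is almost surely nonempty then \<open>t\<close> can be
  chosen so low that the former is likely. The path is determined up to a small Skorokhod distance if no
  grid column contains two points, since a time change can then move all points to the middle of their columns
  (\<open>path_config_snap\<close>). Before the limit and in the limit alike, a set contains two points with probability
  at most the square of the mean number of points in it (\<open>\<xi>_multiple\<close>, \<open>\<zeta>_multiple\<close>). Over the rows, or over
  the columns, of the grid these squares have a small sum if every single mean is small; this can be achieved because
  \<open>\<gamma>\<close> and, for the path, \<open>\<mu>\<close> have no atoms.

  Two general facts support this: convergence in distribution in a metric space follows from
  approximation by finitely valued variables (\<open>conv_in_distribution_finite_approxI\<close>), and a random element
  of the Skorokhod space is Borel measurable as soon as its coordinates are (\<open>measurable_skorokhodI\<close>).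
\<close>


section \<open>Convergence in distribution through finite approximations\<close>

lemma space_borel_of [simp]: "space (borel_of T) = topspace T"
  unfolding borel_of_def by (rule space_measure_of) (auto dest: openin_subset)

lemma openin_sets_borel_of: "openin T U \<Longrightarrow> U \<in> sets (borel_of T)"
  unfolding borel_of_def by (subst sets_measure_of) (auto dest: openin_subset)

lemma borel_of_euclidean: "borel_of euclidean = borel"
  by (simp add: borel_of_def borel_def)

lemma continuous_map_borel_measurable:
  fixes f :: "'a \<Rightarrow> real"
  assumes "continuous_map T euclideanreal f"
  shows "f \<in> borel_measurable (borel_of T)"
proof (rule borel_measurableI)
  fix U :: "real set" assume "open U"
  then have "openin T {x \<in> topspace T. f x \<in> U}"
    using assms openin_continuous_map_preimage by fastforce
  moreover have "f -` U \<inter> space (borel_of T) = {x \<in> topspace T. f x \<in> U}" by auto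
  ultimately show "f -` U \<inter> space (borel_of T) \<in> sets (borel_of T)"
    using openin_sets_borel_of by metis
qed

context Metric_space
begin

lemma lipschitz_imp_continuous_map:
  fixes g :: "'a \<Rightarrow> real"
  assumes "\<And>x y. x \<in> M \<Longrightarrow> y \<in> M \<Longrightarrow> \<bar>g x - g y\<bar> \<le> K * d x y"
  shows "continuous_map mtopology euclideanreal g"
proof (rule continuous_map[THEN iffD2], intro conjI allI impI)
  fix U :: "real set" assume "openin euclideanreal U"
  then have U: "open U" by simp
  show "openin mtopology {x \<in> topspace mtopology. g x \<in> U}"
    unfolding openin_mtopology
  proof (intro conjI allI impI)
    fix x assume "x \<in> {x \<in> topspace mtopology. g x \<in> U}"
    then have x: "x \<in> M" "g x \<in> U" by auto
    from U x(2) obtain e where e: "0 < e" "\<And>v. \<bar>v - g x\<bar> < e \<Longrightarrow> v \<in> U"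
      by (auto simp: open_real)
    have "mball x (e / (\<bar>K\<bar> + 1)) \<subseteq> {x \<in> topspace mtopology. g x \<in> U}"
    proof
      fix y assume y: "y \<in> mball x (e / (\<bar>K\<bar> + 1))"
      then have yM: "y \<in> M" and "d x y * (\<bar>K\<bar> + 1) < e" by (auto simp: field_simps)
      moreover have "\<bar>g y - g x\<bar> \<le> d x y * (\<bar>K\<bar> + 1)"
      proof -
        have "\<bar>g y - g x\<bar> \<le> K * d x y" using assms[OF x(1) yM] by (simp add: abs_minus_commute)
        also have "\<dots> \<le> (\<bar>K\<bar> + 1) * d x y" by (intro mult_right_mono) auto
        finally show ?thesis by (simp add: mult.commute)
      qed
      ultimately show "y \<in> {x \<in> topspace mtopology. g x \<in> U}" using e(2)[of "g y"] by auto
    qed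
    moreover have "0 < e / (\<bar>K\<bar> + 1)" using e(1) by (intro divide_pos_pos) auto
    ultimately show "\<exists>r>0. mball x r \<subseteq> {x \<in> topspace mtopology. g x \<in> U}" by blast
  qed auto
qed auto

text \<open>The infimal convolution of \<open>f\<close> with \<open>m d\<close> is the largest \<open>m\<close>-Lipschitz function below \<open>f\<close>. Far
  from \<open>x\<close> the penalty \<open>m d\<close> exceeds the oscillation \<open>2 B\<close> of \<open>f\<close>, so for large \<open>m\<close> only values of \<open>f\<close>
  near \<open>x\<close> matter at \<open>x\<close>.\<close>

lemma lipschitz_approx_from_below:
  fixes f :: "'a \<Rightarrow> real"
  assumes cont: "continuous_map mtopology euclideanreal f"
    and bound: "\<And>x. x \<in> M \<Longrightarrow> \<bar>f x\<bar> \<le> B"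
  obtains g :: "nat \<Rightarrow> 'a \<Rightarrow> real"
  where "\<And>m x y. x \<in> M \<Longrightarrow> y \<in> M \<Longrightarrow> \<bar>g m x - g m y\<bar> \<le> real m * d x y"
    and "\<And>m x. x \<in> M \<Longrightarrow> \<bar>g m x\<bar> \<le> B"
    and "\<And>m x. x \<in> M \<Longrightarrow> g m x \<le> f x"
    and "\<And>x. x \<in> M \<Longrightarrow> (\<lambda>m. g m x) \<longlonglongrightarrow> f x"
proof -
  define g where "g = (\<lambda>(m::nat) x. INF y\<in>M. f y + real m * d x y)"
  have low: "- B \<le> f y + real m * d x y" if "y \<in> M" for x y m
    using bound[OF that] mult_nonneg_nonneg[of "real m" "d x y"] nonneg[of x y] by linarith
  then have bdd: "bdd_below ((\<lambda>y. f y + real m * d x y) ` M)" for x m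
    by (intro bdd_belowI[of _ "- B"]) auto
  have le: "g m x \<le> f y + real m * d x y" if "y \<in> M" for x y m
    unfolding g_def by (rule cINF_lower[OF bdd that])
  have ge: "v \<le> g m x" if "x \<in> M" "\<And>y. y \<in> M \<Longrightarrow> v \<le> f y + real m * d x y" for v x m
    unfolding g_def using that by (intro cINF_greatest) auto
  have gf: "g m x \<le> f x" if "x \<in> M" for m x using le[OF that, of m x] that by simp
  have half: "g m x - real m * d x y \<le> g m y" if "x \<in> M" "y \<in> M" for m x y
  proof (rule ge[OF that(2)])
    fix z assume z: "z \<in> M"
    have "real m * d x z \<le> real m * (d x y + d y z)"
      using that z triangle by (intro mult_left_mono) auto
    then show "g m x - real m * d x y \<le> f z + real m * d y z"
      using le[OF z, of m x] by (simp add: distrib_left)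
  qed
  have conv: "(\<lambda>m. g m x) \<longlonglongrightarrow> f x" if x: "x \<in> M" for x
  proof (rule LIMSEQ_I)
    fix e :: real assume "0 < e"
    have "openin mtopology {y \<in> topspace mtopology. f y \<in> ball (f x) (e/2)}"
      using cont by (rule openin_continuous_map_preimage) simp
    then obtain r where r: "0 < r" "mball x r \<subseteq> {y \<in> topspace mtopology. f y \<in> ball (f x) (e/2)}"
      using x \<open>0 < e\<close> unfolding openin_mtopology by fastforce
    obtain m0 :: nat where m0: "2 * B / r \<le> real m0" using real_arch_simple by blast
    have "f x - e/2 \<le> g m x" if m: "m0 \<le> m" for m
    proof (rule ge[OF x])
      fix y assume y: "y \<in> M"
      show "f x - e/2 \<le> f y + real m * d x y"
      proof (cases "d x y < r")
        case True
        then have "y \<in> mball x r" using x y by auto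
        then have "\<bar>f x - f y\<bar> < e/2" using r(2) by (auto simp: dist_real_def)
        then show ?thesis using mult_nonneg_nonneg[of "real m" "d x y"] nonneg[of x y] by linarith
      next
        case False
        have "2 * B \<le> real m0 * r" using m0 r(1) by (simp add: field_simps)
        also have "\<dots> \<le> real m * d x y"
          using m False r(1) by (intro mult_mono) auto
        finally show ?thesis using bound[OF x] bound[OF y] \<open>0 < e\<close> by (simp add: abs_le_iff)
      qed
    qed
    then have "norm (g m x - f x) < e" if "m0 \<le> m" for m
      using that gf[OF x, of m] \<open>0 < e\<close> by (fastforce simp: abs_less_iff)
    then show "\<exists>no. \<forall>m\<ge>no. norm (g m x - f x) < e" by blast
  qed
  show thesis
  proof (rule that[of g])
    show "\<bar>g m x - g m y\<bar> \<le> real m * d x y" if "x \<in> M" "y \<in> M" for m x y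
      using half[OF that, of m] half[OF that(2,1), of m] by (simp add: abs_le_iff commute[of y x])
    show "\<bar>g m x\<bar> \<le> B" if "x \<in> M" for m x
    proof -
      have "- B \<le> g m x" by (rule ge[OF that low])
      then show ?thesis using gf[OF that, of m] bound[OF that] by linarith
    qed
  qed (use gf conv in auto)
qed

text \<open>Approximation from below by Lipschitz functions gives the lower half of the convergence for every
  bounded continuous \<open>f\<close>; applied to \<open>- f\<close> it gives the upper half.\<close>

lemma conv_in_distribution_lipschitzI:
  assumes P: "\<And>n. prob_space (P n)" and Q: "prob_space Q"
    and Y: "\<And>n. Y n \<in> P n \<rightarrow>\<^sub>M borel_of mtopology" and Z: "Z \<in> Q \<rightarrow>\<^sub>M borel_of mtopology"
    and lip: "\<And>(g :: 'a \<Rightarrow> real) K B. 0 \<le> K \<Longrightarrow> (\<And>x y. x \<in> M \<Longrightarrow> y \<in> M \<Longrightarrow> \<bar>g x - g y\<bar> \<le> K * d x y) \<Longrightarrow>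
      (\<And>x. x \<in> M \<Longrightarrow> \<bar>g x\<bar> \<le> B) \<Longrightarrow>
      (\<lambda>n. \<integral>\<omega>. g (Y n \<omega>) \<partial>P n) \<longlonglongrightarrow> (\<integral>\<omega>. g (Z \<omega>) \<partial>Q)"
  shows "conv_in_distribution mtopology P Y Q Z"
proof -
  interpret Q: prob_space Q by (rule Q)
  have YM: "Y n \<omega> \<in> M" if "\<omega> \<in> space (P n)" for n \<omega>
    using measurable_space[OF Y that] by simp
  have ZM: "Z \<omega> \<in> M" if "\<omega> \<in> space Q" for \<omega>
    using measurable_space[OF Z that] by simp
  have meas: "(\<lambda>\<omega>. g (Y n \<omega>)) \<in> borel_measurable (P n)" "(\<lambda>\<omega>. g (Z \<omega>)) \<in> borel_measurable Q"
    if "continuous_map mtopology euclideanreal g" for g n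
    using measurable_compose[OF Y continuous_map_borel_measurable[OF that]]
      measurable_compose[OF Z continuous_map_borel_measurable[OF that]] .
  have lower: "\<forall>\<^sub>F n in sequentially. (\<integral>\<omega>. f (Z \<omega>) \<partial>Q) - e < (\<integral>\<omega>. f (Y n \<omega>) \<partial>P n)"
    if cont: "continuous_map mtopology euclideanreal f" and bound: "\<And>x. x \<in> M \<Longrightarrow> \<bar>f x\<bar> \<le> B"
      and "0 < e" for f B and e :: real
  proof -
    obtain g where g: "\<And>m x y. x \<in> M \<Longrightarrow> y \<in> M \<Longrightarrow> \<bar>g m x - g m y\<bar> \<le> real m * d x y"
      "\<And>m x. x \<in> M \<Longrightarrow> \<bar>g m x\<bar> \<le> B" "\<And>m x. x \<in> M \<Longrightarrow> g m x \<le> f x"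
      "\<And>x. x \<in> M \<Longrightarrow> (\<lambda>m. g m x) \<longlonglongrightarrow> f x"
      using lipschitz_approx_from_below[OF cont bound] by blast
    have gc: "continuous_map mtopology euclideanreal (g m)" for m
      using g(1) by (rule lipschitz_imp_continuous_map)
    have "(\<lambda>m. \<integral>\<omega>. g m (Z \<omega>) \<partial>Q) \<longlonglongrightarrow> (\<integral>\<omega>. f (Z \<omega>) \<partial>Q)"
    proof (rule integral_dominated_convergence[where w="\<lambda>_. B"])
      show "AE x in Q. (\<lambda>m. g m (Z x)) \<longlonglongrightarrow> f (Z x)" using g(4) ZM by auto
      show "AE x in Q. norm (g m (Z x)) \<le> B" for m using g(2) ZM by auto
    qed (use meas[OF cont] meas[OF gc] in auto)
    from order_tendstoD(1)[OF this, of "(\<integral>\<omega>. f (Z \<omega>) \<partial>Q) - e"] \<open>0 < e\<close>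
    obtain m where m: "(\<integral>\<omega>. f (Z \<omega>) \<partial>Q) - e < (\<integral>\<omega>. g m (Z \<omega>) \<partial>Q)"
      by (auto simp: eventually_sequentially)
    have "(\<lambda>n. \<integral>\<omega>. g m (Y n \<omega>) \<partial>P n) \<longlonglongrightarrow> (\<integral>\<omega>. g m (Z \<omega>) \<partial>Q)"
      using g(1,2) by (intro lip[of "real m"]) auto
    from order_tendstoD(1)[OF this m] show ?thesis
    proof eventually_elim
      case (elim n)
      interpret prob_space "P n" by (rule P)
      have "(\<integral>\<omega>. g m (Y n \<omega>) \<partial>P n) \<le> (\<integral>\<omega>. f (Y n \<omega>) \<partial>P n)"
      proof (rule integral_mono)
        show "integrable (P n) (\<lambda>\<omega>. g m (Y n \<omega>))"
          using g(2) YM meas(1)[OF gc] by (intro integrable_const_bound[where B=B]) auto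
        show "integrable (P n) (\<lambda>\<omega>. f (Y n \<omega>))"
          using bound YM meas(1)[OF cont] by (intro integrable_const_bound[where B=B]) auto
      qed (use g(3) YM in auto)
      then show ?case using elim by simp
    qed
  qed
  have "(\<lambda>n. \<integral>\<omega>. f (Y n \<omega>) \<partial>P n) \<longlonglongrightarrow> (\<integral>\<omega>. f (Z \<omega>) \<partial>Q)"
    if cont: "continuous_map mtopology euclideanreal f" and "bounded (f ` M)" for f :: "'a \<Rightarrow> real"
  proof -
    obtain B where B: "\<And>x. x \<in> M \<Longrightarrow> \<bar>f x\<bar> \<le> B"
      using \<open>bounded (f ` M)\<close> by (auto simp: bounded_iff)
    have neg: "continuous_map mtopology euclideanreal (\<lambda>x. - f x)"
      using cont by (rule continuous_map_minus)
    have neg_B: "\<bar>- f x\<bar> \<le> B" if "x \<in> M" for x using B[OF that] by simp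
    show ?thesis
    proof (rule tendstoI)
      fix e :: real assume "0 < e"
      show "\<forall>\<^sub>F n in sequentially. dist (\<integral>\<omega>. f (Y n \<omega>) \<partial>P n) (\<integral>\<omega>. f (Z \<omega>) \<partial>Q) < e"
        using lower[OF cont B \<open>0 < e\<close>, simplified] lower[OF neg neg_B \<open>0 < e\<close>, simplified]
        by eventually_elim (auto simp: dist_real_def)
    qed
  qed
  then show ?thesis
    unfolding conv_in_distribution_def weak_conv_top_def
    using Y Z by (auto simp: integral_distr continuous_map_borel_measurable)
qed

text \<open>The mean of a function of a finitely valued variable is a finite sum of point probabilities. If
  \<open>g\<close> is \<open>K\<close>-Lipschitz and bounded by \<open>B\<close>, replacing \<open>Y n\<close> by \<open>r (S n)\<close> and \<open>Z\<close> by \<open>r T\<close> changes the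
  means by at most \<open>(K + 2 B) e\<close>.\<close>

lemma conv_in_distribution_finite_approxI:
  fixes P :: "nat \<Rightarrow> 'b measure" and Q :: "'c measure"
  assumes P: "\<And>n. prob_space (P n)" and Q: "prob_space Q"
    and Y: "\<And>n. Y n \<in> P n \<rightarrow>\<^sub>M borel_of mtopology" and Z: "Z \<in> Q \<rightarrow>\<^sub>M borel_of mtopology"
    and approx: "\<And>e. 0 < e \<Longrightarrow> \<exists>(J :: 'q set) r S T.
      finite J \<and> r ` J \<subseteq> M \<and>
      (\<forall>n. S n \<in> P n \<rightarrow>\<^sub>M count_space J) \<and> T \<in> Q \<rightarrow>\<^sub>M count_space J \<and>
      (\<forall>s\<in>J. (\<lambda>n. measure (P n) {\<omega>\<in>space (P n). S n \<omega> = s}) \<longlonglongrightarrow> measure Q {\<omega>\<in>space Q. T \<omega> = s}) \<and>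
      (\<forall>\<^sub>F n in sequentially. \<exists>E\<in>sets (P n). measure (P n) E \<le> e \<and>
         (\<forall>\<omega>\<in>space (P n) - E. d (Y n \<omega>) (r (S n \<omega>)) \<le> e)) \<and>
      (\<exists>E\<in>sets Q. measure Q E \<le> e \<and> (\<forall>\<omega>\<in>space Q - E. d (Z \<omega>) (r (T \<omega>)) \<le> e))"
  shows "conv_in_distribution mtopology P Y Q Z"
proof (rule conv_in_distribution_lipschitzI[OF P Q Y Z])
  fix g :: "'a \<Rightarrow> real" and K B
  assume K: "0 \<le> K" and lip: "\<And>x y. x \<in> M \<Longrightarrow> y \<in> M \<Longrightarrow> \<bar>g x - g y\<bar> \<le> K * d x y"
    and bd: "\<And>x. x \<in> M \<Longrightarrow> \<bar>g x\<bar> \<le> B"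
  have gc: "g \<in> borel_measurable (borel_of mtopology)"
    using lip by (intro continuous_map_borel_measurable lipschitz_imp_continuous_map)
  have finite_mean: "(\<integral>\<omega>. g (r (S \<omega>)) \<partial>R) = (\<Sum>s\<in>J. g (r s) * measure R {\<omega>\<in>space R. S \<omega> = s})"
    if "prob_space R" "finite J" "S \<in> R \<rightarrow>\<^sub>M count_space J" for R :: "'d measure" and J :: "'q set" and r S
  proof -
    interpret prob_space R by fact
    have SJ: "S \<omega> \<in> J" if "\<omega> \<in> space R" for \<omega>
      using measurable_space[OF \<open>S \<in> _\<close> that] by simp
    have m: "{\<omega>\<in>space R. S \<omega> = s} \<in> sets R" if "s \<in> J" for s
      using measurable_sets[OF \<open>S \<in> _\<close>, of "{s}"] that by (simp add: vimage_def Int_def conj_commute)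
    have "(\<integral>\<omega>. g (r (S \<omega>)) \<partial>R) = (\<integral>\<omega>. (\<Sum>s\<in>J. g (r s) * indicator {\<omega>\<in>space R. S \<omega> = s} \<omega>) \<partial>R)"
    proof (rule Bochner_Integration.integral_cong)
      fix \<omega> assume \<omega>: "\<omega> \<in> space R"
      have "(\<Sum>s\<in>J. g (r s) * indicator {\<omega>\<in>space R. S \<omega> = s} \<omega>) = (\<Sum>s\<in>J. if s = S \<omega> then g (r s) else 0)"
        using \<omega> by (intro sum.cong) (auto simp: indicator_def)
      also have "\<dots> = g (r (S \<omega>))" using SJ[OF \<omega>] \<open>finite J\<close> by simp
      finally show "g (r (S \<omega>)) = (\<Sum>s\<in>J. g (r s) * indicator {\<omega>\<in>space R. S \<omega> = s} \<omega>)" by simp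
    qed simp
    also have "\<dots> = (\<Sum>s\<in>J. g (r s) * measure R {\<omega>\<in>space R. S \<omega> = s})"
      using m by (subst Bochner_Integration.integral_sum)
        (auto intro!: sum.cong integrable_mult_right integrable_real_indicator simp: emeasure_eq_measure)
    finally show ?thesis .
  qed
  have near: "\<bar>(\<integral>\<omega>. g (V \<omega>) \<partial>R) - (\<integral>\<omega>. g (r (S \<omega>)) \<partial>R)\<bar> \<le> (K + 2 * \<bar>B\<bar>) * e"
    if R: "prob_space R" and V: "V \<in> R \<rightarrow>\<^sub>M borel_of mtopology" and S: "S \<in> R \<rightarrow>\<^sub>M count_space J"
      and rJ: "r ` J \<subseteq> M" and e: "0 < e" and E: "E \<in> sets R" "measure R E \<le> e"
      and dVS: "\<And>\<omega>. \<omega> \<in> space R - E \<Longrightarrow> d (V \<omega>) (r (S \<omega>)) \<le> e"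
    for R :: "'d measure" and V and J :: "'q set" and r S e E
  proof -
    interpret prob_space R by fact
    have VM: "V \<omega> \<in> M" if "\<omega> \<in> space R" for \<omega>
      using measurable_space[OF V that] by simp
    have SM: "r (S \<omega>) \<in> M" if "\<omega> \<in> space R" for \<omega>
      using measurable_space[OF S that] rJ by auto
    have m1: "(\<lambda>\<omega>. g (V \<omega>)) \<in> borel_measurable R" by (rule measurable_compose[OF V gc])
    have m2: "(\<lambda>\<omega>. g (r (S \<omega>))) \<in> borel_measurable R"
      by (rule measurable_compose[OF S]) simp
    have i1: "integrable R (\<lambda>\<omega>. g (V \<omega>))"
      using bd VM m1 by (intro integrable_const_bound[where B=B]) auto
    have i2: "integrable R (\<lambda>\<omega>. g (r (S \<omega>)))"
      using bd SM m2 by (intro integrable_const_bound[where B=B]) auto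
    have "\<bar>(\<integral>\<omega>. g (V \<omega>) \<partial>R) - (\<integral>\<omega>. g (r (S \<omega>)) \<partial>R)\<bar> = \<bar>\<integral>\<omega>. g (V \<omega>) - g (r (S \<omega>)) \<partial>R\<bar>"
      using i1 i2 by simp
    also have "\<dots> \<le> (\<integral>\<omega>. \<bar>g (V \<omega>) - g (r (S \<omega>))\<bar> \<partial>R)"
      by (rule integral_abs_bound)
    also have "\<dots> \<le> (\<integral>\<omega>. K * e + 2 * \<bar>B\<bar> * indicator E \<omega> \<partial>R)"
    proof (rule integral_mono)
      show "integrable R (\<lambda>\<omega>. K * e + 2 * \<bar>B\<bar> * indicator E \<omega>)"
        using E(1) by (intro Bochner_Integration.integrable_add integrable_mult_right integrable_real_indicator)
          (auto simp: emeasure_eq_measure)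
      fix \<omega> assume \<omega>: "\<omega> \<in> space R"
      show "\<bar>g (V \<omega>) - g (r (S \<omega>))\<bar> \<le> K * e + 2 * \<bar>B\<bar> * indicator E \<omega>"
      proof (cases "\<omega> \<in> E")
        case True
        then show ?thesis
          using bd[OF VM[OF \<omega>]] bd[OF SM[OF \<omega>]] mult_nonneg_nonneg[OF K less_imp_le[OF e]] by simp
      next
        case False
        have "\<bar>g (V \<omega>) - g (r (S \<omega>))\<bar> \<le> K * d (V \<omega>) (r (S \<omega>))"
          using \<omega> by (intro lip VM SM)
        also have "\<dots> \<le> K * e" using K False \<omega> by (intro mult_left_mono dVS) auto
        finally show ?thesis using False by simp
      qed
    qed (use i1 i2 in auto)
    also have "\<dots> = K * e + 2 * \<bar>B\<bar> * measure R E"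
      using E(1) by (subst Bochner_Integration.integral_add) (auto simp: prob_space emeasure_eq_measure)
    also have "\<dots> \<le> (K + 2 * \<bar>B\<bar>) * e"
      using E(2) mult_left_mono[OF E(2), of "2 * \<bar>B\<bar>"] by (simp add: algebra_simps)
    finally show ?thesis .
  qed
  show "(\<lambda>n. \<integral>\<omega>. g (Y n \<omega>) \<partial>P n) \<longlonglongrightarrow> (\<integral>\<omega>. g (Z \<omega>) \<partial>Q)"
  proof (rule tendstoI)
    fix h :: real assume "0 < h"
    \<comment> \<open>The errors of the two replacements and of the finite sum are each below \<open>h / 3\<close>.\<close>
    define C where "C = K + 2 * \<bar>B\<bar> + 1"
    define e where "e = h / (3 * C)"
    have C: "0 < C" using K by (simp add: C_def)
    have e: "0 < e" "(K + 2 * \<bar>B\<bar>) * e < h / 3"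
    proof -
      show "0 < e" using C \<open>0 < h\<close> by (simp add: e_def)
      have "(K + 2 * \<bar>B\<bar>) * e < C * e" using \<open>0 < e\<close> by (intro mult_strict_right_mono) (auto simp: C_def)
      also have "C * e = h / 3" using C by (simp add: e_def)
      finally show "(K + 2 * \<bar>B\<bar>) * e < h / 3" .
    qed
    obtain J :: "'q set" and r S T E where J: "finite J" "r ` J \<subseteq> M"
      and S: "\<forall>n. S n \<in> P n \<rightarrow>\<^sub>M count_space J" and T: "T \<in> Q \<rightarrow>\<^sub>M count_space J"
      and lim: "\<forall>s\<in>J. (\<lambda>n. measure (P n) {\<omega>\<in>space (P n). S n \<omega> = s}) \<longlonglongrightarrow> measure Q {\<omega>\<in>space Q. T \<omega> = s}"
      and nearY: "\<forall>\<^sub>F n in sequentially. \<exists>E\<in>sets (P n). measure (P n) E \<le> e \<and>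
         (\<forall>\<omega>\<in>space (P n) - E. d (Y n \<omega>) (r (S n \<omega>)) \<le> e)"
      and nearZ: "E \<in> sets Q" "measure Q E \<le> e" "\<forall>\<omega>\<in>space Q - E. d (Z \<omega>) (r (T \<omega>)) \<le> e"
      using approx[OF e(1)] by (elim exE conjE bexE) (rule that)
    note S = S[rule_format] and lim = lim[rule_format] and nearZ = nearZ(1,2) nearZ(3)[rule_format]
    have "(\<lambda>n. \<integral>\<omega>. g (r (S n \<omega>)) \<partial>P n) \<longlonglongrightarrow> (\<integral>\<omega>. g (r (T \<omega>)) \<partial>Q)"
      unfolding finite_mean[OF P J(1) S] finite_mean[OF Q J(1) T]
      by (intro tendsto_sum tendsto_mult_left lim)
    then have "\<forall>\<^sub>F n in sequentially. dist (\<integral>\<omega>. g (r (S n \<omega>)) \<partial>P n) (\<integral>\<omega>. g (r (T \<omega>)) \<partial>Q) < h / 3"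
      using \<open>0 < h\<close> by (intro tendstoD) auto
    with nearY show "\<forall>\<^sub>F n in sequentially. dist (\<integral>\<omega>. g (Y n \<omega>) \<partial>P n) (\<integral>\<omega>. g (Z \<omega>) \<partial>Q) < h"
    proof eventually_elim
      case (elim n)
      then have "\<bar>(\<integral>\<omega>. g (Y n \<omega>) \<partial>P n) - (\<integral>\<omega>. g (r (S n \<omega>)) \<partial>P n)\<bar> \<le> (K + 2 * \<bar>B\<bar>) * e"
        using near[OF P Y S J(2) e(1)] by blast
      moreover have "\<bar>(\<integral>\<omega>. g (Z \<omega>) \<partial>Q) - (\<integral>\<omega>. g (r (T \<omega>)) \<partial>Q)\<bar> \<le> (K + 2 * \<bar>B\<bar>) * e"
        using near[OF Q Z T J(2) e(1) nearZ] by blast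
      ultimately show ?case using elim(2) e(2) unfolding dist_real_def by linarith
    qed
  qed
qed

end

section \<open>The Skorokhod space\<close>

text \<open>A limit lies in an open set \<open>U\<close> iff the approximants eventually stay at some fixed distance from
  the complement of \<open>U\<close>.\<close>

lemma (in Metric_space) borel_of_measurable_limit:
  assumes G: "\<And>k::nat. G k \<in> R \<rightarrow>\<^sub>M count_space UNIV"
    and GM: "\<And>k \<omega>. \<omega> \<in> space R \<Longrightarrow> G k \<omega> \<in> M" and FM: "\<And>\<omega>. \<omega> \<in> space R \<Longrightarrow> F \<omega> \<in> M"
    and lim: "\<And>\<omega>. \<omega> \<in> space R \<Longrightarrow> (\<lambda>k. d (F \<omega>) (G k \<omega>)) \<longlonglongrightarrow> 0"
  shows "F \<in> R \<rightarrow>\<^sub>M borel_of mtopology"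
  unfolding borel_of_def
proof (rule measurable_measure_of)
  fix U assume "U \<in> {U. openin mtopology U}"
  then have U: "openin mtopology U" by simp
  define V where "V m = {y \<in> M. mball y (1 / Suc m) \<subseteq> U}" for m
  have "F \<omega> \<in> U \<longleftrightarrow> (\<exists>m. \<exists>k0. \<forall>k\<ge>k0. G k \<omega> \<in> V m)" if \<omega>: "\<omega> \<in> space R" for \<omega>
  proof
    assume "F \<omega> \<in> U"
    then obtain r where r: "0 < r" "mball (F \<omega>) r \<subseteq> U" using U unfolding openin_mtopology by blast
    obtain m :: nat where m: "2 / r < real m" using reals_Archimedean2 by blast
    then have m': "2 / Suc m < r" using r(1) by (simp add: field_simps)
    have "\<forall>\<^sub>F k in sequentially. d (F \<omega>) (G k \<omega>) < 1 / Suc m"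
      using lim[OF \<omega>] by (rule order_tendstoD) simp
    then obtain k0 where k0: "\<And>k. k0 \<le> k \<Longrightarrow> d (F \<omega>) (G k \<omega>) < 1 / Suc m"
      by (auto simp: eventually_sequentially)
    have "G k \<omega> \<in> V m" if "k0 \<le> k" for k
    proof -
      have "mball (G k \<omega>) (1 / Suc m) \<subseteq> mball (F \<omega>) r"
      proof
        fix y assume y: "y \<in> mball (G k \<omega>) (1 / Suc m)"
        then have "d (F \<omega>) y \<le> d (F \<omega>) (G k \<omega>) + d (G k \<omega>) y"
          using FM[OF \<omega>] GM[OF \<omega>] by (intro triangle) auto
        also have "\<dots> < 1 / Suc m + 1 / Suc m" using k0[OF that] y by (intro add_strict_mono) auto
        also have "\<dots> = 2 / Suc m" by simp
        finally show "y \<in> mball (F \<omega>) r" using m' y FM[OF \<omega>] by auto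
      qed
      then show ?thesis using r(2) GM[OF \<omega>] by (auto simp: V_def)
    qed
    then show "\<exists>m. \<exists>k0. \<forall>k\<ge>k0. G k \<omega> \<in> V m" by blast
  next
    assume "\<exists>m. \<exists>k0. \<forall>k\<ge>k0. G k \<omega> \<in> V m"
    then obtain m k0 where k0: "\<And>k. k0 \<le> k \<Longrightarrow> G k \<omega> \<in> V m" by blast
    have "\<forall>\<^sub>F k in sequentially. d (F \<omega>) (G k \<omega>) < 1 / Suc m"
      using lim[OF \<omega>] by (rule order_tendstoD) simp
    then obtain k1 where "\<And>k. k1 \<le> k \<Longrightarrow> d (F \<omega>) (G k \<omega>) < 1 / Suc m"
      by (auto simp: eventually_sequentially)
    then have "F \<omega> \<in> mball (G (max k0 k1) \<omega>) (1 / Suc m)"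
      using FM[OF \<omega>] GM[OF \<omega>] by (simp add: commute)
    then show "F \<omega> \<in> U" using k0[of "max k0 k1"] by (auto simp: V_def)
  qed
  then have "F -` U \<inter> space R = {\<omega> \<in> space R. \<exists>m k0. \<forall>k. k0 \<le> k \<longrightarrow> G k \<omega> \<in> V m}"
    by auto
  also have "\<dots> \<in> sets R"
  proof -
    have [measurable]: "Measurable.pred R (\<lambda>\<omega>. G k \<omega> \<in> V m)" for k m
      using measurable_sets[OF G, of "V m" k] by (simp add: pred_def vimage_def Int_def conj_commute)
    show ?thesis by measurable
  qed
  finally show "F -` U \<inter> space R \<in> sets R" .
qed (use FM openin_subset[of mtopology] in auto)

lemma time_changesI:
  assumes mono: "strict_mono_on {0..1} \<theta>" and cont: "continuous_on {0..1} \<theta>"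
    and ends: "\<theta> 0 = 0" "\<theta> 1 = 1"
  shows "\<theta> \<in> time_changes"
proof -
  have "\<theta> t \<in> {0..1}" if t: "t \<in> {0..1}" for t
    using strict_mono_on_leD[OF mono, of 0 t] strict_mono_on_leD[OF mono, of t 1] t ends by auto
  moreover have "s \<in> \<theta> ` {0..1}" if "s \<in> {0..1}" for s
    using IVT'[of \<theta> 0 s 1] cont ends that by (auto simp: image_iff)
  ultimately show ?thesis using mono cont by (auto simp: time_changes_def)
qed

lemma time_changesD:
  assumes "\<theta> \<in> time_changes"
  shows "strict_mono_on {0..1} \<theta>" "continuous_on {0..1} \<theta>" "\<theta> 0 = 0" "\<theta> 1 = 1"
    "t \<in> {0..1} \<Longrightarrow> \<theta> t \<in> {0..1}"
proof -
  show mono: "strict_mono_on {0..1} \<theta>" and "continuous_on {0..1} \<theta>"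
    using assms by (auto simp: time_changes_def)
  have im: "\<theta> ` {0..1} = {0..1}" using assms by (auto simp: time_changes_def)
  then show "t \<in> {0..1} \<Longrightarrow> \<theta> t \<in> {0..1}" by blast
  have "0 \<in> \<theta> ` {0..1}" "1 \<in> \<theta> ` {0..1}" unfolding im by auto
  then obtain u v where uv: "u \<in> {0..1}" "\<theta> u = 0" "v \<in> {0..1}" "\<theta> v = 1" by (metis imageE)
  have "\<theta> 0 \<in> {0..1}" "\<theta> 1 \<in> {0..1}" using im by (metis atLeastAtMost_iff imageI order_refl zero_le_one)+
  then show "\<theta> 0 = 0" "\<theta> 1 = 1"
    using strict_mono_on_leD[OF mono, of 0 u] strict_mono_on_leD[OF mono, of v 1] uv by auto
qed

lemma time_changes_le_iff:
  assumes "\<theta> \<in> time_changes" "s \<in> {0..1}" "t \<in> {0..1}"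
  shows "\<theta> s \<le> \<theta> t \<longleftrightarrow> s \<le> t"
  using strict_mono_on_less_eq[OF time_changesD(1)[OF assms(1)] assms(2,3)] .

lemma time_changes_comp:
  assumes "\<theta> \<in> time_changes" "\<eta> \<in> time_changes"
  shows "(\<lambda>t. \<eta> (\<theta> t)) \<in> time_changes"
proof (rule time_changesI)
  note \<theta> = time_changesD[OF assms(1)] and \<eta> = time_changesD[OF assms(2)]
  show "strict_mono_on {0..1} (\<lambda>t. \<eta> (\<theta> t))"
    using \<theta>(1,5) \<eta>(1) unfolding strict_mono_on_def by blast
  show "continuous_on {0..1} (\<lambda>t. \<eta> (\<theta> t))"
    using \<theta>(5) by (intro continuous_on_compose2[OF \<eta>(2) \<theta>(2)]) blast
qed (use time_changesD[OF assms(1)] time_changesD[OF assms(2)] in auto)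

text \<open>The witness is piecewise linear through \<open>(a, a)\<close>, \<open>(p, m)\<close>, \<open>(b, b)\<close> and the identity elsewhere. With
  \<open>l1\<close> and \<open>l2\<close> the lines through the first and the last two of these points, it is
  \<open>min t (max (l1 t) (l2 t))\<close> if \<open>m \<le> p\<close> and \<open>max t (min (l1 t) (l2 t))\<close> otherwise, so monotonicity and
  continuity are immediate.\<close>

lemma time_change_pin:
  fixes a b p m :: real
  assumes "0 \<le> a" "a < p" "p < b" "a < m" "m < b" "b \<le> 1"
  obtains \<theta> where "\<theta> \<in> time_changes" "\<theta> p = m" "\<And>t. t \<notin> {a<..<b} \<Longrightarrow> \<theta> t = t"
proof -
  define s1 where "s1 = (m - a) / (p - a)"
  define s2 where "s2 = (b - m) / (b - p)"
  define l1 where "l1 t = a + (t - a) * s1" for t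
  define l2 where "l2 t = b + (t - b) * s2" for t
  have pos: "0 < s1" "0 < s2" using assms by (auto simp: s1_def s2_def)
  have lp: "l1 p = m" "l2 p = m" using assms by (auto simp: l1_def l2_def s1_def s2_def field_simps)
  have mono: "s < t \<Longrightarrow> l1 s < l1 t" "s < t \<Longrightarrow> l2 s < l2 t" for s t
    using pos by (auto simp: l1_def l2_def)
  have cont: "continuous_on A l1" "continuous_on A l2" for A
    by (auto simp: l1_def l2_def intro!: continuous_intros)
  note conclude = that
  have finish: thesis
    if mono: "\<And>s t. s < t \<Longrightarrow> \<theta> s < \<theta> t" and cont: "continuous_on {0..1} \<theta>"
      and "\<theta> p = m" and out: "\<And>t. t \<notin> {a<..<b} \<Longrightarrow> \<theta> t = t" for \<theta>
  proof -
    have "\<theta> \<in> time_changes"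
      using assms by (intro time_changesI strict_mono_onI mono cont out) auto
    then show thesis using \<open>\<theta> p = m\<close> out by (rule conclude)
  qed
  show thesis
  proof (cases "m \<le> p")
    case True
    then have s: "s1 \<le> 1" "1 \<le> s2" using assms by (auto simp: s1_def s2_def field_simps)
    show thesis
    proof (rule finish)
      show "min s (max (l1 s) (l2 s)) < min t (max (l1 t) (l2 t))" if "s < t" for s t
        using mono[OF that] that by (auto simp: min_def max_def)
      show "min t (max (l1 t) (l2 t)) = t" if "t \<notin> {a<..<b}" for t
      proof (cases "t \<le> a")
        case True
        have "t = a + (t - a) * 1" by simp
        also have "\<dots> \<le> l1 t" unfolding l1_def using True s by (intro add_left_mono mult_left_mono_neg) auto
        finally show ?thesis by simp
      next
        case False
        then have "b \<le> t" using that by auto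
        have "t = b + (t - b) * 1" by simp
        also have "\<dots> \<le> l2 t" unfolding l2_def using \<open>b \<le> t\<close> s by (intro add_left_mono mult_left_mono) auto
        finally show ?thesis by simp
      qed
    qed (use True in \<open>auto simp: lp intro!: continuous_intros cont\<close>)
  next
    case False
    then have s: "1 \<le> s1" "s2 \<le> 1" using assms by (auto simp: s1_def s2_def field_simps)
    show thesis
    proof (rule finish)
      show "max s (min (l1 s) (l2 s)) < max t (min (l1 t) (l2 t))" if "s < t" for s t
        using mono[OF that] that by (auto simp: min_def max_def)
      show "max t (min (l1 t) (l2 t)) = t" if "t \<notin> {a<..<b}" for t
      proof (cases "t \<le> a")
        case True
        have "l1 t \<le> a + (t - a) * 1" unfolding l1_def using True s by (intro add_left_mono mult_left_mono_neg) auto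
        then show ?thesis by simp
      next
        case False
        then have "b \<le> t" using that by auto
        have "l2 t \<le> b + (t - b) * 1" unfolding l2_def using \<open>b \<le> t\<close> s by (intro add_left_mono mult_left_mono) auto
        then show ?thesis by simp
      qed
    qed (use False in \<open>auto simp: lp intro!: continuous_intros cont\<close>)
  qed
qed

text \<open>Time changes that pin points of disjoint intervals do not interfere, so they can be composed.\<close>

lemma time_change_pins:
  fixes a b p m :: "'i \<Rightarrow> real"
  assumes "finite J"
    and "\<And>i. i \<in> J \<Longrightarrow> 0 \<le> a i \<and> a i < p i \<and> p i < b i \<and> a i < m i \<and> m i < b i \<and> b i \<le> 1"
    and "disjoint_family_on (\<lambda>i. {a i<..<b i}) J"
  shows "\<exists>\<theta>\<in>time_changes. (\<forall>i\<in>J. \<theta> (p i) = m i) \<and> (\<forall>t. t \<notin> (\<Union>i\<in>J. {a i<..<b i}) \<longrightarrow> \<theta> t = t)"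
  using assms
proof (induction J)
  case empty
  then show ?case using time_changes_id by (intro bexI[of _ "\<lambda>t. t"]) auto
next
  case (insert i J)
  obtain \<theta> where \<theta>: "\<theta> \<in> time_changes" "\<And>j. j \<in> J \<Longrightarrow> \<theta> (p j) = m j"
    "\<And>t. t \<notin> (\<Union>i\<in>J. {a i<..<b i}) \<Longrightarrow> \<theta> t = t"
    using insert.IH[OF insert.prems(1) disjoint_family_on_mono[OF subset_insertI insert.prems(2)]] by blast
  have i: "0 \<le> a i" "a i < p i" "p i < b i" "a i < m i" "m i < b i" "b i \<le> 1"
    using insert.prems(1)[of i] by auto
  obtain \<phi> where \<phi>: "\<phi> \<in> time_changes" "\<phi> (p i) = m i" "\<And>t. t \<notin> {a i<..<b i} \<Longrightarrow> \<phi> t = t"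
    using time_change_pin[OF i] by blast
  have dis: "x \<notin> {a j<..<b j}" if "x \<in> {a i<..<b i}" "j \<in> J" for x j
    using insert.prems(2) insert.hyps(2) that by (fastforce simp: disjoint_family_on_def)
  have "\<phi> (\<theta> (p j)) = m j" if "j \<in> insert i J" for j
  proof (cases "j = i")
    case True
    have "\<theta> (p i) = p i" using dis[of "p i"] i by (intro \<theta>(3)) auto
    then show ?thesis using True \<phi>(2) by simp
  next
    case False
    then have "j \<in> J" using that by simp
    moreover have "m j \<in> {a j<..<b j}" using insert.prems(1)[of j] \<open>j \<in> J\<close> by auto
    ultimately show ?thesis using dis \<theta>(2) \<phi>(3) by metis
  qed
  moreover have "\<phi> (\<theta> t) = t" if "t \<notin> (\<Union>i\<in>insert i J. {a i<..<b i})" for t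
    using that \<theta>(3)[of t] \<phi>(3)[of t] by auto
  ultimately show ?case using time_changes_comp[OF \<theta>(1) \<phi>(1)] by (intro bexI[of _ "\<lambda>t. \<phi> (\<theta> t)"]) auto
qed

text \<open>A time change that fixes the complement of the intervals fixes their endpoints, hence maps each
  interval into itself.\<close>

lemma time_change_displacement:
  assumes \<theta>: "\<theta> \<in> time_changes"
    and ab: "\<And>i. i \<in> J \<Longrightarrow> 0 \<le> a i \<and> a i < b i \<and> b i \<le> 1 \<and> b i - a i \<le> w" and "0 \<le> w"
    and dis: "disjoint_family_on (\<lambda>i. {a i<..<b i}) J"
    and fixed: "\<And>t. t \<notin> (\<Union>i\<in>J. {a i<..<b i}) \<Longrightarrow> \<theta> t = t" and t: "t \<in> {0..1}"
  shows "\<bar>\<theta> t - t\<bar> \<le> w"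
proof (cases "t \<in> (\<Union>i\<in>J. {a i<..<b i})")
  case True
  then obtain i where i: "i \<in> J" "a i < t" "t < b i" by auto
  have ends: "a i \<notin> {a j<..<b j} \<and> b i \<notin> {a j<..<b j}" if j: "j \<in> J" for j
  proof (cases "j = i")
    case False
    then have e: "{a i<..<b i} \<inter> {a j<..<b j} = {}"
      using dis i(1) j by (auto simp: disjoint_family_on_def)
    show ?thesis
    proof (intro conjI notI)
      assume "a i \<in> {a j<..<b j}"
      then obtain x where "a i < x" "x < min (b i) (b j)"
        using i by (metis dense greaterThanLessThan_iff less_trans min_less_iff_conj)
      then show False using e \<open>a i \<in> _\<close> by fastforce
    next
      assume "b i \<in> {a j<..<b j}"
      then obtain x where "max (a i) (a j) < x" "x < b i"
        using i by (metis dense greaterThanLessThan_iff less_trans max_less_iff_conj)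
      then show False using e \<open>b i \<in> _\<close> by fastforce
    qed
  qed auto
  have "\<theta> (a i) = a i" "\<theta> (b i) = b i" using ends by (auto intro!: fixed)
  moreover have "\<theta> (a i) \<le> \<theta> t" "\<theta> t \<le> \<theta> (b i)"
    using i ab[OF i(1)] t by (auto simp: time_changes_le_iff[OF \<theta>])
  ultimately show ?thesis using i ab[OF i(1)] by auto
qed (use fixed \<open>0 \<le> w\<close> in auto)

text \<open>The elements of \<open>D01\<close> are the functions that, up to any \<open>e > 0\<close>, are constant between finitely many
  breakpoints; by left-continuity a breakpoint belongs to the interval on its left. Locally one breakpoint
  suffices because of the one-sided limits, and the local breakpoints are collected by bisection.\<close>

lemma D01_breakpoints:
  assumes "f \<in> D01" "0 < e"
  shows "\<exists>U. finite U \<and> (\<forall>s\<in>{0..1}. \<forall>t\<in>{0..1}. s < t \<longrightarrow> U \<inter> {s..<t} = {} \<longrightarrow> \<bar>f s - f t\<bar> \<le> e)"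
proof -
  define P where "P a b \<longleftrightarrow> (\<exists>U. finite U \<and>
    (\<forall>s\<in>{a..b} \<inter> {0..1}. \<forall>t\<in>{a..b} \<inter> {0..1}. s < t \<longrightarrow> U \<inter> {s..<t} = {} \<longrightarrow> \<bar>f s - f t\<bar> \<le> e))" for a b
  have "P 0 1"
  proof (rule Bolzano[of 0 1 P])
    show "(0::real) \<le> 1" by simp
  next
    fix a b c assume "P a b" "P b c" and "a \<le> b" "b \<le> c"
    then obtain U V where U: "finite U"
      "\<And>s t. s\<in>{a..b} \<inter> {0..1} \<Longrightarrow> t\<in>{a..b} \<inter> {0..1} \<Longrightarrow> s < t \<Longrightarrow> U \<inter> {s..<t} = {} \<Longrightarrow> \<bar>f s - f t\<bar> \<le> e"
      and V: "finite V"
      "\<And>s t. s\<in>{b..c} \<inter> {0..1} \<Longrightarrow> t\<in>{b..c} \<inter> {0..1} \<Longrightarrow> s < t \<Longrightarrow> V \<inter> {s..<t} = {} \<Longrightarrow> \<bar>f s - f t\<bar> \<le> e"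
      unfolding P_def by auto
    show "P a c" unfolding P_def
    proof (intro exI conjI ballI impI)
      show "finite (insert b (U \<union> V))" using U(1) V(1) by simp
      fix s t assume s: "s \<in> {a..c} \<inter> {0..1}" and t: "t \<in> {a..c} \<inter> {0..1}" and "s < t"
        and e: "insert b (U \<union> V) \<inter> {s..<t} = {}"
      then have "b < s \<or> t \<le> b" by (auto simp: not_le not_less)
      moreover have "U \<inter> {s..<t} = {}" "V \<inter> {s..<t} = {}" using e by auto
      ultimately show "\<bar>f s - f t\<bar> \<le> e"
        using U(2)[of s t] V(2)[of s t] s t \<open>s < t\<close> by auto
    qed
  next
    fix x :: real assume 3: "0 \<le> x" "x \<le> 1"
    have left: "\<exists>d>0. \<forall>s. x - d < s \<longrightarrow> s < x \<longrightarrow> 0 \<le> s \<longrightarrow> \<bar>f s - f x\<bar> < e / 2"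
    proof (cases "x = 0")
      case False
      then have "(f \<longlongrightarrow> f x) (at_left x)" using 3 assms(1) by (auto simp: D01_def)
      then have "\<forall>\<^sub>F s in at_left x. dist (f s) (f x) < e / 2" by (rule tendstoD) (use assms in simp)
      then obtain b where "b < x" "\<And>s. b < s \<Longrightarrow> s < x \<Longrightarrow> dist (f s) (f x) < e / 2"
        unfolding eventually_at_left_field by blast
      then show ?thesis by (intro exI[of _ "x - b"]) (auto simp: dist_real_def)
    qed (auto intro: exI[of _ 1])
    have right: "\<exists>d>0. \<exists>l. \<forall>s. x < s \<longrightarrow> s < x + d \<longrightarrow> s \<le> 1 \<longrightarrow> \<bar>f s - l\<bar> < e / 2"
    proof (cases "x = 1")
      case False
      then obtain l where "(f \<longlongrightarrow> l) (at_right x)" using 3 assms(1) by (force simp: D01_def)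
      then have "\<forall>\<^sub>F s in at_right x. dist (f s) l < e / 2" by (rule tendstoD) (use assms in simp)
      then obtain b where "x < b" "\<And>s. x < s \<Longrightarrow> s < b \<Longrightarrow> dist (f s) l < e / 2"
        unfolding eventually_at_right_field by blast
      then show ?thesis by (intro exI[of _ "b - x"]) (auto simp: dist_real_def)
    qed (auto intro: exI[of _ 1])
    obtain d1 where d1: "0 < d1" "\<And>s. x - d1 < s \<Longrightarrow> s < x \<Longrightarrow> 0 \<le> s \<Longrightarrow> \<bar>f s - f x\<bar> < e / 2"
      using left by blast
    obtain d2 l where d2: "0 < d2" "\<And>s. x < s \<Longrightarrow> s < x + d2 \<Longrightarrow> s \<le> 1 \<Longrightarrow> \<bar>f s - l\<bar> < e / 2"
      using right by blast
    show "\<exists>d>0. \<forall>a b. a \<le> x \<and> x \<le> b \<and> b - a < d \<longrightarrow> P a b"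
    proof (intro exI[of _ "min d1 d2"] conjI allI impI)
      show "0 < min d1 d2" using d1 d2 by simp
      fix a b assume ab: "a \<le> x \<and> x \<le> b \<and> b - a < min d1 d2"
      show "P a b" unfolding P_def
      proof (intro exI[of _ "{x}"] conjI ballI impI)
        fix s t assume s: "s \<in> {a..b} \<inter> {0..1}" and t: "t \<in> {a..b} \<inter> {0..1}" and "s < t"
          and "{x} \<inter> {s..<t} = {}"
        then consider "x < s" | "t < x" | "t = x" by fastforce
        then show "\<bar>f s - f t\<bar> \<le> e"
        proof cases
          case 1
          then have "\<bar>f s - l\<bar> < e / 2" "\<bar>f t - l\<bar> < e / 2"
            using d2(2)[of s] d2(2)[of t] s t ab \<open>s < t\<close> by auto
          then show ?thesis by linarith
        next
          case 2
          then have "\<bar>f s - f x\<bar> < e / 2" "\<bar>f t - f x\<bar> < e / 2"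
            using d1(2)[of s] d1(2)[of t] s t ab \<open>s < t\<close> by auto
          then show ?thesis by linarith
        next
          case 3
          then have "\<bar>f s - f x\<bar> < e / 2" using d1(2)[of s] s t ab \<open>s < t\<close> by auto
          then show ?thesis using 3 assms(2) by simp
        qed
      qed simp
    qed
  qed
  then show ?thesis by (auto simp: P_def)
qed

lemma D01I_breakpoints:
  assumes ext: "f \<in> extensional {0..1}"
    and brk: "\<And>e. 0 < e \<Longrightarrow>
      \<exists>U. finite U \<and> (\<forall>s\<in>{0..1}. \<forall>t\<in>{0..1}. s < t \<longrightarrow> U \<inter> {s..<t} = {} \<longrightarrow> \<bar>f s - f t\<bar> \<le> e)"
  shows "f \<in> D01"
  unfolding D01_def
proof (intro CollectI conjI ext ballI)
  fix t :: real assume t: "t \<in> {0<..1}"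
  show "(f \<longlongrightarrow> f t) (at_left t)"
  proof (rule tendstoI)
    fix e :: real assume "0 < e"
    then obtain U where U: "finite U"
      "\<And>s t. s \<in> {0..1} \<Longrightarrow> t \<in> {0..1} \<Longrightarrow> s < t \<Longrightarrow> U \<inter> {s..<t} = {} \<Longrightarrow> \<bar>f s - f t\<bar> \<le> e / 2"
      using brk[of "e / 2"] by auto
    have fin: "finite (insert 0 U \<inter> {..<t})" using U(1) by simp
    define s0 where "s0 = Max (insert 0 U \<inter> {..<t})"
    have ne: "insert 0 U \<inter> {..<t} \<noteq> {}" using t by auto
    have s0: "0 \<le> s0" "s0 < t" "\<And>u. u \<in> U \<Longrightarrow> u < t \<Longrightarrow> u \<le> s0"
      using Max_in[OF fin ne] Max_ge[OF fin] t by (auto simp: s0_def)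
    show "\<forall>\<^sub>F s in at_left t. dist (f s) (f t) < e"
      unfolding eventually_at_left_field
    proof (intro exI[of _ s0] conjI allI impI s0(2))
      fix s assume s: "s0 < s" "s < t"
      have "U \<inter> {s..<t} = {}" using s0(3) s by fastforce
      then have "\<bar>f s - f t\<bar> \<le> e / 2" using s s0 t by (intro U(2)) auto
      then show "dist (f s) (f t) < e" using \<open>0 < e\<close> by (simp add: dist_real_def)
    qed
  qed
next
  fix t :: real assume t: "t \<in> {0..<1}"
  have "cauchy_filter (filtermap f (at_right t))"
    unfolding cauchy_filter_metric_filtermap
  proof (intro allI impI)
    fix e :: real assume "0 < e"
    then obtain U where U: "finite U"
      "\<And>s t. s \<in> {0..1} \<Longrightarrow> t \<in> {0..1} \<Longrightarrow> s < t \<Longrightarrow> U \<inter> {s..<t} = {} \<Longrightarrow> \<bar>f s - f t\<bar> \<le> e / 2"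
      using brk[of "e / 2"] by auto
    have fin: "finite (insert 1 U \<inter> {t<..})" using U(1) by simp
    define s0 where "s0 = Min (insert 1 U \<inter> {t<..})"
    have ne: "insert 1 U \<inter> {t<..} \<noteq> {}" using t by auto
    have s0: "s0 \<le> 1" "t < s0" "\<And>u. u \<in> U \<Longrightarrow> t < u \<Longrightarrow> s0 \<le> u"
      using Min_in[OF fin ne] Min_le[OF fin] t by (auto simp: s0_def)
    have lt: "\<bar>f r - f s\<bar> \<le> e / 2" if "t < r" "r < s" "s < s0" for r s
    proof (rule U(2))
      show "U \<inter> {r..<s} = {}" using s0(3) that by fastforce
    qed (use that s0 t in auto)
    have "dist (f r) (f s) < e" if "t < r" "r < s0" "t < s" "s < s0" for r s
      using lt[of r s] lt[of s r] that \<open>0 < e\<close> unfolding dist_real_def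
      by (cases r s rule: linorder_cases) (linarith | simp)+
    moreover have "\<forall>\<^sub>F s in at_right t. t < s \<and> s < s0"
      unfolding eventually_at_right_field using s0(2) by blast
    ultimately show "\<exists>P. eventually P (at_right t) \<and> (\<forall>x y. P x \<and> P y \<longrightarrow> dist (f x) (f y) < e)"
      by (intro exI[of _ "\<lambda>s. t < s \<and> s < s0"]) auto
  qed
  then have "\<exists>l. filtermap f (at_right t) \<le> nhds l"
    by (rule cauchy_filter_complete_converges[OF _ complete_UNIV]) (auto simp: filtermap_bot_iff)
  then show "\<exists>l. (f \<longlongrightarrow> l) (at_right t)"
    by (simp add: filterlim_def)
qed


text \<open>Sampling on a grid and rounding the values gives a function that depends on finitely many
  integers only.\<close>

definition grid_step :: "nat \<Rightarrow> (real \<Rightarrow> real) \<Rightarrow> real \<Rightarrow> real" where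
  "grid_step K f = (\<lambda>t\<in>{0..1}. real_of_int \<lfloor>K * f (real_of_int \<lceil>t * K\<rceil> / K)\<rfloor> / K)"

lemma grid_step_D01:
  assumes "0 < K"
  shows "grid_step K f \<in> D01"
proof (rule D01I_breakpoints)
  show "grid_step K f \<in> extensional {0..1}" by (simp add: grid_step_def)
  fix e :: real assume "0 < e"
  show "\<exists>U. finite U \<and> (\<forall>s\<in>{0..1}. \<forall>t\<in>{0..1}. s < t \<longrightarrow> U \<inter> {s..<t} = {} \<longrightarrow>
      \<bar>grid_step K f s - grid_step K f t\<bar> \<le> e)"
  proof (intro exI conjI ballI impI)
    show "finite ((\<lambda>i. real_of_int i / K) ` {0..int K})" by simp
    fix s t :: real assume s: "s \<in> {0..1}" and t: "t \<in> {0..1}" and "s < t"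
      and e: "(\<lambda>i. real_of_int i / K) ` {0..int K} \<inter> {s..<t} = {}"
    have "\<lceil>s * K\<rceil> = \<lceil>t * K\<rceil>"
    proof (rule ccontr)
      assume "\<lceil>s * K\<rceil> \<noteq> \<lceil>t * K\<rceil>"
      moreover have "\<lceil>s * K\<rceil> \<le> \<lceil>t * K\<rceil>" using \<open>s < t\<close> by (intro ceiling_mono mult_right_mono) auto
      ultimately have "\<lceil>s * K\<rceil> < \<lceil>t * K\<rceil>" by simp
      then have "\<lceil>s * K\<rceil> < t * K" by (simp only: less_ceiling_iff)
      moreover have "s * K \<le> \<lceil>s * K\<rceil>" by simp
      ultimately have "real_of_int \<lceil>s * K\<rceil> / K \<in> {s..<t}" using assms by (simp add: field_simps)
      moreover have "\<lceil>s * K\<rceil> \<in> {0..int K}"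
      proof -
        have "0 \<le> s * K" "s * K \<le> K" using s assms by (auto simp: mult_left_le_one_le)
        then show ?thesis by (auto simp: ceiling_le_iff)
      qed
      ultimately show False using e by blast
    qed
    then show "\<bar>grid_step K f s - grid_step K f t\<bar> \<le> e"
      using s t \<open>0 < e\<close> by (simp add: grid_step_def)
  qed
qed

lemma finite_separated:
  fixes V :: "real set"
  assumes "finite V"
  obtains \<eta> where "0 < \<eta>" "\<And>u v. u \<in> V \<Longrightarrow> v \<in> V \<Longrightarrow> u \<noteq> v \<Longrightarrow> \<eta> \<le> \<bar>u - v\<bar>"
proof -
  define D where "D = (\<lambda>(u, v). \<bar>u - v\<bar>) ` (V \<times> V) - {0}"
  have "finite D" using assms by (simp add: D_def)
  show thesis
  proof (rule that[of "Min (insert 1 D)"])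
    show "0 < Min (insert 1 D)" using \<open>finite D\<close> by (auto simp: D_def)
    show "Min (insert 1 D) \<le> \<bar>u - v\<bar>" if "u \<in> V" "v \<in> V" "u \<noteq> v" for u v
      using \<open>finite D\<close> that by (intro Min_le) (auto simp: D_def image_iff)
  qed
qed

text \<open>The time change moves every breakpoint \<open>u\<close> of \<open>f\<close> to the last grid point before it. Afterwards a
  time and the grid point at which \<open>f\<close> was sampled for it lie on the same side of every breakpoint.\<close>

lemma grid_step_limit:
  assumes f: "f \<in> D01"
  shows "(\<lambda>k. skorokhod_dist f (grid_step (Suc k) f)) \<longlonglongrightarrow> 0"
proof (rule LIMSEQ_I)
  fix e' :: real assume "0 < e'"
  define e where "e = e' / 2"
  have "0 < e" using \<open>0 < e'\<close> by (simp add: e_def)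
  obtain U where U: "finite U"
    "\<And>s t. s \<in> {0..1} \<Longrightarrow> t \<in> {0..1} \<Longrightarrow> s < t \<Longrightarrow> U \<inter> {s..<t} = {} \<Longrightarrow> \<bar>f s - f t\<bar> \<le> e / 2"
    using D01_breakpoints[OF f, of "e / 2"] \<open>0 < e\<close> by auto
  obtain \<eta>' where \<eta>': "0 < \<eta>'" "\<And>u v. u \<in> U \<union> {0, 1} \<Longrightarrow> v \<in> U \<union> {0, 1} \<Longrightarrow> u \<noteq> v \<Longrightarrow> \<eta>' \<le> \<bar>u - v\<bar>"
    using finite_separated[of "U \<union> {0, 1}"] U(1) by (metis finite.emptyI finite.insertI finite_UnI)
  \<comment> \<open>Half the separation, so that the intervals of radius \<open>\<eta>\<close> about the breakpoints are disjoint.\<close>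
  define \<eta> where "\<eta> = min \<eta>' e / 2"
  have \<eta>: "0 < \<eta>" "2 * \<eta> \<le> e" "2 * \<eta> \<le> \<eta>'" using \<eta>' \<open>0 < e\<close> by (auto simp: \<eta>_def)
  define V where "V = U \<inter> {0<..<1}"
  have V: "u - \<eta> \<ge> 0 \<and> u + \<eta> \<le> 1" if "u \<in> V" for u
    using \<eta>'(2)[of u 0] \<eta>'(2)[of u 1] \<eta> that by (auto simp: V_def)
  have dis: "disjoint_family_on (\<lambda>u. {u - \<eta><..<u + \<eta>}) V"
    unfolding disjoint_family_on_def
  proof (intro ballI impI)
    fix u v assume "u \<in> V" "v \<in> V" "u \<noteq> v"
    then have "2 * \<eta> \<le> \<bar>u - v\<bar>" using \<eta>'(2)[of u v] \<eta>(3) by (auto simp: V_def)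
    then show "{u - \<eta><..<u + \<eta>} \<inter> {v - \<eta><..<v + \<eta>} = {}" by auto
  qed
  obtain k0 :: nat where k0: "1 / \<eta> < real k0" using reals_Archimedean2 by blast
  have "skorokhod_dist f (grid_step (Suc k) f) \<le> e" if "k0 \<le> k" for k
  proof -
    define K where "K = Suc k"
    have K: "0 < K" "1 / K < \<eta>"
    proof -
      have "1 / \<eta> < K" using k0 that by (simp add: K_def)
      then show "0 < K" "1 / K < \<eta>" using \<eta>(1) by (auto simp: field_simps K_def)
    qed
    define v where "v u = real_of_int \<lfloor>u * K\<rfloor> / K" for u :: real
    have v: "v u \<le> u" "u - \<eta> < v u" for u :: real
    proof -
      have "\<lfloor>u * K\<rfloor> \<le> u * K" "u * K - 1 < \<lfloor>u * K\<rfloor>" by linarith+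
      then show "v u \<le> u" using K(1) by (simp add: v_def field_simps)
      have "u - 1 / K = (u * K - 1) / K" using K(1) by (simp add: field_simps)
      also have "\<dots> < v u" unfolding v_def using \<open>u * K - 1 < _\<close> K(1) by (intro divide_strict_right_mono) auto
      finally have "u - 1 / K < v u" .
      then show "u - \<eta> < v u" using K(2) by simp
    qed
    have pins: "0 \<le> u - \<eta> \<and> u - \<eta> < v u \<and> v u < u + \<eta> \<and> u - \<eta> < u \<and> u < u + \<eta> \<and> u + \<eta> \<le> 1" if "u \<in> V" for u
      using v[of u] \<eta>(1) V[OF that] by auto
    obtain \<theta> where \<theta>: "\<theta> \<in> time_changes" "\<And>u. u \<in> V \<Longrightarrow> \<theta> (v u) = u"
      "\<And>t. t \<notin> (\<Union>u\<in>V. {u - \<eta><..<u + \<eta>}) \<Longrightarrow> \<theta> t = t"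
      using time_change_pins[of V "\<lambda>u. u - \<eta>" v "\<lambda>u. u + \<eta>" "\<lambda>u. u", OF _ pins dis] U(1)
      by (auto simp: V_def)
    have "sk_close (grid_step K f) f e"
      unfolding sk_close_def
    proof (intro conjI bexI[OF _ \<theta>(1)] ballI \<open>0 < e\<close>)
      fix t :: real assume t: "t \<in> {0..1}"
      have "\<bar>\<theta> t - t\<bar> \<le> 2 * \<eta>"
        using V \<eta>(1) by (intro time_change_displacement[OF \<theta>(1) _ _ dis \<theta>(3) t]) auto
      then show "\<bar>\<theta> t - t\<bar> \<le> e" using \<eta>(2) by simp
      define i where "i = \<lceil>t * K\<rceil>"
      have i01: "real_of_int i / K \<in> {0..1}"
      proof -
        have "0 \<le> t * K" "t * K \<le> K" using t K by (auto simp: mult_left_le_one_le)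
        then have "0 \<le> i" "i \<le> int K" unfolding i_def by (auto simp: ceiling_le_iff)
        then show ?thesis using K by (simp add: field_simps)
      qed
      have \<theta>01: "\<theta> t \<in> {0..1}" using time_changesD(5)[OF \<theta>(1) t] .
      have side: "real_of_int i / K \<le> u \<longleftrightarrow> \<theta> t \<le> u" if "u \<in> U" "u \<in> {0..1}" for u
      proof -
        consider "u = 0" | "u = 1" | "u \<in> V"
          using \<open>u \<in> U\<close> \<open>u \<in> {0..1}\<close> by (force simp: V_def)
        then show ?thesis
        proof cases
          case 1
          have "i \<le> 0 \<longleftrightarrow> t * K \<le> 0" by (simp add: i_def ceiling_le_iff)
          moreover have "\<theta> t \<le> \<theta> 0 \<longleftrightarrow> t \<le> 0" using t by (intro time_changes_le_iff[OF \<theta>(1)]) auto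
          ultimately show ?thesis using 1 K time_changesD(3)[OF \<theta>(1)] t
            by (auto simp: divide_le_0_iff mult_le_0_iff)
        next
          case 2
          then show ?thesis using i01 \<theta>01 by auto
        next
          case 3
          have "real_of_int i / K \<le> u \<longleftrightarrow> i \<le> u * K" using K by (simp add: field_simps)
          also have "\<dots> \<longleftrightarrow> i \<le> \<lfloor>u * K\<rfloor>" by (simp add: le_floor_iff)
          also have "\<dots> \<longleftrightarrow> t * K \<le> \<lfloor>u * K\<rfloor>" by (simp add: i_def ceiling_le_iff)
          also have "\<dots> \<longleftrightarrow> t \<le> v u" using K by (simp add: v_def field_simps)
          also have "\<dots> \<longleftrightarrow> \<theta> t \<le> \<theta> (v u)"
            using t v[of u] V[OF 3] \<eta>(1) by (intro time_changes_le_iff[OF \<theta>(1), symmetric]) auto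
          finally show ?thesis using \<theta>(2)[OF 3] by simp
        qed
      qed
      have "\<bar>f (real_of_int i / K) - f (\<theta> t)\<bar> \<le> e / 2"
      proof (cases "real_of_int i / K" "\<theta> t" rule: linorder_cases)
        case less
        have "U \<inter> {real_of_int i / K..<\<theta> t} = {}" using side i01 \<theta>01 by fastforce
        then show ?thesis using U(2)[OF i01 \<theta>01 less] by simp
      next
        case greater
        have "U \<inter> {\<theta> t..<real_of_int i / K} = {}" using side i01 \<theta>01 by fastforce
        then show ?thesis using U(2)[OF \<theta>01 i01 greater] by (simp add: abs_minus_commute)
      qed (use \<open>0 < e\<close> in simp)
      moreover have "\<bar>grid_step K f t - f (real_of_int i / K)\<bar> \<le> 1 / K"
      proof -
        define x where "x = K * f (real_of_int i / K)"
        have "grid_step K f t = real_of_int \<lfloor>x\<rfloor> / K" using t by (simp add: grid_step_def x_def i_def)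
        moreover have "f (real_of_int i / K) = x / K" using K by (simp add: x_def)
        moreover have "\<bar>real_of_int \<lfloor>x\<rfloor> - x\<bar> \<le> 1" by linarith
        ultimately show ?thesis using K by (simp add: diff_divide_distrib[symmetric] divide_right_mono)
      qed
      ultimately show "\<bar>grid_step K f t - f (\<theta> t)\<bar> \<le> e" using K(2) \<eta>(2) by linarith
    qed
    then show ?thesis
      using sk_close_le[OF f grid_step_D01[OF K(1)] sk_close_sym] by (simp add: K_def)
  qed
  then have "norm (skorokhod_dist f (grid_step (Suc k) f) - 0) < e'" if "k0 \<le> k" for k
    using that skorokhod_dist_nonneg[of f "grid_step (Suc k) f"] \<open>0 < e'\<close> by (fastforce simp: e_def)
  then show "\<exists>no. \<forall>k\<ge>no. norm (skorokhod_dist f (grid_step (Suc k) f) - 0) < e'" by blast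
qed

text \<open>The grid steps of \<open>F \<omega>\<close> take countably many values, each decided by finitely many coordinates of
  \<open>F \<omega>\<close>, and they converge to \<open>F \<omega>\<close>. So the coordinates generate the Borel sets.\<close>

theorem measurable_skorokhodI:
  assumes D: "\<And>\<omega>. \<omega> \<in> space R \<Longrightarrow> F \<omega> \<in> D01"
    and coord: "\<And>t. t \<in> {0..1} \<Longrightarrow> (\<lambda>\<omega>. F \<omega> t) \<in> borel_measurable R"
  shows "F \<in> R \<rightarrow>\<^sub>M borel_of skorokhod_top"
proof (rule Metric_space.borel_of_measurable_limit[OF Metric_space_skorokhod, where G="\<lambda>k \<omega>. grid_step (Suc k) (F \<omega>)"])
  fix k
  define K where "K = Suc k"
  define L where "L \<omega> = map (\<lambda>i. \<lfloor>K * F \<omega> (real i / K)\<rfloor>) [0..<Suc K]" for \<omega>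
  define H where "H l = (\<lambda>t\<in>{0..1::real}. real_of_int (l ! nat \<lceil>t * K\<rceil>) / K)" for l :: "int list"
  have [measurable]: "(\<lambda>\<omega>. F \<omega> (real i / K)) \<in> borel_measurable R" if "i \<le> K" for i
    using that by (intro coord) (simp add: K_def)
  have "L \<in> R \<rightarrow>\<^sub>M count_space UNIV"
  proof (subst measurable_count_space_eq2_countable, intro conjI ballI)
    fix l :: "int list"
    have "L -` {l} \<inter> space R = {\<omega> \<in> space R. length l = Suc K \<and> (\<forall>i\<in>{..K}. \<lfloor>K * F \<omega> (real i / K)\<rfloor> = l ! i)}"
      by (auto simp: L_def list_eq_iff_nth_eq less_Suc_eq_le simp del: upt_Suc)
    also have "\<dots> \<in> sets R"
      by measurable
    finally show "L -` {l} \<inter> space R \<in> sets R" .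
  qed auto
  then have "(\<lambda>\<omega>. H (L \<omega>)) \<in> R \<rightarrow>\<^sub>M count_space UNIV" by (rule measurable_compose) simp
  moreover have "H (L \<omega>) = grid_step K (F \<omega>)" for \<omega>
  proof (rule extensionalityI[of _ "{0..1}"])
    fix t :: real assume t: "t \<in> {0..1}"
    have "0 \<le> t * K" "t * K \<le> K" using t by (auto simp: mult_left_le_one_le)
    then have c: "0 \<le> \<lceil>t * K\<rceil>" "\<lceil>t * K\<rceil> \<le> int K" by (auto simp: ceiling_le_iff)
    then have "nat \<lceil>t * K\<rceil> < Suc K" by simp
    then show "H (L \<omega>) t = grid_step K (F \<omega>) t"
      using t c by (simp add: H_def L_def grid_step_def del: upt_Suc)
  qed (auto simp: H_def grid_step_def)
  ultimately show "(\<lambda>\<omega>. grid_step (Suc k) (F \<omega>)) \<in> R \<rightarrow>\<^sub>M count_space UNIV"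
    by (simp add: K_def)
qed (use D grid_step_D01 grid_step_limit in auto)

section \<open>Functionals of configurations\<close>

abbreviation config_space :: "(real \<times> ennreal) measure" where
  "config_space \<equiv> restrict_space borel {0..1} \<Otimes>\<^sub>M Rplus_borel"

lemma rectangle_sets:
  "I \<in> sets borel \<Longrightarrow> I \<subseteq> {0..1} \<Longrightarrow> H \<in> sets borel \<Longrightarrow> H \<subseteq> Rplus \<Longrightarrow> I \<times> H \<in> sets config_space"
  by (rule pair_measureI) (auto simp: sets_restrict_space Rplus_def image_iff)

lemma ennreal_tail_Rplus: "0 < t \<Longrightarrow> {ennreal t..} \<subseteq> Rplus" "{a<..} \<subseteq> Rplus"
proof -
  show "0 < t \<Longrightarrow> {ennreal t..} \<subseteq> Rplus"
    unfolding Rplus_def using less_le_trans[of 0 "ennreal t"] by auto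
  show "{a<..} \<subseteq> Rplus"
    unfolding Rplus_def using le_less_trans[of 0 a] by auto
qed

lemma configs_finite_above: "\<kappa> \<in> configs \<Longrightarrow> 0 < t \<Longrightarrow> finite (\<kappa> \<inter> {0..1} \<times> {ennreal t..})"
  by (auto simp: configs_def)

lemma finite_in_configs: "finite \<kappa> \<Longrightarrow> \<kappa> \<subseteq> {0..1} \<times> Rplus \<Longrightarrow> \<kappa> \<in> configs"
  by (auto simp: configs_def)

lemma row_config_in_configs: "row_config n x \<in> configs"
  by (rule finite_in_configs) (auto simp: row_config_def)

subsection \<open>Paths and maxima\<close>

definition tail_height :: "config \<Rightarrow> real \<Rightarrow> ennreal" where
  "tail_height \<kappa> t = Sup {x. \<exists>s\<ge>t. (s, x) \<in> \<kappa>}"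

lemma path_config_eq: "t \<in> {0..1} \<Longrightarrow> path_config \<kappa> t = enn2real (tail_height \<kappa> t)"
  by (simp add: path_config_def tail_height_def)

lemma configs_position: "\<kappa> \<in> configs \<Longrightarrow> (s, x) \<in> \<kappa> \<Longrightarrow> s \<in> {0..1} \<and> 0 < x"
  by (auto simp: configs_def Rplus_def)

lemma configs_point: "\<kappa> \<in> configs \<Longrightarrow> p \<in> \<kappa> \<Longrightarrow> fst p \<in> {0..1} \<and> 0 < snd p"
  using configs_position[of \<kappa> "fst p" "snd p"] by simp

lemma max_config_eq: "\<kappa> \<in> configs \<Longrightarrow> max_config \<kappa> = enn2real (tail_height \<kappa> 0)"
proof -
  assume "\<kappa> \<in> configs"
  then have "{x. \<exists>t. (t, x) \<in> \<kappa>} = {x. \<exists>s\<ge>0. (s, x) \<in> \<kappa>}" using configs_position[of \<kappa>] by auto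
  then show ?thesis by (simp add: max_config_def tail_height_def)
qed

lemma less_tail_height_iff:
  assumes "\<kappa> \<in> configs"
  shows "a < tail_height \<kappa> t \<longleftrightarrow> \<kappa> \<inter> ({t..} \<inter> {0..1}) \<times> {a<..} \<noteq> {}"
proof -
  have "a < tail_height \<kappa> t \<longleftrightarrow> (\<exists>x s. t \<le> s \<and> (s, x) \<in> \<kappa> \<and> a < x)"
    unfolding tail_height_def less_Sup_iff by auto
  also have "\<dots> \<longleftrightarrow> (\<exists>x s. (s, x) \<in> \<kappa> \<inter> ({t..} \<inter> {0..1}) \<times> {a<..})"
    using configs_position[OF assms] by auto
  finally show ?thesis by auto
qed

text \<open>Under these bounds \<open>a\<close> and \<open>b\<close> can only be infinite together, and then both conversions give 0.\<close>

lemma enn2real_diff_le: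
  assumes "b \<le> max a (ennreal s)" "a \<le> b + ennreal e" "0 \<le> s" "0 \<le> e"
  shows "\<bar>enn2real a - enn2real b\<bar> \<le> max s e"
proof (cases a)
  case (real x)
  then have "b < \<top>" using assms(1) by (auto simp: le_less_trans max_def split: if_splits)
  then obtain y where y: "b = ennreal y" "0 \<le> y" by (cases b) auto
  have "y \<le> max x s" using assms(1,3) real y by (auto simp: max_def split: if_splits)
  moreover have "x \<le> y + e" using assms(2,4) real y by (simp add: ennreal_plus[symmetric] del: ennreal_plus)
  ultimately show ?thesis using real y by (auto simp: max_def split: if_splits)
next
  case top
  then have "b = \<top>" using assms(2) by (simp add: top_unique)
  then show ?thesis using top assms(3) by simp
qed

text \<open>Up to \<open>e\<close>, the path changes only at positions of points of height at least \<open>e\<close>, of which there are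
  finitely many.\<close>

lemma path_config_D01:
  assumes "\<kappa> \<in> configs"
  shows "path_config \<kappa> \<in> D01"
proof (rule D01I_breakpoints)
  show "path_config \<kappa> \<in> extensional {0..1}" by (simp add: path_config_def)
  fix e :: real assume "0 < e"
  show "\<exists>U. finite U \<and> (\<forall>s\<in>{0..1}. \<forall>t\<in>{0..1}. s < t \<longrightarrow> U \<inter> {s..<t} = {} \<longrightarrow>
      \<bar>path_config \<kappa> s - path_config \<kappa> t\<bar> \<le> e)"
  proof (intro exI conjI ballI impI)
    show "finite (fst ` (\<kappa> \<inter> {0..1} \<times> {ennreal e..}))"
      using configs_finite_above[OF assms \<open>0 < e\<close>] by simp
    fix s t :: real assume st: "s \<in> {0..1}" "t \<in> {0..1}" "s < t"
      and free: "fst ` (\<kappa> \<inter> {0..1} \<times> {ennreal e..}) \<inter> {s..<t} = {}"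
    have "tail_height \<kappa> s \<le> max (tail_height \<kappa> t) (ennreal e)"
      unfolding tail_height_def
    proof (rule Sup_least)
      fix x assume "x \<in> {x. \<exists>r\<ge>s. (r, x) \<in> \<kappa>}"
      then obtain r where r: "s \<le> r" "(r, x) \<in> \<kappa>" by auto
      show "x \<le> max (Sup {x. \<exists>r\<ge>t. (r, x) \<in> \<kappa>}) (ennreal e)"
      proof (cases "t \<le> r")
        case True
        then show ?thesis using r by (intro max.coboundedI1 Sup_upper) auto
      next
        case False
        have "\<not> ennreal e \<le> x"
        proof
          assume "ennreal e \<le> x"
          then have "(r, x) \<in> \<kappa> \<inter> {0..1} \<times> {ennreal e..}" using r configs_position[OF assms r(2)] by simp
          then have "r \<in> fst ` (\<kappa> \<inter> {0..1} \<times> {ennreal e..})" by (rule image_eqI[rotated]) simp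
          then show False using free r(1) False by auto
        qed
        then show ?thesis by (intro max.coboundedI2) simp
      qed
    qed
    moreover have "tail_height \<kappa> t \<le> tail_height \<kappa> s"
      unfolding tail_height_def using st(3) by (intro Sup_subset_mono Collect_mono) (meson less_imp_le order_trans)
    ultimately have "\<bar>enn2real (tail_height \<kappa> t) - enn2real (tail_height \<kappa> s)\<bar> \<le> max e 0"
      using \<open>0 < e\<close> by (intro enn2real_diff_le) auto
    then show "\<bar>path_config \<kappa> s - path_config \<kappa> t\<bar> \<le> e"
      using st \<open>0 < e\<close> by (simp add: path_config_eq abs_minus_commute)
  qed
qed

lemma tail_height_measurable:
  assumes conf: "\<And>\<omega>. \<omega> \<in> space R \<Longrightarrow> \<xi> \<omega> \<in> configs"
    and hits: "\<And>B. B \<in> sets config_space \<Longrightarrow> {\<omega> \<in> space R. \<xi> \<omega> \<inter> B \<noteq> {}} \<in> sets R"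
  shows "(\<lambda>\<omega>. tail_height (\<xi> \<omega>) t) \<in> borel_measurable R"
proof (rule borel_measurableI_greater)
  fix a
  have "{\<omega> \<in> space R. a < tail_height (\<xi> \<omega>) t} = {\<omega> \<in> space R. \<xi> \<omega> \<inter> ({t..} \<inter> {0..1}) \<times> {a<..} \<noteq> {}}"
    by (intro Collect_cong conj_cong refl less_tail_height_iff conf)
  also have "\<dots> \<in> sets R"
    by (intro hits rectangle_sets ennreal_tail_Rplus) auto
  finally show "{\<omega> \<in> space R. a < tail_height (\<xi> \<omega>) t} \<in> sets R" .
qed

lemma max_config_measurable:
  assumes conf: "\<And>\<omega>. \<omega> \<in> space R \<Longrightarrow> \<xi> \<omega> \<in> configs"
    and hits: "\<And>B. B \<in> sets config_space \<Longrightarrow> {\<omega> \<in> space R. \<xi> \<omega> \<inter> B \<noteq> {}} \<in> sets R"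
  shows "(\<lambda>\<omega>. max_config (\<xi> \<omega>)) \<in> borel_measurable R"
proof -
  have "(\<lambda>\<omega>. enn2real (tail_height (\<xi> \<omega>) 0)) \<in> borel_measurable R"
    using tail_height_measurable[OF assms] by measurable
  then show ?thesis by (rule measurable_cong[THEN iffD1, rotated]) (simp add: conf max_config_eq)
qed

lemma path_config_measurable:
  assumes conf: "\<And>\<omega>. \<omega> \<in> space R \<Longrightarrow> \<xi> \<omega> \<in> configs"
    and hits: "\<And>B. B \<in> sets config_space \<Longrightarrow> {\<omega> \<in> space R. \<xi> \<omega> \<inter> B \<noteq> {}} \<in> sets R"
  shows "(\<lambda>\<omega>. path_config (\<xi> \<omega>)) \<in> R \<rightarrow>\<^sub>M borel_of skorokhod_top"
proof (rule measurable_skorokhodI)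
  fix t :: real assume t: "t \<in> {0..1}"
  show "(\<lambda>\<omega>. path_config (\<xi> \<omega>) t) \<in> borel_measurable R"
    unfolding path_config_eq[OF t] using tail_height_measurable[OF assms] by measurable
qed (use conf path_config_D01 in auto)

subsection \<open>The highest point\<close>

lemma argmax_config_unique: "is_top \<kappa> p \<Longrightarrow> (\<And>q. is_top \<kappa> q \<Longrightarrow> q = p) \<Longrightarrow> argmax_config \<kappa> = fst p"
proof -
  assume top: "is_top \<kappa> p" and uni: "\<And>q. is_top \<kappa> q \<Longrightarrow> q = p"
  have "\<exists>!p. is_top \<kappa> p" using top uni by (rule ex1I)
  moreover have "(THE p. is_top \<kappa> p) = p" using top uni by (rule the_equality)
  ultimately show ?thesis by (simp only: argmax_config_def if_True)
qed

lemma is_top_exists: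
  assumes "\<kappa> \<in> configs" "p \<in> \<kappa>" "ennreal t \<le> snd p" "0 < t"
  obtains q where "is_top \<kappa> q" "ennreal t \<le> snd q"
proof -
  define F where "F = \<kappa> \<inter> {0..1} \<times> {ennreal t..}"
  have F: "finite F" "p \<in> F" using configs_finite_above[OF assms(1,4)] configs_point[OF assms(1,2)] assms(2,3) by (auto simp: F_def mem_Times_iff)
  then have "Max (snd ` F) \<in> snd ` F" by (intro Max_in) auto
  then obtain q where q: "q \<in> F" "snd q = Max (snd ` F)" by auto
  have "snd r \<le> snd q" if "r \<in> \<kappa>" for r
  proof (cases "r \<in> F")
    case True
    then show ?thesis using F q by auto
  next
    case False
    then have "snd r \<le> ennreal t" using configs_point[OF assms(1) that] that by (auto simp: F_def mem_Times_iff)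
    then show ?thesis using q(1) by (auto simp: F_def)
  qed
  then have "is_top \<kappa> q" using q(1) by (auto simp: is_top_def F_def)
  then show thesis using q(1) that by (auto simp: F_def)
qed

lemma npoints_eq_0_iff: "npoints \<kappa> B = 0 \<longleftrightarrow> \<kappa> \<inter> B = {}"
  by (simp add: npoints_def emeasure_count_space_eq_0)

lemma npoints_eq_1_iff: "npoints \<kappa> B = 1 \<longleftrightarrow> (\<exists>p. \<kappa> \<inter> B = {p})"
proof
  assume "npoints \<kappa> B = 1"
  then have "finite (\<kappa> \<inter> B)" "card (\<kappa> \<inter> B) = 1"
    by (auto simp: npoints_def emeasure_count_space split: if_splits)
  then show "\<exists>p. \<kappa> \<inter> B = {p}" by (simp add: card_1_singleton_iff)
qed (auto simp: npoints_def)

text \<open>A unique highest point is separated from the others by a rational level, which turns the position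
  of the highest point into countably many statements about numbers of points.\<close>

lemma argmax_config_in_iff:
  assumes \<kappa>: "\<kappa> \<in> configs"
  shows "argmax_config \<kappa> \<in> A \<longleftrightarrow>
    (\<exists>q::rat. 0 < q \<and> npoints \<kappa> ({0..1} \<times> {ennreal (of_rat q)..}) = 1 \<and> \<kappa> \<inter> ({0..1} \<inter> A) \<times> {ennreal (of_rat q)..} \<noteq> {}) \<or>
    (\<not> (\<exists>q::rat. 0 < q \<and> npoints \<kappa> ({0..1} \<times> {ennreal (of_rat q)..}) = 1)) \<and> 0 \<in> A"
proof -
  have sep: "\<exists>q::rat. 0 < q \<and> npoints \<kappa> ({0..1} \<times> {ennreal (of_rat q)..}) = 1"
    if top: "is_top \<kappa> p" and uni: "\<And>r. is_top \<kappa> r \<Longrightarrow> r = p" for p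
  proof -
    have p: "p \<in> \<kappa>" "0 < snd p" "fst p \<in> {0..1}" using top configs_point[OF \<kappa>, of p] by (auto simp: is_top_def)
    then obtain r' where "0 < r'" "r' < snd p" using dense by blast
    then obtain r where r: "0 < r" "ennreal r < snd p" by (cases r') auto
    define F where "F = \<kappa> \<inter> {0..1} \<times> {ennreal r..}"
    have finF: "finite F" unfolding F_def by (rule configs_finite_above[OF \<kappa> r(1)])
    \<comment> \<open>The height of the second highest point, or \<open>r\<close> if all other points are lower than \<open>r\<close>.\<close>
    define s where "s = Max (insert (ennreal r) (snd ` (F - {p})))"
    have "snd q < snd p" if "q \<in> F - {p}" for q
    proof (rule ccontr)
      assume "\<not> snd q < snd p"
      then have "is_top \<kappa> q" using that top by (fastforce simp: is_top_def F_def)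
      then show False using uni that by auto
    qed
    then have "s < snd p" unfolding s_def using finF r(2) by auto
    then obtain q :: rat where q: "s < ennreal (of_rat q)" "ennreal (of_rat q) < snd p"
      using ennreal_rat_dense by blast
    have rq: "ennreal r < ennreal (of_rat q)"
      using q(1) finF unfolding s_def by (auto intro: le_less_trans[rotated])
    then have "0 < q" using r(1) by (cases "q \<le> 0") (auto simp: ennreal_neg)
    moreover have "\<kappa> \<inter> ({0..1} \<times> {ennreal (of_rat q)..}) = {p}"
    proof (intro subset_antisym subsetI)
      fix x assume x: "x \<in> \<kappa> \<inter> ({0..1} \<times> {ennreal (of_rat q)..})"
      then have "x \<in> F" using rq by (auto simp: F_def)
      show "x \<in> {p}"
      proof (rule ccontr)
        assume "x \<notin> {p}"
        then have "snd x \<le> s" unfolding s_def using \<open>x \<in> F\<close> finF by (intro Max_ge) auto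
        then show False using q(1) x by auto
      qed
    qed (use p q in \<open>auto simp: mem_Times_iff\<close>)
    ultimately show ?thesis using npoints_eq_1_iff by blast
  qed
  have single: "\<exists>p. \<kappa> \<inter> ({0..1} \<times> {ennreal (of_rat q)..}) = {p} \<and> is_top \<kappa> p \<and> (\<forall>r. is_top \<kappa> r \<longrightarrow> r = p)"
    if q: "npoints \<kappa> ({0..1} \<times> {ennreal (of_rat q)..}) = 1" for q :: rat
  proof -
    obtain p where p: "\<kappa> \<inter> ({0..1} \<times> {ennreal (of_rat q)..}) = {p}"
      using q unfolding npoints_eq_1_iff by (elim exE)
    have low: "snd r < snd p" if "r \<in> \<kappa>" "r \<noteq> p" for r
    proof -
      have "r \<notin> \<kappa> \<inter> ({0..1} \<times> {ennreal (of_rat q)..})" unfolding p using that by simp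
      then have "snd r < ennreal (of_rat q)" using configs_point[OF \<kappa> that(1)] that(1) by (auto simp: mem_Times_iff not_le)
      have "p \<in> \<kappa> \<inter> ({0..1} \<times> {ennreal (of_rat q)..})" unfolding p by simp
      then have "ennreal (of_rat q) \<le> snd p" by (auto simp: mem_Times_iff)
      with \<open>snd r < ennreal (of_rat q)\<close> show ?thesis by (rule less_le_trans)
    qed
    have "p \<in> \<kappa> \<inter> ({0..1} \<times> {ennreal (of_rat q)..})" unfolding p by simp
    then have top: "is_top \<kappa> p" unfolding is_top_def using low by (metis IntD1 less_imp_le order_refl)
    have uni: "r = p" if "is_top \<kappa> r" for r
    proof (rule ccontr)
      assume "r \<noteq> p"
      then have "snd r < snd p" using low that by (simp add: is_top_def)
      moreover have "snd p \<le> snd r" using that top by (simp add: is_top_def)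
      ultimately show False by simp
    qed
    show ?thesis by (intro exI[of _ p] conjI allI impI p top uni)
  qed
  show ?thesis
  proof (cases "\<exists>q::rat. 0 < q \<and> npoints \<kappa> ({0..1} \<times> {ennreal (of_rat q)..}) = 1")
    case True
    then obtain q0 :: rat where "npoints \<kappa> ({0..1} \<times> {ennreal (of_rat q0)..}) = 1" by blast
    then obtain p where p: "is_top \<kappa> p" "\<And>r. is_top \<kappa> r \<Longrightarrow> r = p" using single by metis
    then have A: "argmax_config \<kappa> = fst p" by (rule argmax_config_unique)
    have "\<kappa> \<inter> ({0..1} \<inter> A) \<times> {ennreal (of_rat q)..} \<noteq> {} \<longleftrightarrow> fst p \<in> A"
      if "npoints \<kappa> ({0..1} \<times> {ennreal (of_rat q)..}) = 1" for q :: rat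
    proof -
      have "\<kappa> \<inter> ({0..1} \<times> {ennreal (of_rat q)..}) = {p}" using single[OF that] p(2) by metis
      moreover have "\<kappa> \<inter> ({0..1} \<inter> A) \<times> {ennreal (of_rat q)..} =
          (\<kappa> \<inter> ({0..1} \<times> {ennreal (of_rat q)..})) \<inter> (A \<times> UNIV)" by auto
      ultimately show ?thesis by (cases p) auto
    qed
    then have "(\<exists>q::rat. 0 < q \<and> npoints \<kappa> ({0..1} \<times> {ennreal (of_rat q)..}) = 1 \<and>
        \<kappa> \<inter> ({0..1} \<inter> A) \<times> {ennreal (of_rat q)..} \<noteq> {}) \<longleftrightarrow> fst p \<in> A"
      using True by metis
    then show ?thesis using True A by simp
  next
    case False
    then have "\<not> (\<exists>!p. is_top \<kappa> p)" using sep by blast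
    then have "argmax_config \<kappa> = 0" by (simp only: argmax_config_def if_False)
    then show ?thesis using False by auto
  qed
qed

lemma argmax_config_measurable:
  assumes conf: "\<And>\<omega>. \<omega> \<in> space R \<Longrightarrow> \<xi> \<omega> \<in> configs"
    and np: "\<And>B. B \<in> sets config_space \<Longrightarrow> (\<lambda>\<omega>. npoints (\<xi> \<omega>) B) \<in> borel_measurable R"
  shows "(\<lambda>\<omega>. argmax_config (\<xi> \<omega>)) \<in> borel_measurable R"
proof (rule borel_measurable_iff_le[THEN iffD2], rule allI)
  fix a :: real
  define B C where "B = (\<lambda>q::rat. {0..1::real} \<times> {ennreal (of_rat q)..})"
    and "C = (\<lambda>q::rat. ({0..1} \<inter> {..a}) \<times> {ennreal (of_rat q)..})"
  have [measurable]: "(\<lambda>\<omega>. npoints (\<xi> \<omega>) (B q)) \<in> borel_measurable R"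
    "(\<lambda>\<omega>. npoints (\<xi> \<omega>) (C q)) \<in> borel_measurable R" if "0 < q" for q
    unfolding B_def C_def using that
    by (auto intro!: np rectangle_sets ennreal_tail_Rplus)
  have [measurable]: "Measurable.pred R (\<lambda>\<omega>. 0 < q \<and> npoints (\<xi> \<omega>) (B q) = 1 \<and> npoints (\<xi> \<omega>) (C q) \<noteq> 0)"
    "Measurable.pred R (\<lambda>\<omega>. 0 < q \<and> npoints (\<xi> \<omega>) (B q) = 1)" for q
    by (cases "0 < q"; simp)+
  have "{\<omega> \<in> space R. argmax_config (\<xi> \<omega>) \<le> a} = {\<omega> \<in> space R.
     (\<exists>q. 0 < q \<and> npoints (\<xi> \<omega>) (B q) = 1 \<and> npoints (\<xi> \<omega>) (C q) \<noteq> 0) \<or>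
     (\<not> (\<exists>q. 0 < q \<and> npoints (\<xi> \<omega>) (B q) = 1)) \<and> 0 \<le> a}"
    unfolding B_def C_def npoints_eq_0_iff
    using argmax_config_in_iff[OF conf, of _ "{..a}"] by (intro Collect_cong conj_cong refl) simp
  also have "\<dots> \<in> sets R" by measurable
  finally show "{\<omega> \<in> space R. argmax_config (\<xi> \<omega>) \<le> a} \<in> sets R" .
qed

subsection \<open>Snapping a configuration to a grid\<close>

definition simple_on :: "'p set \<Rightarrow> 'p set \<Rightarrow> bool" where
  "simple_on \<kappa> B \<longleftrightarrow> (\<forall>p\<in>\<kappa> \<inter> B. \<forall>q\<in>\<kappa> \<inter> B. p = q)"

lemma simple_onD: "simple_on \<kappa> B \<Longrightarrow> p \<in> \<kappa> \<Longrightarrow> p \<in> B \<Longrightarrow> q \<in> \<kappa> \<Longrightarrow> q \<in> B \<Longrightarrow> p = q"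
  by (auto simp: simple_on_def)

text \<open>Columns are open intervals, so a point whose position is a column boundary lies in no cell. The cells
  start at level \<open>t\<close>, above which locally finite configurations have finitely many points.\<close>

locale grid =
  fixes u w t \<delta> :: real and K l :: nat
  assumes w: "0 < w" and t: "0 < t" and \<delta>: "0 < \<delta>"
begin

definition col :: "nat \<Rightarrow> real set" where
  "col a = {0..1} \<inter> {u + real a * w<..<u + (real a + 1) * w}"

definition row :: "nat \<Rightarrow> ennreal set" where
  "row b = {ennreal (t + real b * \<delta>)<..ennreal (t + (real b + 1) * \<delta>)}"

definition cell :: "nat \<times> nat \<Rightarrow> (real \<times> ennreal) set" where
  "cell q = col (fst q) \<times> row (snd q)"

definition cells :: "(nat \<times> nat) set" where
  "cells = {..<K} \<times> {..<l}"

definition snap :: "nat \<times> nat \<Rightarrow> real \<times> ennreal" where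
  "snap q = (u + (real (fst q) + 1 / 2) * w, ennreal (t + (real (snd q) + 1) * \<delta>))"

definition occupied :: "config \<Rightarrow> (nat \<times> nat) set" where
  "occupied \<kappa> = {q \<in> cells. \<kappa> \<inter> cell q \<noteq> {}}"

definition covered :: "config \<Rightarrow> bool" where
  "covered \<kappa> \<longleftrightarrow> (\<forall>p\<in>\<kappa>. ennreal t < snd p \<longrightarrow> (\<exists>q\<in>cells. p \<in> cell q))"

lemma finite_cells: "finite cells"
  by (simp add: cells_def)

lemma occupied_subset: "occupied \<kappa> \<subseteq> cells"
  by (auto simp: occupied_def)

lemma occupiedI: "q \<in> cells \<Longrightarrow> p \<in> \<kappa> \<Longrightarrow> p \<in> cell q \<Longrightarrow> q \<in> occupied \<kappa>"
  by (auto simp: occupied_def)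

lemma occupiedE:
  assumes "q \<in> occupied \<kappa>"
  obtains p where "q \<in> cells" "p \<in> \<kappa>" "p \<in> cell q"
  using assms by (auto simp: occupied_def)

lemma cellD: "p \<in> cell q \<Longrightarrow> fst p \<in> col (fst q) \<and> snd p \<in> row (snd q)"
  by (auto simp: cell_def mem_Times_iff)

lemma row_bounds:
  assumes "x \<in> row b"
  shows "ennreal t < x" "x \<le> ennreal (t + (real b + 1) * \<delta>)" "ennreal (t + (real b + 1) * \<delta>) \<le> x + ennreal \<delta>"
proof -
  have "ennreal t \<le> ennreal (t + real b * \<delta>)" using \<delta> by (intro ennreal_leI) simp
  then show "ennreal t < x" using assms by (auto simp: row_def)
  show "x \<le> ennreal (t + (real b + 1) * \<delta>)" using assms by (simp add: row_def)
  have "ennreal (t + (real b + 1) * \<delta>) = ennreal ((t + real b * \<delta>) + \<delta>)" by (simp add: algebra_simps)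
  also have "\<dots> = ennreal (t + real b * \<delta>) + ennreal \<delta>" using t \<delta> by (intro ennreal_plus) auto
  also have "\<dots> \<le> x + ennreal \<delta>" using assms by (intro add_right_mono) (auto simp: row_def)
  finally show "ennreal (t + (real b + 1) * \<delta>) \<le> x + ennreal \<delta>" .
qed

lemma row_index_mono:
  assumes "x \<in> row b" "y \<in> row b'" "x \<le> y"
  shows "b \<le> b'"
proof (rule ccontr)
  assume "\<not> b \<le> b'"
  then have "(real b' + 1) * \<delta> \<le> real b * \<delta>" using \<delta> by (intro mult_right_mono) auto
  then have "ennreal (t + (real b' + 1) * \<delta>) \<le> ennreal (t + real b * \<delta>)" by (intro ennreal_leI) simp
  also have "\<dots> < x" using assms(1) by (simp add: row_def)
  also have "x \<le> y" by fact
  finally show False using row_bounds(2)[OF assms(2)] by simp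
qed

lemma row_disjoint: "x \<in> row b \<Longrightarrow> x \<in> row b' \<Longrightarrow> b = b'"
  using row_index_mono[of x b x b'] row_index_mono[of x b' x b] by simp

lemma col_disjoint:
  assumes "s \<in> col a" "s \<in> col a'"
  shows "a = a'"
proof -
  have le: "a \<le> a'" if "s \<in> col a" "s \<in> col a'" for a a'
  proof (rule ccontr)
    assume "\<not> a \<le> a'"
    then have "(real a' + 1) * w \<le> real a * w" using w by (intro mult_right_mono) auto
    then show False using that by (simp add: col_def)
  qed
  show ?thesis using le[of a a'] le[of a' a] assms by simp
qed

lemma cell_disjoint: "disjoint_family_on cell cells"
  unfolding disjoint_family_on_def
  by (metis cellD col_disjoint row_disjoint prod_eqI disjoint_iff)

lemma col_near_mid: "s \<in> col a \<Longrightarrow> \<bar>s - (u + (real a + 1 / 2) * w)\<bar> \<le> w"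
  unfolding col_def using w by (auto simp: abs_le_iff algebra_simps)

lemma row_cover:
  assumes "ennreal t < x" "x \<le> ennreal (t + real l * \<delta>)"
  shows "\<exists>b<l. x \<in> row b"
proof -
  have "x < \<top>" using assms(2) by (auto intro: le_less_trans)
  then obtain r where r: "x = ennreal r" "0 \<le> r" by (cases x) auto
  have tr: "t < r" using assms(1) r t by (simp add: ennreal_less_iff)
  have rT: "r \<le> t + real l * \<delta>"
    using assms(2) t \<delta> unfolding r(1) by (subst (asm) ennreal_le_iff) auto
  define k where "k = \<lceil>(r - t) / \<delta>\<rceil>"
  have "0 < (r - t) / \<delta>" using tr \<delta> by simp
  then have k1: "1 \<le> k" by (simp add: k_def)
  have "(r - t) / \<delta> \<le> real l" using rT \<delta> by (simp add: field_simps)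
  then have kl: "k \<le> int l" by (simp add: k_def ceiling_le_iff)
  define b where "b = nat (k - 1)"
  have b: "real b = real_of_int k - 1" "b < l" using k1 kl by (auto simp: b_def)
  have "real_of_int k - 1 < (r - t) / \<delta>" "(r - t) / \<delta> \<le> real_of_int k" unfolding k_def by linarith+
  then have "real b < (r - t) / \<delta>" "(r - t) / \<delta> \<le> real b + 1" using b(1) by simp_all
  then have "t + real b * \<delta> < r" "r \<le> t + (real b + 1) * \<delta>" using \<delta> by (simp_all add: field_simps)
  then have "x \<in> row b" unfolding row_def r(1) using t \<delta> r by (simp add: ennreal_less_iff ennreal_leI del: ennreal_plus)
  then show ?thesis using b(2) by blast
qed

lemma snap_height:
  "p \<in> cell q \<Longrightarrow> ennreal t < snd p \<and> snd p \<le> snd (snap q) \<and> snd (snap q) \<le> snd p + ennreal \<delta>"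
  using row_bounds[of "snd p" "snd q"] cellD[of p q] by (simp add: snap_def)

lemma snap_height_less: "b < b' \<Longrightarrow> snd (snap (a, b)) < snd (snap (a', b'))"
  using \<delta> t by (auto simp: snap_def ennreal_lessI)

text \<open>Points of a covered configuration outside the cells have height at most \<open>t\<close>, and snapping raises a point by at most \<open>\<delta>\<close>. The
  threshold \<open>r'\<close> differs from \<open>r\<close> because snapping also moves the positions.\<close>

lemma tail_height_snap:
  assumes cov: "covered \<kappa>"
    and thr: "\<And>p q. p \<in> \<kappa> \<Longrightarrow> q \<in> cells \<Longrightarrow> p \<in> cell q \<Longrightarrow> r \<le> fst p \<longleftrightarrow> r' \<le> fst (snap q)"
  shows "\<bar>enn2real (tail_height \<kappa> r) - enn2real (tail_height (snap ` occupied \<kappa>) r')\<bar> \<le> t + \<delta>"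
proof -
  let ?a = "tail_height (snap ` occupied \<kappa>) r'" and ?b = "tail_height \<kappa> r"
  have "?b \<le> max ?a (ennreal t)"
    unfolding tail_height_def[of \<kappa>]
  proof (rule Sup_least, elim CollectE exE conjE)
    fix x s assume s: "r \<le> s" "(s, x) \<in> \<kappa>"
    show "x \<le> max ?a (ennreal t)"
    proof (cases "ennreal t < x")
      case True
      then obtain q where q: "q \<in> cells" "(s, x) \<in> cell q" using cov s(2) by (force simp: covered_def)
      then have "r' \<le> fst (snap q)" using thr[OF s(2) q] s(1) by simp
      moreover have "q \<in> occupied \<kappa>" using occupiedI[OF q(1) s(2) q(2)] .
      ultimately have "snd (snap q) \<in> {x. \<exists>s\<ge>r'. (s, x) \<in> snap ` occupied \<kappa>}"
        by (intro CollectI exI[of _ "fst (snap q)"]) simp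
      then have "snd (snap q) \<le> ?a" unfolding tail_height_def by (rule Sup_upper)
      then show ?thesis using snap_height[OF q(2)] by (auto intro: max.coboundedI1)
    qed (simp add: max.coboundedI2)
  qed
  moreover have "?a \<le> ?b + ennreal \<delta>"
    unfolding tail_height_def[of "snap ` occupied \<kappa>"]
  proof (rule Sup_least, elim CollectE exE conjE imageE)
    fix y s q assume s: "r' \<le> s" "(s, y) = snap q" "q \<in> occupied \<kappa>"
    then obtain p where p: "q \<in> cells" "p \<in> \<kappa>" "p \<in> cell q" using occupiedE by blast
    have "r \<le> fst p" using thr[OF p(2,1,3)] s by (metis fst_conv)
    then have "snd p \<in> {x. \<exists>s\<ge>r. (s, x) \<in> \<kappa>}" using p(2) by (intro CollectI exI[of _ "fst p"]) simp
    then have "snd p \<le> ?b" unfolding tail_height_def by (rule Sup_upper)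
    moreover have "y \<le> snd p + ennreal \<delta>" using snap_height[OF p(3)] s(2) by (metis snd_conv)
    ultimately show "y \<le> ?b + ennreal \<delta>" by (meson add_right_mono order_trans)
  qed
  ultimately have "\<bar>enn2real ?a - enn2real ?b\<bar> \<le> max t \<delta>"
    using t \<delta> by (intro enn2real_diff_le) auto
  then show ?thesis using t \<delta> by (auto simp: abs_minus_commute max_def split: if_splits)
qed

lemma max_config_snap:
  assumes "\<kappa> \<in> configs" "covered \<kappa>"
  shows "\<bar>max_config \<kappa> - enn2real (tail_height (snap ` occupied \<kappa>) u)\<bar> \<le> t + \<delta>"
  unfolding max_config_eq[OF assms(1)]
proof (rule tail_height_snap[OF assms(2)])
  fix p q assume "p \<in> \<kappa>"
  then show "0 \<le> fst p \<longleftrightarrow> u \<le> fst (snap q)"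
    using configs_point[OF assms(1)] w by (auto simp: snap_def)
qed

lemma snap_in_configs:
  assumes "u = 0" "w * K = 1" "S \<subseteq> cells"
  shows "snap ` S \<in> configs"
proof (rule finite_in_configs)
  show "finite (snap ` S)" using finite_subset[OF assms(3) finite_cells] by simp
  have "snap q \<in> {0..1} \<times> Rplus" if "q \<in> cells" for q
  proof -
    have "(real (fst q) + 1 / 2) * w \<le> K * w" using that w by (intro mult_right_mono) (auto simp: cells_def)
    then have "fst (snap q) \<in> {0..1}"
      unfolding snap_def using assms(1,2) w by (simp add: mult.commute)
    moreover have "snd (snap q) \<in> Rplus" using t \<delta> by (auto simp: snap_def Rplus_def add_pos_nonneg)
    ultimately show ?thesis by (simp add: mem_Times_iff)
  qed
  then show "snap ` S \<subseteq> {0..1} \<times> Rplus" using assms(3) by blast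
qed

text \<open>When every column contains at most one point, a time change moves all points to the middle of
  their column at once, and then the two paths differ only through the heights.\<close>

lemma path_config_snap:
  assumes \<kappa>: "\<kappa> \<in> configs" and cov: "covered \<kappa>" and u: "u = 0" and wK: "w * K = 1"
    and simple: "\<And>a. a < K \<Longrightarrow> simple_on \<kappa> (col a \<times> {ennreal t<..})"
  shows "skorokhod_dist (path_config \<kappa>) (path_config (snap ` occupied \<kappa>)) \<le> w + t + \<delta>"
proof -
  define A where "A = {a. a < K \<and> \<kappa> \<inter> col a \<times> {ennreal t<..} \<noteq> {}}"
  have "\<exists>p. p \<in> \<kappa> \<inter> col a \<times> {ennreal t<..}" if "a \<in> A" for a using that by (auto simp: A_def)
  then obtain pt where pt: "\<And>a. a \<in> A \<Longrightarrow> pt a \<in> \<kappa> \<inter> col a \<times> {ennreal t<..}" by metis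
  have ucol: "col a = {0..1} \<inter> {real a * w<..<(real a + 1) * w}" for a
    unfolding col_def by (simp add: u)
  have end1: "(real a + 1) * w \<le> 1" if "a < K" for a
    using mult_right_mono[of "real a + 1" "real K" w] that w wK by (simp add: mult.commute)
  have pins: "0 \<le> real a * w \<and> real a * w < fst (pt a) \<and> fst (pt a) < (real a + 1) * w \<and>
      real a * w < (real a + 1 / 2) * w \<and> (real a + 1 / 2) * w < (real a + 1) * w \<and> (real a + 1) * w \<le> 1"
    if "a \<in> A" for a
    using pt[OF that] w end1[of a] that by (auto simp: ucol A_def mem_Times_iff)
  have dis: "disjoint_family_on (\<lambda>a. {real a * w<..<(real a + 1) * w}) A"
    unfolding disjoint_family_on_def
  proof (intro ballI impI)
    fix a a' assume a: "a \<in> A" "a' \<in> A" "a \<noteq> a'"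
    have "s \<in> col b" if "b \<in> A" "s \<in> {real b * w<..<(real b + 1) * w}" for s b
      using pins[OF that(1)] that(2) by (auto simp: ucol)
    then show "{real a * w<..<(real a + 1) * w} \<inter> {real a' * w<..<(real a' + 1) * w} = {}"
      using a col_disjoint by blast
  qed
  have "finite A" by (simp add: A_def)
  obtain \<theta> where \<theta>: "\<theta> \<in> time_changes" "\<And>a. a \<in> A \<Longrightarrow> \<theta> (fst (pt a)) = (real a + 1 / 2) * w"
    "\<And>s. s \<notin> (\<Union>a\<in>A. {real a * w<..<(real a + 1) * w}) \<Longrightarrow> \<theta> s = s"
    using time_change_pins[OF \<open>finite A\<close> pins dis] by blast
  have "sk_close (path_config \<kappa>) (path_config (snap ` occupied \<kappa>)) (w + t + \<delta>)"
    unfolding sk_close_def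
  proof (intro conjI bexI[OF _ \<theta>(1)] ballI)
    show "0 < w + t + \<delta>" using w t \<delta> by simp
    fix s :: real assume s: "s \<in> {0..1}"
    have "\<bar>\<theta> s - s\<bar> \<le> w"
      using pins w by (intro time_change_displacement[OF \<theta>(1) _ _ dis \<theta>(3) s]) (auto simp: algebra_simps)
    then show "\<bar>\<theta> s - s\<bar> \<le> w + t + \<delta>" using t \<delta> by simp
    have "s \<le> fst p \<longleftrightarrow> \<theta> s \<le> fst (snap q)" if p: "p \<in> \<kappa>" "q \<in> cells" "p \<in> cell q" for p q
    proof -
      have pc: "p \<in> col (fst q) \<times> {ennreal t<..}"
        using cellD[OF p(3)] snap_height[OF p(3)] by (simp add: mem_Times_iff)
      have "fst q < K" using p(2) by (auto simp: cells_def)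
      then have A: "fst q \<in> A" using p(1) pc by (auto simp: A_def)
      have "p = pt (fst q)"
        by (rule simple_onD[OF simple[OF \<open>fst q < K\<close>] p(1) pc IntD1[OF pt[OF A]] IntD2[OF pt[OF A]]])
      then have "fst (snap q) = \<theta> (fst p)" unfolding snap_def using \<theta>(2)[OF A] by (simp add: u)
      moreover have "fst p \<in> {0..1}" using configs_point[OF \<kappa> p(1)] by simp
      ultimately show ?thesis using time_changes_le_iff[OF \<theta>(1) s] by simp
    qed
    then have "\<bar>enn2real (tail_height \<kappa> s) - enn2real (tail_height (snap ` occupied \<kappa>) (\<theta> s))\<bar> \<le> t + \<delta>"
      by (rule tail_height_snap[OF cov])
    then show "\<bar>path_config \<kappa> s - path_config (snap ` occupied \<kappa>) (\<theta> s)\<bar> \<le> w + t + \<delta>"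
      using w s time_changesD(5)[OF \<theta>(1) s] by (simp add: path_config_eq)
  qed
  then show ?thesis
    by (intro sk_close_le path_config_D01 \<kappa> snap_in_configs u wK occupied_subset)
qed

text \<open>When every row contains at most one point, the highest occupied cell contains the highest
  point and no other.\<close>

lemma argmax_config_snap:
  assumes \<kappa>: "\<kappa> \<in> configs" and cov: "covered \<kappa>"
    and simple: "\<And>b. b < l \<Longrightarrow> simple_on \<kappa> ({0..1} \<times> row b)"
    and ne: "\<kappa> \<inter> {0..1} \<times> {ennreal t<..} \<noteq> {}"
  obtains p where "is_top \<kappa> p" "\<And>q. is_top \<kappa> q \<Longrightarrow> q = p"
    "\<bar>fst p - argmax_config (snap ` occupied \<kappa>)\<bar> \<le> w"
proof -
  obtain p0 where p0: "p0 \<in> \<kappa>" "ennreal t < snd p0" using ne by auto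
  obtain p where top: "is_top \<kappa> p" using is_top_exists[OF \<kappa> p0(1) less_imp_le[OF p0(2)] t] by blast
  then have p: "p \<in> \<kappa>" "\<And>q. q \<in> \<kappa> \<Longrightarrow> snd q \<le> snd p" by (auto simp: is_top_def)
  have "ennreal t < snd p" using p(2)[OF p0(1)] p0(2) by simp
  then obtain q where q: "q \<in> cells" "p \<in> cell q" using cov p(1) by (auto simp: covered_def)
  have ql: "snd q < l" using q(1) by (auto simp: cells_def)
  have same_row: "r = p" if "r \<in> \<kappa>" "snd r \<in> row (snd q)" for r
    using simple_onD[OF simple[OF ql] that(1) _ p(1)] that cellD[OF q(2)] configs_point[OF \<kappa>] p(1)
    by (simp add: mem_Times_iff)
  have uni: "r = p" if "is_top \<kappa> r" for r
  proof -
    have "r \<in> \<kappa>" "snd p \<le> snd r" using that p(1) by (auto simp: is_top_def)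
    moreover from this have "snd r = snd p" using p(2) by (intro antisym)
    ultimately show ?thesis using cellD[OF q(2)] by (intro same_row) auto
  qed
  have high: "q' = q \<or> snd (snap q') < snd (snap q)" if q': "q' \<in> occupied \<kappa>" for q'
  proof -
    obtain r where r: "q' \<in> cells" "r \<in> \<kappa>" "r \<in> cell q'" using occupiedE[OF q'] by blast
    have "snd q' \<le> snd q"
      using row_index_mono[of "snd r" "snd q'" "snd p" "snd q"] cellD[OF r(3)] cellD[OF q(2)] p(2)[OF r(2)] by simp
    moreover have "q' = q" if "snd q' = snd q"
    proof -
      have "r = p" using same_row[OF r(2)] cellD[OF r(3)] that by simp
      then have "fst q' = fst q" using col_disjoint[of "fst p"] cellD[OF r(3)] cellD[OF q(2)] by simp
      then show ?thesis using that by (simp add: prod_eq_iff)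
    qed
    ultimately show ?thesis
      using snap_height_less[of "snd q'" "snd q" "fst q'" "fst q"] by (cases "snd q' = snd q") auto
  qed
  have "is_top (snap ` occupied \<kappa>) (snap q)"
    unfolding is_top_def
  proof (intro conjI ballI imageI)
    show "q \<in> occupied \<kappa>" using occupiedI[OF q(1) p(1) q(2)] .
    fix s assume "s \<in> snap ` occupied \<kappa>"
    then obtain q' where "q' \<in> occupied \<kappa>" "s = snap q'" by blast
    then show "snd s \<le> snd (snap q)" using high[of q'] by (auto intro: less_imp_le)
  qed
  moreover have "s = snap q" if s: "is_top (snap ` occupied \<kappa>) s" for s
  proof -
    obtain q' where q': "q' \<in> occupied \<kappa>" "s = snap q'" using s by (auto simp: is_top_def)
    have "snd (snap q) \<le> snd s" using s occupiedI[OF q(1) p(1) q(2)] by (auto simp: is_top_def)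
    then show ?thesis using high[OF q'(1)] q'(2) by auto
  qed
  ultimately have "argmax_config (snap ` occupied \<kappa>) = fst (snap q)" by (rule argmax_config_unique)
  then have "\<bar>fst p - argmax_config (snap ` occupied \<kappa>)\<bar> \<le> w"
    using col_near_mid[of "fst p" "fst q"] cellD[OF q(2)] by (simp add: snap_def)
  then show thesis using top uni that by blast
qed

end

lemma arg_max_on_row_config:
  assumes x: "\<And>j. j \<in> {1..n} \<Longrightarrow> 0 \<le> x j"
    and top: "is_top (row_config n x) p" and uni: "\<And>q. is_top (row_config n x) q \<Longrightarrow> q = p"
  shows "real (arg_max_on x {1..n}) / real n = fst p"
proof -
  have pt: "(real i / real n, ennreal (x i)) \<in> row_config n x" if "i \<in> {1..n}" "0 < x i" for i
    using that by (auto simp: row_config_def Rplus_def)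
  obtain j where j: "j \<in> {1..n}" "p = (real j / real n, ennreal (x j))" "0 < x j"
    using top by (auto simp: is_top_def row_config_def Rplus_def)
  have le: "x i \<le> x j" if i: "i \<in> {1..n}" for i
  proof (cases "0 < x i")
    case True
    then have "ennreal (x i) \<le> ennreal (x j)" using top pt[OF i True] j by (force simp: is_top_def)
    then show ?thesis using j(3) by (simp add: ennreal_le_iff)
  qed (use j in simp)
  have "i = j" if i: "i \<in> {1..n}" "x j \<le> x i" for i
  proof -
    have "x i = x j" using le[OF i(1)] i(2) by simp
    then have "is_top (row_config n x) (real i / real n, ennreal (x i))"
      using pt[OF i(1)] j top by (auto simp: is_top_def)
    then have "(real i / real n, ennreal (x i)) = p" by (rule uni)
    then have "real i / real n = real j / real n" using j(2) by simp
    then show ?thesis using j(1) by simp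
  qed
  then have "arg_max_on x {1..n} = j"
    unfolding arg_max_on_def arg_max_def is_arg_max_def
    using j(1) le by (intro some_equality) (auto simp: not_less)
  then show ?thesis using j(2) by simp
qed

section \<open>The intensities\<close>

text \<open>For \<open>0 \<le> p \<le> b \<le> 1 / 2\<close> the factor \<open>1 - p\<close> lies between \<open>exp (- (1 + 2 b) p)\<close> and \<open>exp (- p)\<close>.\<close>

lemma prod_one_minus_tendsto_exp:
  fixes p :: "nat \<Rightarrow> 'i \<Rightarrow> real"
  assumes fin: "\<And>n. finite (A n)"
    and p: "\<forall>\<^sub>F n in sequentially. \<forall>j\<in>A n. 0 \<le> p n j \<and> p n j \<le> b n"
    and b: "b \<longlonglongrightarrow> 0" and sum: "(\<lambda>n. \<Sum>j\<in>A n. p n j) \<longlonglongrightarrow> s"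
  shows "(\<lambda>n. \<Prod>j\<in>A n. 1 - p n j) \<longlonglongrightarrow> exp (- s)"
proof (rule tendsto_sandwich)
  have small: "\<forall>\<^sub>F n in sequentially. b n < 1 / 2" by (rule order_tendstoD(2)[OF b]) simp
  show "\<forall>\<^sub>F n in sequentially. exp (- (1 + 2 * b n) * (\<Sum>j\<in>A n. p n j)) \<le> (\<Prod>j\<in>A n. 1 - p n j)"
    using p small
  proof eventually_elim
    case (elim n)
    have "exp (- (1 + 2 * b n) * (\<Sum>j\<in>A n. p n j)) = (\<Prod>j\<in>A n. exp (- (1 + 2 * b n) * p n j))"
      using fin by (simp add: exp_sum[symmetric] sum_distrib_left)
    also have "\<dots> \<le> (\<Prod>j\<in>A n. 1 - p n j)"
    proof (rule prod_mono, intro conjI)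
      fix j assume "j \<in> A n"
      then have j: "0 \<le> p n j" "p n j \<le> b n" using elim by auto
      then have "p n j * p n j \<le> p n j * b n" by (intro mult_left_mono) auto
      then have "- (1 + 2 * b n) * p n j \<le> - p n j - 2 * (p n j)\<^sup>2" by (simp add: power2_eq_square algebra_simps)
      also have "\<dots> \<le> ln (1 - p n j)" using j elim by (intro ln_one_minus_pos_lower_bound) auto
      finally show "exp (- (1 + 2 * b n) * p n j) \<le> 1 - p n j"
        using j elim by (simp add: ln_ge_iff)
    qed simp
    finally show ?case .
  qed
  show "\<forall>\<^sub>F n in sequentially. (\<Prod>j\<in>A n. 1 - p n j) \<le> exp (- (\<Sum>j\<in>A n. p n j))"
    using p small
  proof eventually_elim
    case (elim n)
    have "(\<Prod>j\<in>A n. 1 - p n j) \<le> (\<Prod>j\<in>A n. exp (- p n j))"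
    proof (rule prod_mono)
      fix j assume "j \<in> A n"
      then have "p n j \<le> 1 / 2" using elim by fastforce
      then show "0 \<le> 1 - p n j \<and> 1 - p n j \<le> exp (- p n j)"
        using exp_ge_add_one_self[of "- p n j"] by simp
    qed
    then show ?case using fin by (simp add: exp_sum[symmetric] sum_negf)
  qed
  have "(\<lambda>n. exp (- (1 + 2 * b n) * (\<Sum>j\<in>A n. p n j))) \<longlonglongrightarrow> exp (- (1 + 2 * 0) * s)"
    by (intro tendsto_intros b sum)
  then show "(\<lambda>n. exp (- (1 + 2 * b n) * (\<Sum>j\<in>A n. p n j))) \<longlonglongrightarrow> exp (- s)" by simp
  show "(\<lambda>n. exp (- (\<Sum>j\<in>A n. p n j))) \<longlonglongrightarrow> exp (- s)" by (intro tendsto_intros sum)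
qed

subsection \<open>Heights\<close>

text \<open>Being linear in the reciprocal height, the ramp is Lipschitz for \<open>rho\<close>. As \<open>m\<close> grows it converges
  to the indicator of the heights above \<open>h\<close>.\<close>

definition height_ramp :: "real \<Rightarrow> nat \<Rightarrow> ennreal \<Rightarrow> real" where
  "height_ramp h m x = min 1 (max 0 (real m * (1 / h - enn2real (inverse x))))"

lemma inverse_less_iff:
  assumes "0 < h" "x \<in> Rplus"
  shows "enn2real (inverse x) < 1 / h \<longleftrightarrow> ennreal h < x"
proof (cases x)
  case (real r)
  then have "0 < r" using assms(2) by (cases "r = 0") (auto simp: Rplus_def)
  then show ?thesis using real assms(1) by (simp add: inverse_ennreal ennreal_less_iff field_simps)
qed (use assms in simp)

lemma height_ramp_le_indicator:
  assumes "0 < h" "x \<in> Rplus"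
  shows "\<bar>height_ramp h m x\<bar> \<le> indicator {ennreal h<..} x"
proof (cases "ennreal h < x")
  case False
  then have "1 / h - enn2real (inverse x) \<le> 0" using inverse_less_iff[OF assms] by simp
  then have "real m * (1 / h - enn2real (inverse x)) \<le> 0" by (intro mult_nonneg_nonpos) auto
  then show ?thesis by (simp add: height_ramp_def max_absorb1)
qed (simp add: height_ramp_def)

lemma height_ramp_limit:
  assumes "0 < h" "x \<in> Rplus"
  shows "(\<lambda>m. height_ramp h m x) \<longlonglongrightarrow> indicator {ennreal h<..} x"
proof (cases "ennreal h < x")
  case True
  then have y: "0 < 1 / h - enn2real (inverse x)" using inverse_less_iff[OF assms] by simp
  obtain m0 :: nat where m0: "1 / (1 / h - enn2real (inverse x)) < real m0" using reals_Archimedean2 by blast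
  have "height_ramp h m x = 1" if "m0 \<le> m" for m
  proof -
    have "1 / (1 / h - enn2real (inverse x)) < real m" using m0 that by linarith
    then have "1 \<le> real m * (1 / h - enn2real (inverse x))" using y by (simp only: pos_divide_less_eq less_imp_le)
    then show ?thesis by (simp add: height_ramp_def)
  qed
  then have "\<forall>\<^sub>F m in sequentially. height_ramp h m x = 1" unfolding eventually_sequentially by blast
  then show ?thesis using True by (simp add: tendsto_eventually)
next
  case False
  then have "height_ramp h m x = 0" for m using height_ramp_le_indicator[OF assms, of m] by simp
  then show ?thesis using False by simp
qed

lemma height_ramp_CK_plus_from:
  assumes "0 < t" "t \<le> h"
  shows "height_ramp h m \<in> CK_plus_from t"
proof -
  have h: "0 < h" using assms by simp
  let ?S = "{x \<in> Rplus. height_ramp h m x \<noteq> 0}" and ?K = "{ennreal t..}"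
  have "continuous_map Rplus_top euclideanreal (height_ramp h m)"
  proof (rule Metric_space.lipschitz_imp_continuous_map[OF Metric_space_rho, where K="real m"])
    fix x y
    have "\<bar>height_ramp h m x - height_ramp h m y\<bar> \<le>
      \<bar>real m * (1 / h - enn2real (inverse x)) - real m * (1 / h - enn2real (inverse y))\<bar>"
      unfolding height_ramp_def by linarith
    also have "\<dots> = real m * rho x y"
      unfolding rho_def right_diff_distrib[symmetric] abs_mult by (simp add: abs_minus_commute)
    finally show "\<bar>height_ramp h m x - height_ramp h m y\<bar> \<le> real m * rho x y" .
  qed
  moreover have "?S \<subseteq> ?K"
  proof
    fix x assume "x \<in> ?S"
    then have "ennreal h < x" using height_ramp_le_indicator[OF h, of x m] by (cases "ennreal h < x") auto
    moreover have "ennreal t \<le> ennreal h" using assms by (intro ennreal_leI)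
    ultimately show "x \<in> ?K" by auto
  qed
  moreover have KR: "?K \<subseteq> Rplus" using assms ennreal_tail_Rplus(1) by blast
  have closed: "closedin Rplus_top ?K"
    unfolding Rplus_top_eq closedin_closed using KR by (intro exI[of _ ?K]) auto
  have compact: "compactin Rplus_top ?K"
  proof -
    have "compact (UNIV \<inter> ?K)" by (intro compact_Int_closed compact_UNIV closed_atLeast)
    then show ?thesis unfolding Rplus_top_eq by (simp add: compactin_subtopology KR)
  qed
  have "Rplus_top closure_of ?S \<subseteq> ?K" by (rule closure_of_minimal[OF \<open>?S \<subseteq> ?K\<close> closed])
  moreover have "compactin Rplus_top (Rplus_top closure_of ?S)"
    by (rule closed_compactin[OF compact]) (use \<open>Rplus_top closure_of ?S \<subseteq> ?K\<close> in auto)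
  ultimately show ?thesis by (simp add: CK_plus_from_def height_ramp_def)
qed

lemma CK_plus_from_scale:
  assumes "f \<in> CK_plus_from t" "0 < (k::real)"
  shows "(\<lambda>x. k * f x) \<in> CK_plus_from t"
proof -
  have "{x \<in> Rplus. k * f x \<noteq> 0} = {x \<in> Rplus. f x \<noteq> 0}" using assms(2) by auto
  moreover have "continuous_map Rplus_top euclideanreal (\<lambda>x. k * f x)"
    using assms(1) by (intro continuous_map_real_mult) (auto simp: CK_plus_from_def)
  ultimately show ?thesis using assms by (auto simp: CK_plus_from_def)
qed

text \<open>\<open>CK_plus_from t\<close> is a cone, so the supremum defining \<open>Delta\<close> is 0 or infinite. Once it is
  below 1 it vanishes.\<close>

lemma Delta_tendsto_0_imp_eq:
  assumes "(\<lambda>n. Delta M X c \<gamma> n t) \<longlonglongrightarrow> 0"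
  shows "\<forall>\<^sub>F n in sequentially. \<forall>f\<in>CK_plus_from t. \<forall>j\<in>{1..n}.
    row_sum c n / c n j * (\<integral>x. f x \<partial>Rplus_law (M n) (X n j)) = (\<integral>x. f x \<partial>\<gamma>)"
proof -
  have "\<forall>\<^sub>F n in sequentially. Delta M X c \<gamma> n t < 1" by (rule order_tendstoD(2)[OF assms]) simp
  then show ?thesis
  proof eventually_elim
    case (elim n)
    show ?case
    proof (intro ballI)
      fix f j assume f: "f \<in> CK_plus_from t" and j: "j \<in> {1..n}"
      define dev where "dev g = \<bar>row_sum c n / c n j * (\<integral>x. g x \<partial>Rplus_law (M n) (X n j)) - (\<integral>x. g x \<partial>\<gamma>)\<bar>" for g
      have dev: "dev g < 1" if "g \<in> CK_plus_from t" for g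
      proof -
        have "ennreal (dev g) \<le> (MAX j\<in>{1..n}.
            ennreal \<bar>row_sum c n / c n j * (\<integral>x. g x \<partial>Rplus_law (M n) (X n j)) - (\<integral>x. g x \<partial>\<gamma>)\<bar>)"
          unfolding dev_def using j by (intro Max_ge) auto
        also have "\<dots> \<le> Delta M X c \<gamma> n t" unfolding Delta_def using that by (rule SUP_upper)
        also have "\<dots> < 1" by (rule elim)
        finally show ?thesis by (simp add: ennreal_less_one_iff dev_def)
      qed
      have scale: "dev (\<lambda>x. k * f x) = k * dev f" if "0 < k" for k
      proof -
        have "dev (\<lambda>x. k * f x) = \<bar>k * (row_sum c n / c n j * (\<integral>x. f x \<partial>Rplus_law (M n) (X n j)) - (\<integral>x. f x \<partial>\<gamma>))\<bar>"
          unfolding dev_def by (simp add: algebra_simps)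
        then show ?thesis using that by (simp only: abs_mult dev_def) simp
      qed
      have "dev f = 0"
      proof (rule ccontr)
        assume "dev f \<noteq> 0"
        then have "0 < dev f" by (simp add: dev_def)
        then show False using dev[OF CK_plus_from_scale[OF f, of "1 / dev f"]] scale[of "1 / dev f"] by simp
      qed
      then show "row_sum c n / c n j * (\<integral>x. f x \<partial>Rplus_law (M n) (X n j)) = (\<integral>x. f x \<partial>\<gamma>)"
        by (simp add: dev_def)
    qed
  qed
qed

lemma integral_height_ramp_limit:
  assumes "sets \<nu> = sets Rplus_borel" "emeasure \<nu> {ennreal h<..} < \<infinity>" "0 < h"
  shows "(\<lambda>m. \<integral>x. height_ramp h m x \<partial>\<nu>) \<longlonglongrightarrow> measure \<nu> {ennreal h<..}"
proof -
  have sp: "space \<nu> = Rplus" using sets_eq_imp_space_eq[OF assms(1)] by (simp add: space_restrict_space)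
  have S: "{ennreal h<..} \<in> sets \<nu>"
    unfolding assms(1) using ennreal_tail_Rplus(2)[of "ennreal h"]
    by (subst sets_restrict_space_iff) (auto simp: Rplus_def)
  have meas: "height_ramp h m \<in> borel_measurable \<nu>" for m
  proof -
    have "height_ramp h m \<in> borel_measurable Rplus_borel"
      unfolding height_ramp_def by (intro measurable_restrict_space1) measurable
    then show ?thesis using measurable_cong_sets[OF assms(1) refl] by blast
  qed
  have "(\<lambda>m. \<integral>x. height_ramp h m x \<partial>\<nu>) \<longlonglongrightarrow> (\<integral>x. indicator {ennreal h<..} x \<partial>\<nu>)"
  proof (rule integral_dominated_convergence[where w="indicator {ennreal h<..}"])
    show "integrable \<nu> (indicator {ennreal h<..} :: ennreal \<Rightarrow> real)"
      using S assms(2) by (simp add: integrable_indicator_iff Int_absorb2 sets.sets_into_space)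
    show "AE x in \<nu>. (\<lambda>m. height_ramp h m x) \<longlonglongrightarrow> indicator {ennreal h<..} x"
      using height_ramp_limit[OF assms(3)] sp by auto
    show "AE x in \<nu>. norm (height_ramp h m x) \<le> indicator {ennreal h<..} x" for m
      using height_ramp_le_indicator[OF assms(3)] sp by auto
  qed (use S meas in auto)
  then show ?thesis using S by (simp add: Int_absorb2 sets.sets_into_space)
qed

lemma sets_Rplus_law: "sets (Rplus_law R Y) = sets Rplus_borel"
  unfolding Rplus_law_def by (intro sets_restrict_space_cong) simp

lemma measure_Rplus_law:
  assumes "Y \<in> borel_measurable R" "H \<in> sets borel" "H \<subseteq> Rplus"
  shows "measure (Rplus_law R Y) H = measure R {\<omega> \<in> space R. ennreal (Y \<omega>) \<in> H}"
proof -
  have R: "Rplus \<in> sets borel" by (simp add: Rplus_def)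
  have "measure (Rplus_law R Y) H = measure (distr R borel (\<lambda>\<omega>. ennreal (Y \<omega>))) H"
    unfolding Rplus_law_def using assms(3) R by (intro measure_restrict_space) auto
  also have "\<dots> = measure R {\<omega> \<in> space R. ennreal (Y \<omega>) \<in> H}"
    using assms by (subst measure_distr) (auto simp: vimage_def Int_def conj_commute)
  finally show ?thesis .
qed

text \<open>The height ramps from \<open>h\<close> converge to the indicator of the heights above \<open>h\<close> and are dominated by it,
  so the equality of their integrals passes to the tails.\<close>

lemma scaled_law_eq:
  assumes R: "prob_space R" and Y: "Y \<in> borel_measurable R"
    and \<gamma>: "sets \<gamma> = sets Rplus_borel" "emeasure \<gamma> {ennreal t..} < \<infinity>"
    and eq: "\<And>f. f \<in> CK_plus_from t \<Longrightarrow> k * (\<integral>x. f x \<partial>Rplus_law R Y) = (\<integral>x. f x \<partial>\<gamma>)"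
    and t: "0 < t" "t \<le> h"
  shows "k * measure R {\<omega> \<in> space R. ennreal h < ennreal (Y \<omega>)} = measure \<gamma> {ennreal h<..}"
proof -
  interpret prob_space R by fact
  have h: "0 < h" using t by simp
  have "emeasure (Rplus_law R Y) {ennreal h<..} < \<infinity>"
  proof -
    have "finite_measure (distr R borel (\<lambda>\<omega>. ennreal (Y \<omega>)))" using Y by (intro finite_measure_distr) simp
    then have "finite_measure (Rplus_law R Y)"
      unfolding Rplus_law_def by (intro finite_measure_restrict_space) (auto simp: Rplus_def)
    then show ?thesis by (simp add: finite_measure.emeasure_finite less_top[symmetric])
  qed
  then have "(\<lambda>m. k * (\<integral>x. height_ramp h m x \<partial>Rplus_law R Y)) \<longlonglongrightarrow> k * measure (Rplus_law R Y) {ennreal h<..}"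
    by (intro tendsto_mult_left integral_height_ramp_limit sets_Rplus_law h)
  moreover have "emeasure \<gamma> {ennreal h<..} < \<infinity>"
  proof -
    have "ennreal t \<le> ennreal h" using t by (intro ennreal_leI) simp
    then have "{ennreal h<..} \<subseteq> {ennreal t..}" by auto
    moreover have "{ennreal t..} \<in> sets \<gamma>"
      unfolding \<gamma>(1) using ennreal_tail_Rplus(1)[OF t(1)] by (subst sets_restrict_space_iff) (auto simp: Rplus_def)
    ultimately have "emeasure \<gamma> {ennreal h<..} \<le> emeasure \<gamma> {ennreal t..}" by (rule emeasure_mono)
    then show ?thesis using \<gamma>(2) by (rule le_less_trans)
  qed
  then have "(\<lambda>m. \<integral>x. height_ramp h m x \<partial>\<gamma>) \<longlonglongrightarrow> measure \<gamma> {ennreal h<..}"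
    by (intro integral_height_ramp_limit \<gamma> h)
  moreover have "k * (\<integral>x. height_ramp h m x \<partial>Rplus_law R Y) = (\<integral>x. height_ramp h m x \<partial>\<gamma>)" for m
    by (rule eq[OF height_ramp_CK_plus_from[OF t]])
  ultimately have "k * measure (Rplus_law R Y) {ennreal h<..} = measure \<gamma> {ennreal h<..}"
    using LIMSEQ_unique by simp
  then show ?thesis using measure_Rplus_law[OF Y, of "{ennreal h<..}"] ennreal_tail_Rplus(2)[of "ennreal h"] by simp
qed

subsection \<open>Positions\<close>

text \<open>The mass that \<open>position_measure c n\<close> gives to the part of \<open>I\<close> inside the unit interval, written as
  a sum so that \<open>I\<close> may be any set of reals.\<close>

definition position_mass :: "(nat \<Rightarrow> nat \<Rightarrow> real) \<Rightarrow> nat \<Rightarrow> real set \<Rightarrow> real" where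
  "position_mass c n I = (\<Sum>j=1..n. c n j / row_sum c n * indicator I (real j / real n))"

lemma row_sum_pos: "(\<And>j. j \<in> {1..n} \<Longrightarrow> 0 < c n j) \<Longrightarrow> 1 \<le> n \<Longrightarrow> 0 < row_sum c n"
  unfolding row_sum_def by (intro sum_pos) auto

lemma integral_position_measure:
  fixes f :: "real \<Rightarrow> real"
  assumes c: "\<And>j. j \<in> {1..n} \<Longrightarrow> 0 < c n j" and f: "f \<in> borel_measurable borel"
  shows "(\<integral>x. f x \<partial>position_measure c n) = (\<Sum>j=1..n. c n j / row_sum c n * f (real j / real n))"
proof -
  have m: "(\<lambda>j. real j / real n) \<in> point_measure {1..n} (\<lambda>j. ennreal (c n j / row_sum c n)) \<rightarrow>\<^sub>M restrict_space borel {0..1}"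
    by (auto simp: measurable_def space_point_measure sets_point_measure space_restrict_space)
  have "(\<integral>x. f x \<partial>position_measure c n) =
      (\<integral>j. f (real j / real n) \<partial>point_measure {1..n} (\<lambda>j. ennreal (c n j / row_sum c n)))"
    unfolding position_measure_def using f by (intro integral_distr m measurable_restrict_space1)
  also have "\<dots> = (\<Sum>j=1..n. (c n j / row_sum c n) *\<^sub>R f (real j / real n))"
    using row_sum_pos[of n c, OF c] c by (intro lebesgue_integral_point_measure_finite) (auto intro!: divide_nonneg_nonneg less_imp_le)
  finally show ?thesis by simp
qed

context
  fixes c :: "nat \<Rightarrow> nat \<Rightarrow> real" and \<mu> :: "real measure"
  assumes c: "\<And>n j. j \<in> {1..n} \<Longrightarrow> 0 < c n j"
    and \<mu>: "sets \<mu> = sets (restrict_space borel {0..1})" "finite_measure \<mu>"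
    and weak: "weak_conv_top (top_of_set {0..1}) (position_measure c) \<mu>"
begin

lemma position_mass_mono: "I \<inter> {0..1} \<subseteq> I' \<Longrightarrow> position_mass c n I \<le> position_mass c n I'"
  unfolding position_mass_def using row_sum_pos[of n c, OF c] c
  by (intro sum_mono mult_left_mono) (auto simp: indicator_def intro!: divide_nonneg_nonneg less_imp_le)

lemma position_average_tendsto:
  fixes f :: "real \<Rightarrow> real"
  assumes f: "continuous_on UNIV f" and bd: "\<And>x. \<bar>f x\<bar> \<le> 1"
  shows "(\<lambda>n. \<Sum>j=1..n. c n j / row_sum c n * f (real j / real n)) \<longlonglongrightarrow> (\<integral>x. f x \<partial>\<mu>)"
proof -
  have "continuous_map (top_of_set {0..1}) euclideanreal f"
    using continuous_on_subset[OF f] by (simp add: continuous_map_iff_continuous)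
  moreover have "bounded (f ` topspace (top_of_set {0..1}))"
    using bd by (intro boundedI[of _ 1]) auto
  ultimately have "(\<lambda>n. \<integral>x. f x \<partial>position_measure c n) \<longlonglongrightarrow> (\<integral>x. f x \<partial>\<mu>)"
    using weak by (auto simp: weak_conv_top_def)
  moreover have "f \<in> borel_measurable borel" using f by (rule borel_measurable_continuous_onI)
  ultimately show ?thesis using integral_position_measure[OF c] by simp
qed

lemma position_set: "I \<in> sets borel \<Longrightarrow> {0..1} \<inter> I \<in> sets \<mu>"
  unfolding \<mu>(1) by (auto simp: sets_restrict_space)

text \<open>Both half-lines up to a point without mass are squeezed between the same continuous ramps.\<close>

lemma position_mass_half_lines:
  assumes x: "measure \<mu> ({0..1} \<inter> {x}) = 0"
  shows "(\<lambda>n. position_mass c n {..x}) \<longlonglongrightarrow> measure \<mu> ({0..1} \<inter> {..x})"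
    and "(\<lambda>n. position_mass c n {..<x}) \<longlonglongrightarrow> measure \<mu> ({0..1} \<inter> {..x})"
proof -
  interpret finite_measure \<mu> by (rule \<mu>(2))
  have sp: "space \<mu> = {0..1}" using sets_eq_imp_space_eq[OF \<mu>(1)] by (simp add: space_restrict_space)
  define L where "L = measure \<mu> ({0..1} \<inter> {..x})"
  have L': "measure \<mu> ({0..1} \<inter> {..<x}) = L"
  proof -
    have "L = measure \<mu> (({0..1} \<inter> {..<x}) \<union> ({0..1} \<inter> {x}))" unfolding L_def by (rule arg_cong[where f="measure \<mu>"]) auto
    also have "\<dots> = measure \<mu> ({0..1} \<inter> {..<x}) + measure \<mu> ({0..1} \<inter> {x})"
      by (intro finite_measure_Union position_set) auto
    finally show ?thesis using x by simp
  qed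
  define up where "up k s = min 1 (max 0 (1 - real k * (s - x)))" for k :: nat and s :: real
  define lo where "lo k s = min 1 (max 0 (real k * (x - s)))" for k :: nat and s :: real
  have cont: "continuous_on UNIV (up k)" "continuous_on UNIV (lo k)" for k
    unfolding up_def lo_def by (intro continuous_intros)+
  have bd: "\<bar>up k s\<bar> \<le> 1" "\<bar>lo k s\<bar> \<le> 1" for k s by (auto simp: up_def lo_def)
  have meas: "up k \<in> borel_measurable \<mu>" "lo k \<in> borel_measurable \<mu>" for k
    using cont[of k, THEN borel_measurable_continuous_onI] measurable_cong_sets[OF \<mu>(1) refl]
    by (auto intro: measurable_restrict_space1)
  have ind_meas: "(indicator I :: real \<Rightarrow> real) \<in> borel_measurable \<mu>" if "I \<in> sets borel" for I :: "real set" 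
    using measurable_cong_sets[OF \<mu>(1) refl, of borel] that
    by (metis borel_measurable_indicator measurable_restrict_space1)
  have lim_up: "(\<lambda>k. up k s) \<longlonglongrightarrow> indicator {..x} s" for s
  proof (cases "s \<le> x")
    case True
    then have "real k * (s - x) \<le> 0" for k by (intro mult_nonneg_nonpos) auto
    then have "up k s = 1" for k unfolding up_def by (simp add: min_absorb1 max_absorb2 order_trans[OF _ zero_le_one])
    then show ?thesis using True by simp
  next
    case False
    then obtain k0 :: nat where k0: "1 / (s - x) < real k0" using reals_Archimedean2 by blast
    have "up k s = 0" if "k0 \<le> k" for k
    proof -
      have "1 / (s - x) < real k" using k0 that by linarith
      then have "1 < real k * (s - x)" using False by (simp only: pos_divide_less_eq diff_gt_0_iff_gt not_le)
      then show ?thesis by (simp add: up_def)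
    qed
    then have "\<forall>\<^sub>F k in sequentially. up k s = 0" unfolding eventually_sequentially by blast
    then show ?thesis using False by (simp add: tendsto_eventually)
  qed
  have lim_lo: "(\<lambda>k. lo k s) \<longlonglongrightarrow> indicator {..<x} s" for s
  proof (cases "s < x")
    case True
    then obtain k0 :: nat where k0: "1 / (x - s) < real k0" using reals_Archimedean2 by blast
    have "lo k s = 1" if "k0 \<le> k" for k
    proof -
      have "1 / (x - s) < real k" using k0 that by linarith
      then have "1 < real k * (x - s)" using True by (simp only: pos_divide_less_eq diff_gt_0_iff_gt)
      then show ?thesis by (simp add: lo_def)
    qed
    then have "\<forall>\<^sub>F k in sequentially. lo k s = 1" unfolding eventually_sequentially by blast
    then show ?thesis using True by (simp add: tendsto_eventually)
  next
    case False
    then have "real k * (x - s) \<le> 0" for k by (intro mult_nonneg_nonpos) auto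
    then have "lo k s = 0" for k unfolding lo_def by (simp add: max_absorb1)
    then show ?thesis using False by simp
  qed
  have "(\<lambda>k. \<integral>s. up k s \<partial>\<mu>) \<longlonglongrightarrow> (\<integral>s. indicator {..x} s \<partial>\<mu>)"
    by (rule integral_dominated_convergence[where w="\<lambda>_. 1"]) (use lim_up bd meas ind_meas in auto)
  then have up: "(\<lambda>k. \<integral>s. up k s \<partial>\<mu>) \<longlonglongrightarrow> L" by (simp add: L_def sp Int_commute)
  have "(\<lambda>k. \<integral>s. lo k s \<partial>\<mu>) \<longlonglongrightarrow> (\<integral>s. indicator {..<x} s \<partial>\<mu>)"
    by (rule integral_dominated_convergence[where w="\<lambda>_. 1"]) (use lim_lo bd meas ind_meas in auto)
  then have lo: "(\<lambda>k. \<integral>s. lo k s \<partial>\<mu>) \<longlonglongrightarrow> L" by (simp add: L'[symmetric] sp Int_commute)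
  have weight: "0 \<le> c n j / row_sum c n" if "j \<in> {1..n}" for n j
    using that row_sum_pos[of n c, OF c] c[OF that] by (auto intro!: divide_nonneg_nonneg less_imp_le)
  have upper: "position_mass c n {..x} \<le> (\<Sum>j=1..n. c n j / row_sum c n * up k (real j / real n))" for n k
    unfolding position_mass_def
  proof (intro sum_mono mult_left_mono weight)
    fix j show "indicator {..x} (real j / real n) \<le> up k (real j / real n)"
      using mult_nonneg_nonpos[of "real k" "real j / real n - x"]
      by (cases "real j / real n \<le> x") (auto simp: up_def)
  qed
  have lower: "(\<Sum>j=1..n. c n j / row_sum c n * lo k (real j / real n)) \<le> position_mass c n {..<x}" for n k
    unfolding position_mass_def
  proof (intro sum_mono mult_left_mono weight)
    fix j show "lo k (real j / real n) \<le> indicator {..<x} (real j / real n)"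
      using mult_nonneg_nonpos[of "real k" "x - real j / real n"]
      by (cases "real j / real n < x") (auto simp: lo_def)
  qed
  have mid: "position_mass c n {..<x} \<le> position_mass c n {..x}" for n
    by (rule position_mass_mono) auto
  have above: "\<forall>\<^sub>F n in sequentially. position_mass c n {..x} < L + e" if "0 < e" for e
  proof -
    have "\<forall>\<^sub>F k in sequentially. (\<integral>s. up k s \<partial>\<mu>) < L + e"
      by (rule order_tendstoD(2)[OF up]) (use that in simp)
    then obtain k where k: "(\<integral>s. up k s \<partial>\<mu>) < L + e" by (auto simp: eventually_sequentially)
    show ?thesis
      using order_tendstoD(2)[OF position_average_tendsto[OF cont(1) bd(1)] k]
      by eventually_elim (use upper le_less_trans in blast)
  qed
  have below: "\<forall>\<^sub>F n in sequentially. L - e < position_mass c n {..<x}" if "0 < e" for e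
  proof -
    have "\<forall>\<^sub>F k in sequentially. L - e < (\<integral>s. lo k s \<partial>\<mu>)"
      by (rule order_tendstoD(1)[OF lo]) (use that in simp)
    then obtain k where k: "L - e < (\<integral>s. lo k s \<partial>\<mu>)" by (auto simp: eventually_sequentially)
    show ?thesis
      using order_tendstoD(1)[OF position_average_tendsto[OF cont(2) bd(2)] k]
      by eventually_elim (use lower less_le_trans in blast)
  qed
  show "(\<lambda>n. position_mass c n {..x}) \<longlonglongrightarrow> measure \<mu> ({0..1} \<inter> {..x})"
  proof (rule tendstoI)
    fix e :: real assume "0 < e"
    show "\<forall>\<^sub>F n in sequentially. dist (position_mass c n {..x}) (measure \<mu> ({0..1} \<inter> {..x})) < e"
      using above[OF \<open>0 < e\<close>] below[OF \<open>0 < e\<close>]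
    proof eventually_elim
      case (elim n)
      then show ?case using mid[of n] unfolding L_def[symmetric] dist_real_def by linarith
    qed
  qed
  show "(\<lambda>n. position_mass c n {..<x}) \<longlonglongrightarrow> measure \<mu> ({0..1} \<inter> {..x})"
  proof (rule tendstoI)
    fix e :: real assume "0 < e"
    show "\<forall>\<^sub>F n in sequentially. dist (position_mass c n {..<x}) (measure \<mu> ({0..1} \<inter> {..x})) < e"
      using above[OF \<open>0 < e\<close>] below[OF \<open>0 < e\<close>]
    proof eventually_elim
      case (elim n)
      then show ?case using mid[of n] unfolding L_def[symmetric] dist_real_def by linarith
    qed
  qed
qed

end

lemma position_mass_Un:
  "I \<inter> I' = {} \<Longrightarrow> position_mass c n (I \<union> I') = position_mass c n I + position_mass c n I'"
  unfolding position_mass_def sum.distrib[symmetric] by (intro sum.cong) (auto simp: indicator_def)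

text \<open>The distribution function of an atomless measure is uniformly continuous on compact intervals.\<close>

lemma atomless_increments_small:
  assumes "finite_measure \<nu>" "sets \<nu> = sets (borel :: real measure)" "\<And>x. measure \<nu> {x} = 0" "0 < \<eta>"
  shows "\<exists>r>0. \<forall>x\<in>{a..b}. \<forall>y\<in>{a..b}. x < y \<and> y \<le> x + r \<longrightarrow> measure \<nu> {x<..y} \<le> \<eta>"
proof -
  interpret finite_borel_measure \<nu>
    using assms by (simp add: finite_borel_measure_def finite_borel_measure_axioms_def)
  have "continuous_on {a..b} (cdf \<nu>)"
    using assms(3) isCont_cdf by (intro continuous_at_imp_continuous_on) auto
  then have "uniformly_continuous_on {a..b} (cdf \<nu>)" by (intro compact_uniformly_continuous) auto
  then obtain d where d: "0 < d" "\<And>x y. x \<in> {a..b} \<Longrightarrow> y \<in> {a..b} \<Longrightarrow> dist y x < d \<Longrightarrow> dist (cdf \<nu> y) (cdf \<nu> x) < \<eta>"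
    using assms(4) unfolding uniformly_continuous_on_def by metis
  show ?thesis
  proof (intro exI[of _ "d / 2"] conjI ballI impI)
    fix x y assume x: "x \<in> {a..b}" and y: "y \<in> {a..b}" and xy: "x < y \<and> y \<le> x + d / 2"
    have "dist (cdf \<nu> y) (cdf \<nu> x) < \<eta>" using d xy by (intro d(2)[OF x y]) (auto simp: dist_real_def)
    then show "measure \<nu> {x<..y} \<le> \<eta>" using cdf_diff_eq[of x y] xy by (simp add: dist_real_def)
  qed (use d in simp)
qed

section \<open>Avoidance probabilities\<close>

locale triangular_array =
  fixes M :: "nat \<Rightarrow> 'a measure" and X :: "nat \<Rightarrow> nat \<Rightarrow> 'a \<Rightarrow> real"
    and c :: "nat \<Rightarrow> nat \<Rightarrow> real"
    and \<mu> :: "real measure" and \<gamma> :: "ennreal measure"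
    and N :: "'b measure" and \<zeta> :: "'b \<Rightarrow> (real \<times> ennreal) set"
  assumes prob_M: "\<And>n. prob_space (M n)"
    and indep: "\<And>n. prob_space.indep_vars (M n) (\<lambda>_. borel) (X n) {1..n}"
    and X_nonneg: "\<And>n j \<omega>. j \<in> {1..n} \<Longrightarrow> \<omega> \<in> space (M n) \<Longrightarrow> 0 \<le> X n j \<omega>"
    and c_pos: "\<And>n j. j \<in> {1..n} \<Longrightarrow> 0 < c n j"
    and c_max: "(\<lambda>n. (MAX j\<in>{1..n}. c n j) / row_sum c n) \<longlonglongrightarrow> 0"
    and sets_\<mu>: "sets \<mu> = sets (restrict_space borel {0..1})" and finite_\<mu>: "finite_measure \<mu>"
    and weak_\<mu>: "weak_conv_top (top_of_set {0..1}) (position_measure c) \<mu>"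
    and sets_\<gamma>: "sets \<gamma> = sets Rplus_borel"
    and finite_\<gamma>: "\<And>t::real. 0 < t \<Longrightarrow> emeasure \<gamma> {ennreal t..} < \<infinity>"
    and nonatomic_\<gamma>: "nonatomic \<gamma>"
    and Delta: "\<And>t::real. 0 < t \<Longrightarrow> (\<lambda>n. Delta M X c \<gamma> n t) \<longlonglongrightarrow> 0"
    and prob_N: "prob_space N" and poisson: "poisson_process N (\<mu> \<Otimes>\<^sub>M \<gamma>) \<zeta>"
begin

abbreviation \<Lambda> :: "(real \<times> ennreal) measure" where
  "\<Lambda> \<equiv> \<mu> \<Otimes>\<^sub>M \<gamma>"

definition \<xi> :: "nat \<Rightarrow> 'a \<Rightarrow> config" where
  "\<xi> n \<omega> = row_config n (\<lambda>j. X n j \<omega>)"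

definition hit :: "nat \<Rightarrow> nat \<Rightarrow> (real \<times> ennreal) set \<Rightarrow> 'a set" where
  "hit n j B = {\<omega> \<in> space (M n). (real j / real n, ennreal (X n j \<omega>)) \<in> B}"

definition mean :: "nat \<Rightarrow> (real \<times> ennreal) set \<Rightarrow> real" where
  "mean n B = (\<Sum>j=1..n. measure (M n) (hit n j B))"

lemma sets_\<Lambda>: "sets \<Lambda> = sets config_space"
  using sets_\<mu> sets_\<gamma> by (rule sets_pair_measure_cong)

lemma space_config_space: "space config_space = {0..1} \<times> Rplus"
  by (simp add: space_pair_measure space_restrict_space)

lemma X_measurable:
  assumes "j \<in> {1..n}"
  shows "X n j \<in> borel_measurable (M n)"
proof -
  have "\<forall>i\<in>{1..n}. X n i \<in> borel_measurable (M n)"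
    using indep[of n] unfolding prob_space.indep_vars_def2[OF prob_M] by (rule conjunct1)
  then show ?thesis using assms by (rule bspec)
qed

text \<open>Points of height 0 are not in the state space, so the slice is first shown to be measurable within
  the positive reals.\<close>

lemma slice_sets:
  assumes "B \<in> sets config_space" "j \<in> {1..n}"
  shows "{x. (real j / real n, ennreal x) \<in> B} \<in> sets (borel :: real measure)"
proof -
  have "(\<lambda>x::real. (real j / real n, ennreal x)) \<in> restrict_space borel {0<..} \<rightarrow>\<^sub>M config_space"
  proof (rule measurable_Pair)
    show "(\<lambda>x::real. real j / real n) \<in> restrict_space borel {0<..} \<rightarrow>\<^sub>M restrict_space borel {0..1}"
      using assms(2) by (intro measurable_const) (auto simp: space_restrict_space)
    show "(\<lambda>x::real. ennreal x) \<in> restrict_space borel {0<..} \<rightarrow>\<^sub>M Rplus_borel"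
      by (intro measurable_restrict_space3) (auto simp: Rplus_def)
  qed
  from measurable_sets[OF this assms(1)]
  have "(\<lambda>x::real. (real j / real n, ennreal x)) -` B \<inter> {0<..} \<in> sets borel"
    by (simp add: space_restrict_space sets_restrict_space_iff)
  moreover have "{x. (real j / real n, ennreal x) \<in> B} = (\<lambda>x::real. (real j / real n, ennreal x)) -` B \<inter> {0<..}"
  proof (intro set_eqI iffI)
    fix x :: real assume "x \<in> {x. (real j / real n, ennreal x) \<in> B}"
    moreover from this have "ennreal x \<in> Rplus"
      using sets.sets_into_space[OF assms(1)] by (auto simp: space_config_space)
    ultimately show "x \<in> (\<lambda>x::real. (real j / real n, ennreal x)) -` B \<inter> {0<..}" by (simp add: Rplus_def)
  qed auto
  ultimately show ?thesis by simp
qed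

lemma hit_eq: "hit n j B = X n j -` {x. (real j / real n, ennreal x) \<in> B} \<inter> space (M n)"
  by (auto simp: hit_def)

lemma hit_sets: "B \<in> sets config_space \<Longrightarrow> j \<in> {1..n} \<Longrightarrow> hit n j B \<in> sets (M n)"
  unfolding hit_eq by (intro measurable_sets[OF X_measurable] slice_sets) auto

lemma \<xi>_configs: "\<xi> n \<omega> \<in> configs"
  by (simp add: \<xi>_def row_config_in_configs)

lemma mem_\<xi>_iff:
  assumes "B \<in> sets config_space" "\<omega> \<in> space (M n)" "p \<in> B"
  shows "p \<in> \<xi> n \<omega> \<longleftrightarrow> (\<exists>j\<in>{1..n}. \<omega> \<in> hit n j B \<and> p = (real j / real n, ennreal (X n j \<omega>)))"
  using sets.sets_into_space[OF assms(1)] assms(2,3)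
  unfolding space_config_space by (auto simp: \<xi>_def row_config_def hit_def)

lemma \<xi>_hits_iff:
  assumes "B \<in> sets config_space" "\<omega> \<in> space (M n)"
  shows "\<xi> n \<omega> \<inter> B \<noteq> {} \<longleftrightarrow> (\<exists>j\<in>{1..n}. \<omega> \<in> hit n j B)"
  using sets.sets_into_space[OF assms(1)] assms(2)
  unfolding space_config_space by (fastforce simp: \<xi>_def row_config_def hit_def)

lemma \<xi>_hits_eq:
  "B \<in> sets config_space \<Longrightarrow> {\<omega> \<in> space (M n). \<xi> n \<omega> \<inter> B \<noteq> {}} = (\<Union>j\<in>{1..n}. hit n j B)"
  using \<xi>_hits_iff[of B _ n] by (auto simp: hit_def)

lemma \<xi>_hits_sets: "B \<in> sets config_space \<Longrightarrow> {\<omega> \<in> space (M n). \<xi> n \<omega> \<inter> B \<noteq> {}} \<in> sets (M n)"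
  unfolding \<xi>_hits_eq by (intro sets.finite_UN hit_sets) auto

lemma \<xi>_hits_prob_le:
  assumes "B \<in> sets config_space"
  shows "measure (M n) {\<omega> \<in> space (M n). \<xi> n \<omega> \<inter> B \<noteq> {}} \<le> mean n B"
proof -
  interpret prob_space "M n" by (rule prob_M)
  show ?thesis unfolding \<xi>_hits_eq[OF assms] mean_def
    by (intro finite_measure_subadditive_finite) (use assms hit_sets in auto)
qed

lemma \<xi>_avoids_prob:
  assumes B: "B \<in> sets config_space"
  shows "measure (M n) {\<omega> \<in> space (M n). \<xi> n \<omega> \<inter> B = {}} = (\<Prod>j\<in>{1..n}. 1 - measure (M n) (hit n j B))"
proof -
  interpret prob_space "M n" by (rule prob_M)
  define A where "A j = - {x. (real j / real n, ennreal x) \<in> B}" for j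
  have A: "X n j -` A j \<inter> space (M n) = space (M n) - hit n j B" for j
    by (auto simp: A_def hit_def)
  have avoid: "{\<omega> \<in> space (M n). \<xi> n \<omega> \<inter> B = {}} = space (M n) - (\<Union>j\<in>{1..n}. hit n j B)"
    unfolding \<xi>_hits_eq[OF B, symmetric] by auto
  show ?thesis
  proof (cases "n = 0")
    case True
    then show ?thesis unfolding avoid by (simp add: prob_space.prob_space[OF prob_M])
  next
    case False
    then have "{\<omega> \<in> space (M n). \<xi> n \<omega> \<inter> B = {}} = (\<Inter>j\<in>{1..n}. X n j -` A j \<inter> space (M n))"
      unfolding avoid A by auto
    also have "prob \<dots> = (\<Prod>j\<in>{1..n}. prob (X n j -` A j \<inter> space (M n)))"
      using False B slice_sets by (intro indep_varsD[OF indep]) (auto simp: A_def borel_comp)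
    also have "\<dots> = (\<Prod>j\<in>{1..n}. 1 - prob (hit n j B))"
      unfolding A using hit_sets[OF B] by (intro prod.cong refl prob_compl) auto
    finally show ?thesis .
  qed
qed

text \<open>Two different indices hit \<open>B\<close> independently, so a union bound over pairs gives the square of
  the mean number of points.\<close>

lemma \<xi>_multiple:
  assumes B: "B \<in> sets config_space"
  shows "{\<omega> \<in> space (M n). \<not> simple_on (\<xi> n \<omega>) B} \<in> sets (M n)"
    and "measure (M n) {\<omega> \<in> space (M n). \<not> simple_on (\<xi> n \<omega>) B} \<le> (mean n B)\<^sup>2"
proof -
  interpret prob_space "M n" by (rule prob_M)
  define D where "D = {(i, j). i \<in> {1..n} \<and> j \<in> {1..n} \<and> i \<noteq> j}"
  have "finite D" by (rule finite_subset[of _ "{1..n} \<times> {1..n}"]) (auto simp: D_def)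
  have eq: "{\<omega> \<in> space (M n). \<not> simple_on (\<xi> n \<omega>) B} = (\<Union>(i, j)\<in>D. hit n i B \<inter> hit n j B)"
  proof (intro set_eqI iffI)
    fix \<omega> assume "\<omega> \<in> {\<omega> \<in> space (M n). \<not> simple_on (\<xi> n \<omega>) B}"
    then obtain p q where \<omega>: "\<omega> \<in> space (M n)" and pq: "p \<in> \<xi> n \<omega>" "p \<in> B" "q \<in> \<xi> n \<omega>" "q \<in> B" "p \<noteq> q"
      by (auto simp: simple_on_def)
    obtain i where "i \<in> {1..n}" "\<omega> \<in> hit n i B" "p = (real i / real n, ennreal (X n i \<omega>))"
      using mem_\<xi>_iff[OF B \<omega> pq(2)] pq(1) by blast
    moreover obtain j where "j \<in> {1..n}" "\<omega> \<in> hit n j B" "q = (real j / real n, ennreal (X n j \<omega>))"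
      using mem_\<xi>_iff[OF B \<omega> pq(4)] pq(3) by blast
    ultimately show "\<omega> \<in> (\<Union>(i, j)\<in>D. hit n i B \<inter> hit n j B)" using pq(5) by (auto simp: D_def)
  next
    fix \<omega> assume "\<omega> \<in> (\<Union>(i, j)\<in>D. hit n i B \<inter> hit n j B)"
    then obtain i j where ij: "i \<in> {1..n}" "j \<in> {1..n}" "i \<noteq> j" "\<omega> \<in> hit n i B" "\<omega> \<in> hit n j B"
      by (auto simp: D_def)
    let ?p = "\<lambda>i. (real i / real n, ennreal (X n i \<omega>))"
    have \<omega>: "\<omega> \<in> space (M n)" "?p i \<in> B" "?p j \<in> B" using ij by (auto simp: hit_def)
    have "?p i \<in> \<xi> n \<omega>" "?p j \<in> \<xi> n \<omega>"
      using mem_\<xi>_iff[OF B \<omega>(1,2)] mem_\<xi>_iff[OF B \<omega>(1,3)] ij by blast+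
    moreover have "?p i \<noteq> ?p j" using ij(1,2,3) by simp
    ultimately have "\<not> simple_on (\<xi> n \<omega>) B"
      using simple_onD[of "\<xi> n \<omega>" B "?p i" "?p j"] \<omega> by blast
    then show "\<omega> \<in> {\<omega> \<in> space (M n). \<not> simple_on (\<xi> n \<omega>) B}" using \<omega>(1) by simp
  qed
  have meas: "hit n i B \<inter> hit n j B \<in> sets (M n)" if "(i, j) \<in> D" for i j
    using that B by (intro sets.Int hit_sets) (auto simp: D_def)
  show "{\<omega> \<in> space (M n). \<not> simple_on (\<xi> n \<omega>) B} \<in> sets (M n)"
    unfolding eq using meas \<open>finite D\<close> by (intro sets.finite_UN) auto
  have pair: "prob (hit n i B \<inter> hit n j B) = prob (hit n i B) * prob (hit n j B)" if "(i, j) \<in> D" for i j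
  proof -
    have D: "i \<in> {1..n}" "j \<in> {1..n}" "i \<noteq> j" using that by (auto simp: D_def)
    have "prob (\<Inter>k\<in>{i, j}. X n k -` {x. (real k / real n, ennreal x) \<in> B} \<inter> space (M n)) =
        (\<Prod>k\<in>{i, j}. prob (X n k -` {x. (real k / real n, ennreal x) \<in> B} \<inter> space (M n)))"
      using D by (intro indep_varsD[OF indep] slice_sets B) auto
    then show ?thesis using D(3) by (simp add: hit_eq)
  qed
  have "prob {\<omega> \<in> space (M n). \<not> simple_on (\<xi> n \<omega>) B} \<le> (\<Sum>(i, j)\<in>D. prob (hit n i B \<inter> hit n j B))"
    unfolding eq using meas \<open>finite D\<close>
    by (intro order_trans[OF finite_measure_subadditive_finite]) (auto simp: case_prod_beta)
  also have "\<dots> = (\<Sum>(i, j)\<in>D. prob (hit n i B) * prob (hit n j B))"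
    by (intro sum.cong refl) (auto simp: pair)
  also have "\<dots> \<le> (\<Sum>(i, j)\<in>{1..n} \<times> {1..n}. prob (hit n i B) * prob (hit n j B))"
    by (intro sum_mono2) (auto simp: D_def)
  also have "\<dots> = (mean n B)\<^sup>2"
    by (simp add: mean_def power2_eq_square sum_product sum.cartesian_product)
  finally show "prob {\<omega> \<in> space (M n). \<not> simple_on (\<xi> n \<omega>) B} \<le> (mean n B)\<^sup>2" .
qed

subsection \<open>The limit process\<close>

lemma \<zeta>_configs: "\<omega> \<in> space N \<Longrightarrow> \<zeta> \<omega> \<in> configs"
  using poisson by (simp add: poisson_process_def)

lemma npoints_measurable: "B \<in> sets config_space \<Longrightarrow> (\<lambda>\<omega>. npoints (\<zeta> \<omega>) B) \<in> borel_measurable N"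
  using poisson by (simp add: poisson_process_def sets_\<Lambda>)

lemma npoints_prob:
  "B \<in> sets config_space \<Longrightarrow> emeasure \<Lambda> B < \<infinity> \<Longrightarrow>
    measure N {\<omega>\<in>space N. npoints (\<zeta> \<omega>) B = of_nat k} = measure \<Lambda> B ^ k / fact k * exp (- measure \<Lambda> B)"
  using poisson by (simp add: poisson_process_def sets_\<Lambda>)

lemma \<zeta>_hits_sets:
  assumes "B \<in> sets config_space"
  shows "{\<omega> \<in> space N. \<zeta> \<omega> \<inter> B \<noteq> {}} \<in> sets N"
proof -
  have "{\<omega> \<in> space N. npoints (\<zeta> \<omega>) B \<noteq> 0} \<in> sets N"
    using npoints_measurable[OF assms] by measurable
  then show ?thesis by (simp add: npoints_eq_0_iff)
qed

lemma \<zeta>_avoids_prob: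
  assumes "B \<in> sets config_space" "emeasure \<Lambda> B < \<infinity>"
  shows "measure N {\<omega> \<in> space N. \<zeta> \<omega> \<inter> B = {}} = exp (- measure \<Lambda> B)"
  using npoints_prob[OF assms, of 0] by (simp add: npoints_eq_0_iff)

lemma \<zeta>_hits_prob_le:
  assumes "B \<in> sets config_space" "emeasure \<Lambda> B < \<infinity>"
  shows "measure N {\<omega> \<in> space N. \<zeta> \<omega> \<inter> B \<noteq> {}} \<le> measure \<Lambda> B"
proof -
  interpret prob_space N by (rule prob_N)
  have avoid: "{\<omega> \<in> space N. \<zeta> \<omega> \<inter> B = {}} = space N - {\<omega> \<in> space N. \<zeta> \<omega> \<inter> B \<noteq> {}}" by auto
  have "exp (- measure \<Lambda> B) = 1 - prob {\<omega> \<in> space N. \<zeta> \<omega> \<inter> B \<noteq> {}}"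
    unfolding \<zeta>_avoids_prob[OF assms, symmetric] avoid by (intro prob_compl \<zeta>_hits_sets assms)
  then show ?thesis using exp_ge_add_one_self[of "- measure \<Lambda> B"] by linarith
qed

lemma simple_on_iff_npoints: "simple_on \<kappa> B \<longleftrightarrow> npoints \<kappa> B = 0 \<or> npoints \<kappa> B = 1"
proof -
  have "(\<forall>p\<in>A. \<forall>q\<in>A. p = q) \<longleftrightarrow> A = {} \<or> (\<exists>p. A = {p})" for A :: "'p set"
  proof
    assume same: "\<forall>p\<in>A. \<forall>q\<in>A. p = q"
    have "A = {p}" if "p \<in> A" for p using same that by auto
    then show "A = {} \<or> (\<exists>p. A = {p})" by auto
  qed auto
  then show ?thesis unfolding npoints_eq_0_iff npoints_eq_1_iff simple_on_def .
qed

text \<open>A Poisson variable with mean \<open>s\<close> exceeds 1 with probability \<open>1 - (1 + s) exp (- s)\<close>, and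
  \<open>exp (- s) \<ge> 1 - s\<close> bounds this by the square of \<open>s\<close>.\<close>

lemma \<zeta>_multiple:
  assumes "B \<in> sets config_space" "emeasure \<Lambda> B < \<infinity>"
  shows "{\<omega> \<in> space N. \<not> simple_on (\<zeta> \<omega>) B} \<in> sets N"
    and "measure N {\<omega> \<in> space N. \<not> simple_on (\<zeta> \<omega>) B} \<le> (measure \<Lambda> B)\<^sup>2"
proof -
  interpret prob_space N by (rule prob_N)
  note [measurable] = npoints_measurable[OF assms(1)]
  show meas: "{\<omega> \<in> space N. \<not> simple_on (\<zeta> \<omega>) B} \<in> sets N"
    unfolding simple_on_iff_npoints by measurable
  define s where "s = measure \<Lambda> B"
  define E where "E k = {\<omega> \<in> space N. npoints (\<zeta> \<omega>) B = of_nat k}" for k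
  have E: "E k \<in> sets N" for k unfolding E_def by measurable
  have "{\<omega> \<in> space N. \<not> simple_on (\<zeta> \<omega>) B} = space N - (E 0 \<union> E 1)"
    by (auto simp: simple_on_iff_npoints E_def)
  then have "prob {\<omega> \<in> space N. \<not> simple_on (\<zeta> \<omega>) B} = 1 - prob (E 0 \<union> E 1)"
    using E by (simp add: prob_compl)
  also have "prob (E 0 \<union> E 1) = prob (E 0) + prob (E 1)"
    using E by (intro finite_measure_Union) (auto simp: E_def)
  also have "prob (E 0) = exp (- s)" unfolding E_def s_def npoints_prob[OF assms] by simp
  also have "prob (E 1) = s * exp (- s)" unfolding E_def s_def npoints_prob[OF assms] by simp
  also have "1 - (exp (- s) + s * exp (- s)) \<le> s\<^sup>2"
  proof -
    have "0 \<le> s" by (simp add: s_def)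
    have "(1 - s) * (1 + s) \<le> exp (- s) * (1 + s)"
      using exp_ge_add_one_self[of "- s"] \<open>0 \<le> s\<close> by (intro mult_right_mono) auto
    then show ?thesis by (simp add: algebra_simps power2_eq_square)
  qed
  finally show "prob {\<omega> \<in> space N. \<not> simple_on (\<zeta> \<omega>) B} \<le> (measure \<Lambda> B)\<^sup>2" by (simp add: s_def)
qed

subsection \<open>Sets on which the intensities converge\<close>

lemma tail_in_sets_\<gamma>: "{ennreal h<..} \<in> sets \<gamma>" "{ennreal h<..ennreal h'} \<in> sets \<gamma>"
  "0 < h \<Longrightarrow> {ennreal h..} \<in> sets \<gamma>"
proof -
  have R: "Rplus \<inter> space borel \<in> sets borel" by (simp add: Rplus_def)
  show "{ennreal h<..} \<in> sets \<gamma>" "{ennreal h<..ennreal h'} \<in> sets \<gamma>"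
    unfolding sets_\<gamma> sets_restrict_space_iff[OF R] using ennreal_tail_Rplus(2)[of "ennreal h"] by auto
  show "0 < h \<Longrightarrow> {ennreal h..} \<in> sets \<gamma>"
    unfolding sets_\<gamma> sets_restrict_space_iff[OF R] using ennreal_tail_Rplus(1)[of h] by auto
qed

lemma finite_tail_\<gamma>: "0 < h \<Longrightarrow> emeasure \<gamma> {ennreal h<..} < \<infinity>"
  by (rule le_less_trans[OF emeasure_mono finite_\<gamma>]) (auto intro: tail_in_sets_\<gamma>(3))

lemma sigma_finite_\<gamma>: "sigma_finite_measure \<gamma>"
proof
  have sp: "space \<gamma> = Rplus" using sets_eq_imp_space_eq[OF sets_\<gamma>] by (simp add: space_restrict_space)
  show "\<exists>A. countable A \<and> A \<subseteq> sets \<gamma> \<and> \<Union> A = space \<gamma> \<and> (\<forall>a\<in>A. emeasure \<gamma> a \<noteq> \<infinity>)"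
  proof (intro exI conjI ballI)
    let ?A = "range (\<lambda>n. {ennreal (1 / Suc n)..})"
    show "countable ?A" by simp
    show "?A \<subseteq> sets \<gamma>" using tail_in_sets_\<gamma>(3) by auto
    show "\<Union> ?A = space \<gamma>" unfolding sp
    proof (intro subset_antisym subsetI)
      fix x assume "x \<in> Rplus"
      then have "0 < x" by (simp add: Rplus_def)
      then obtain y where y: "0 < y" "y < x" using dense by blast
      then obtain r where r: "y = ennreal r" "0 < r" by (cases y) auto
      obtain n :: nat where "1 / r < real n" using reals_Archimedean2 by blast
      then have "1 / Suc n \<le> r" using r(2) by (simp add: field_simps)
      then have "ennreal (1 / Suc n) \<le> x" using y(2) r(1) by (metis ennreal_leI less_imp_le order_trans)
      then show "x \<in> \<Union> ?A" by blast
    next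
      fix x assume "x \<in> \<Union> ?A"
      then obtain n where "ennreal (1 / Suc n) \<le> x" by auto
      then show "x \<in> Rplus" using ennreal_tail_Rplus(1)[of "1 / Suc n"] by auto
    qed
    show "emeasure \<gamma> a \<noteq> \<infinity>" if "a \<in> ?A" for a using that finite_\<gamma> by (auto simp: less_top)
  qed
qed

lemma measure_\<Lambda>_Times:
  "I \<in> sets \<mu> \<Longrightarrow> H \<in> sets \<gamma> \<Longrightarrow> measure \<Lambda> (I \<times> H) = measure \<mu> I * measure \<gamma> H"
  unfolding measure_def
  by (simp add: sigma_finite_measure.emeasure_pair_measure_Times[OF sigma_finite_\<gamma>] enn2real_mult)

text \<open>Regular sets are those bounded away from height 0 on which the mean number of points of row \<open>n\<close>
  converges to the intensity of the Poisson process.\<close>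

definition regular :: "(real \<times> ennreal) set \<Rightarrow> bool" where
  "regular B \<longleftrightarrow> B \<in> sets config_space \<and> (\<exists>t>0. B \<subseteq> {0..1} \<times> {ennreal t<..}) \<and>
    (\<lambda>n. mean n B) \<longlonglongrightarrow> measure \<Lambda> B"

lemma regularD:
  assumes "regular B"
  shows "B \<in> sets config_space" "emeasure \<Lambda> B < \<infinity>" "(\<lambda>n. mean n B) \<longlonglongrightarrow> measure \<Lambda> B"
proof -
  show B: "B \<in> sets config_space" and "(\<lambda>n. mean n B) \<longlonglongrightarrow> measure \<Lambda> B" using assms by (auto simp: regular_def)
  obtain t where t: "0 < t" "B \<subseteq> {0..1} \<times> {ennreal t<..}" using assms by (auto simp: regular_def)
  have I: "{0..1} \<in> sets \<mu>" unfolding sets_\<mu> by (auto simp: sets_restrict_space)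
  have "emeasure \<Lambda> B \<le> emeasure \<Lambda> ({0..1} \<times> {ennreal t<..})"
    using t(2) I tail_in_sets_\<gamma>(1) by (intro emeasure_mono pair_measureI) auto
  also have "\<dots> = emeasure \<mu> {0..1} * emeasure \<gamma> {ennreal t<..}"
    by (intro sigma_finite_measure.emeasure_pair_measure_Times[OF sigma_finite_\<gamma>] I tail_in_sets_\<gamma>)
  also have "\<dots> < \<infinity>"
    using finite_tail_\<gamma>[OF t(1)] finite_measure.emeasure_finite[OF finite_\<mu>]
    by (auto simp: ennreal_mult_less_top less_top)
  finally show "emeasure \<Lambda> B < \<infinity>" .
qed

lemma tail_prob:
  assumes t: "0 < t"
  shows "\<forall>\<^sub>F n in sequentially. \<forall>j\<in>{1..n}. \<forall>h\<ge>t.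
    measure (M n) {\<omega> \<in> space (M n). ennreal h < ennreal (X n j \<omega>)} = c n j / row_sum c n * measure \<gamma> {ennreal h<..}"
  using Delta_tendsto_0_imp_eq[OF Delta[OF t]]
proof eventually_elim
  case (elim n)
  show ?case
  proof (intro ballI allI impI)
    fix j h assume j: "j \<in> {1..n}" and h: "t \<le> h"
    have "row_sum c n / c n j * measure (M n) {\<omega> \<in> space (M n). ennreal h < ennreal (X n j \<omega>)} = measure \<gamma> {ennreal h<..}"
      using elim j by (intro scaled_law_eq[OF prob_M X_measurable[OF j] sets_\<gamma> finite_\<gamma>[OF t] _ t h]) auto
    then show "measure (M n) {\<omega> \<in> space (M n). ennreal h < ennreal (X n j \<omega>)} = c n j / row_sum c n * measure \<gamma> {ennreal h<..}"
      using c_pos[OF j] row_sum_pos[of n c, OF c_pos] j by (auto simp: field_simps)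
  qed
qed

text \<open>Row \<open>n\<close> avoids \<open>B\<close> with probability \<open>\<Prod>j. 1 - p n j\<close>, where \<open>p n j\<close> is the probability that index \<open>j\<close>
  hits \<open>B\<close>. The \<open>p n j\<close> add up to \<open>mean n B\<close> and are uniformly small, because they are at most
  \<open>c n j / row_sum c n\<close> times the mass of \<open>\<gamma>\<close> above the lower end of \<open>B\<close>. So the product converges to
  \<open>exp (- measure \<Lambda> B)\<close>, the avoidance probability of the Poisson process.\<close>

lemma regular_avoids_limit:
  assumes B: "regular B"
  shows "(\<lambda>n. measure (M n) {\<omega> \<in> space (M n). \<xi> n \<omega> \<inter> B = {}}) \<longlonglongrightarrow> measure N {\<omega> \<in> space N. \<zeta> \<omega> \<inter> B = {}}"
proof -
  note B' = regularD[OF B]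
  obtain t where t: "0 < t" "B \<subseteq> {0..1} \<times> {ennreal t<..}" using B by (auto simp: regular_def)
  define b where "b n = (MAX j\<in>{1..n}. c n j) / row_sum c n * measure \<gamma> {ennreal t<..}" for n
  have "(\<lambda>n. \<Prod>j\<in>{1..n}. 1 - measure (M n) (hit n j B)) \<longlonglongrightarrow> exp (- measure \<Lambda> B)"
  proof (rule prod_one_minus_tendsto_exp[where b=b])
    show "b \<longlonglongrightarrow> 0" unfolding b_def using tendsto_mult_right[OF c_max] by simp
    show "(\<lambda>n. \<Sum>j\<in>{1..n}. measure (M n) (hit n j B)) \<longlonglongrightarrow> measure \<Lambda> B"
      using B'(3) by (simp add: mean_def)
    show "\<forall>\<^sub>F n in sequentially. \<forall>j\<in>{1..n}. 0 \<le> measure (M n) (hit n j B) \<and> measure (M n) (hit n j B) \<le> b n"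
      using tail_prob[OF t(1)]
    proof eventually_elim
      case (elim n)
      interpret prob_space "M n" by (rule prob_M)
      show ?case
      proof (intro ballI conjI)
        fix j assume j: "j \<in> {1..n}"
        have "{\<omega> \<in> space (M n). ennreal t < ennreal (X n j \<omega>)} \<in> sets (M n)"
          using X_measurable[OF j] by measurable
        then have "prob (hit n j B) \<le> prob {\<omega> \<in> space (M n). ennreal t < ennreal (X n j \<omega>)}"
          using t(2) by (intro finite_measure_mono) (auto simp: hit_def)
        also have "\<dots> = c n j / row_sum c n * measure \<gamma> {ennreal t<..}" using elim j by simp
        also have "\<dots> \<le> b n"
          unfolding b_def using j row_sum_pos[of n c, OF c_pos]
          by (intro mult_right_mono divide_right_mono Max_ge) auto
        finally show "prob (hit n j B) \<le> b n" .
      qed simp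
    qed
  qed simp
  then show ?thesis unfolding \<xi>_avoids_prob[OF B'(1)] \<zeta>_avoids_prob[OF B'(1,2)] .
qed

lemma mean_Un:
  assumes "A \<in> sets config_space" "B \<in> sets config_space" "A \<inter> B = {}"
  shows "mean n (A \<union> B) = mean n A + mean n B"
proof -
  interpret prob_space "M n" by (rule prob_M)
  have "hit n j (A \<union> B) = hit n j A \<union> hit n j B" "hit n j A \<inter> hit n j B = {}" for j
    using assms(3) by (auto simp: hit_def)
  then show ?thesis
    unfolding mean_def sum.distrib[symmetric]
    using hit_sets assms by (intro sum.cong refl) (simp add: finite_measure_Union)
qed

lemma regular_Un:
  assumes A: "regular A" and B: "regular B" and "A \<inter> B = {}"
  shows "regular (A \<union> B)" "measure \<Lambda> (A \<union> B) = measure \<Lambda> A + measure \<Lambda> B"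
proof -
  note A' = regularD[OF A] and B' = regularD[OF B]
  show eq: "measure \<Lambda> (A \<union> B) = measure \<Lambda> A + measure \<Lambda> B"
    using A' B' assms(3) by (intro measure_Union) (auto simp: sets_\<Lambda>)
  obtain s where s: "0 < s" "A \<subseteq> {0..1} \<times> {ennreal s<..}" using A by (auto simp: regular_def)
  obtain t where t: "0 < t" "B \<subseteq> {0..1} \<times> {ennreal t<..}" using B by (auto simp: regular_def)
  have "ennreal (min s t) \<le> ennreal s" "ennreal (min s t) \<le> ennreal t" by (auto intro: ennreal_leI)
  then have "A \<union> B \<subseteq> {0..1} \<times> {ennreal (min s t)<..}" using s(2) t(2) by fastforce
  moreover have "0 < min s t" using s t by simp
  moreover have "(\<lambda>n. mean n (A \<union> B)) \<longlonglongrightarrow> measure \<Lambda> (A \<union> B)"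
    unfolding eq mean_Un[OF A'(1) B'(1) assms(3)] by (intro tendsto_add A' B')
  ultimately show "regular (A \<union> B)" unfolding regular_def using A'(1) B'(1) by blast
qed

lemma regular_empty: "regular {}"
  by (auto simp: regular_def mean_def hit_def intro: exI[of _ 1])

lemma regular_UN:
  assumes "finite J" "\<And>q. q \<in> J \<Longrightarrow> regular (C q)" "disjoint_family_on C J"
  shows "regular (\<Union>q\<in>J. C q)"
  using assms
proof (induction J)
  case empty
  then show ?case using regular_empty by simp
next
  case (insert q J)
  have "regular (C q \<union> (\<Union>q\<in>J. C q))"
  proof (rule regular_Un(1))
    show "regular (\<Union>q\<in>J. C q)"
      using insert.IH insert.prems(1) disjoint_family_on_mono[OF subset_insertI insert.prems(2)] by blast
    show "C q \<inter> (\<Union>q\<in>J. C q) = {}"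
      using insert.prems(2) insert.hyps(2) unfolding disjoint_family_on_def by auto
  qed (use insert.prems in auto)
  then show ?case by simp
qed

definition position_continuity :: "real set \<Rightarrow> bool" where
  "position_continuity I \<longleftrightarrow> I \<in> sets borel \<and> I \<subseteq> {0..1} \<and> (\<lambda>n. position_mass c n I) \<longlonglongrightarrow> measure \<mu> I"

text \<open>From some row on the mean number of points in the rectangle is exactly the position mass of \<open>I\<close> times
  \<open>measure \<gamma> H\<close>; only the first factor still depends on the row.\<close>

lemma regular_rectangle:
  assumes I: "position_continuity I" and h: "0 < h" and H: "H = {ennreal h<..} \<or> H = {ennreal h<..ennreal h'} \<and> h \<le> h'"
  shows "regular (I \<times> H)"
  unfolding regular_def
proof (intro conjI)
  have I': "I \<in> sets borel" "I \<subseteq> {0..1}" and lim: "(\<lambda>n. position_mass c n I) \<longlonglongrightarrow> measure \<mu> I"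
    using I by (auto simp: position_continuity_def)
  have H': "H \<in> sets borel" "H \<subseteq> Rplus" "H \<subseteq> {ennreal h<..}" "H \<in> sets \<gamma>"
    using H ennreal_tail_Rplus(2)[of "ennreal h"] tail_in_sets_\<gamma> by auto
  show "I \<times> H \<in> sets config_space" by (intro rectangle_sets I' H')
  show "\<exists>t>0. I \<times> H \<subseteq> {0..1} \<times> {ennreal t<..}" using h I'(2) H'(3) by blast
  have I\<mu>: "I \<in> sets \<mu>" unfolding sets_\<mu> using I' by (auto simp: sets_restrict_space image_iff)
  have "\<forall>\<^sub>F n in sequentially. mean n (I \<times> H) = position_mass c n I * measure \<gamma> H"
    using tail_prob[OF h]
  proof eventually_elim
    case (elim n)
    interpret prob_space "M n" by (rule prob_M)
    have law: "prob {\<omega> \<in> space (M n). ennreal (X n j \<omega>) \<in> H} = c n j / row_sum c n * measure \<gamma> H" if j: "j \<in> {1..n}" for j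
    proof -
      note [measurable] = X_measurable[OF j]
      show ?thesis
      proof (cases "H = {ennreal h<..}")
        case True
        then show ?thesis using elim j by simp
      next
        case False
        then have H: "H = {ennreal h<..ennreal h'}" and hh: "h \<le> h'" using H by auto
        have "prob {\<omega> \<in> space (M n). ennreal (X n j \<omega>) \<in> H} =
          prob ({\<omega> \<in> space (M n). ennreal h < ennreal (X n j \<omega>)} - {\<omega> \<in> space (M n). ennreal h' < ennreal (X n j \<omega>)})"
          unfolding H by (intro arg_cong[where f=prob]) auto
        also have "\<dots> = prob {\<omega> \<in> space (M n). ennreal h < ennreal (X n j \<omega>)} - prob {\<omega> \<in> space (M n). ennreal h' < ennreal (X n j \<omega>)}"
          by (intro finite_measure_Diff Collect_mono) (auto intro: le_less_trans[OF ennreal_leI[OF hh]])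
        also have "\<dots> = c n j / row_sum c n * (measure \<gamma> {ennreal h<..} - measure \<gamma> {ennreal h'<..})"
          using elim j hh by (simp add: right_diff_distrib)
        also have "measure \<gamma> {ennreal h<..} - measure \<gamma> {ennreal h'<..} = measure \<gamma> ({ennreal h<..} - {ennreal h'<..})"
          using finite_tail_\<gamma>[OF h] tail_in_sets_\<gamma>(1) ennreal_leI[OF hh]
          by (intro measure_Diff[symmetric]) (auto intro: le_less_trans[OF ennreal_leI[OF hh]])
        also have "{ennreal h<..} - {ennreal h'<..} = H" unfolding H by auto
        finally show ?thesis .
      qed
    qed
    have "prob (hit n j (I \<times> H)) = c n j / row_sum c n * indicator I (real j / real n) * measure \<gamma> H" if "j \<in> {1..n}" for j
    proof (cases "real j / real n \<in> I")
      case True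
      then have "hit n j (I \<times> H) = {\<omega> \<in> space (M n). ennreal (X n j \<omega>) \<in> H}" by (auto simp: hit_def)
      then show ?thesis using law[OF that] True by simp
    next
      case False
      then have "hit n j (I \<times> H) = {}" by (auto simp: hit_def)
      then show ?thesis using False by simp
    qed
    then show ?case unfolding mean_def position_mass_def sum_distrib_right by (intro sum.cong) auto
  qed
  moreover have "(\<lambda>n. position_mass c n I * measure \<gamma> H) \<longlonglongrightarrow> measure \<Lambda> (I \<times> H)"
    unfolding measure_\<Lambda>_Times[OF I\<mu> H'(4)] by (intro tendsto_mult_right lim)
  ultimately show "(\<lambda>n. mean n (I \<times> H)) \<longlonglongrightarrow> measure \<Lambda> (I \<times> H)"
    by (simp add: tendsto_cong)
qed

end

section \<open>From avoidance probabilities to functionals\<close>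

lemma prob_subset_eq_sum:
  assumes R: "prob_space R" and J: "finite J" and S: "S \<in> R \<rightarrow>\<^sub>M count_space (Pow J)" and s: "s \<subseteq> J"
  shows "measure R {\<omega> \<in> space R. S \<omega> \<subseteq> s} = (\<Sum>s'\<in>Pow s. measure R {\<omega> \<in> space R. S \<omega> = s'})"
proof -
  interpret prob_space R by fact
  have "{\<omega> \<in> space R. S \<omega> = s'} \<in> sets R" if "s' \<in> Pow s" for s'
    using measurable_sets[OF S, of "{s'}"] that s by (auto simp: vimage_def Int_def conj_commute)
  moreover have "finite s" using finite_subset[OF s J] .
  ultimately have "prob (\<Union>s'\<in>Pow s. {\<omega> \<in> space R. S \<omega> = s'}) = (\<Sum>s'\<in>Pow s. prob {\<omega> \<in> space R. S \<omega> = s'})"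
    by (intro finite_measure_finite_Union) (auto simp: disjoint_family_on_def)
  moreover have "{\<omega> \<in> space R. S \<omega> \<subseteq> s} = (\<Union>s'\<in>Pow s. {\<omega> \<in> space R. S \<omega> = s'})" by auto
  ultimately show ?thesis by simp
qed

definition occ :: "'q set \<Rightarrow> ('q \<Rightarrow> 'p set) \<Rightarrow> 'p set \<Rightarrow> 'q set" where
  "occ J C \<kappa> = {q \<in> J. \<kappa> \<inter> C q \<noteq> {}}"

lemma occ_measurable:
  assumes "finite J" and hits: "\<And>q. q \<in> J \<Longrightarrow> {\<omega> \<in> space R. \<eta> \<omega> \<inter> C q \<noteq> {}} \<in> sets R"
  shows "(\<lambda>\<omega>. occ J C (\<eta> \<omega>)) \<in> R \<rightarrow>\<^sub>M count_space (Pow J)"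
proof (subst measurable_count_space_eq2; (intro conjI ballI)?)
  fix s assume "s \<in> Pow J"
  then have "(\<lambda>\<omega>. occ J C (\<eta> \<omega>)) -` {s} \<inter> space R = {\<omega> \<in> space R. \<forall>q\<in>J. (\<eta> \<omega> \<inter> C q \<noteq> {}) = (q \<in> s)}"
    by (auto simp: occ_def)
  also have "\<dots> \<in> sets R"
  proof (intro sets.sets_Collect_finite_All assms(1))
    fix q assume q: "q \<in> J"
    have "{\<omega> \<in> space R. (\<eta> \<omega> \<inter> C q \<noteq> {}) = (q \<in> s)} =
        (if q \<in> s then {\<omega> \<in> space R. \<eta> \<omega> \<inter> C q \<noteq> {}} else space R - {\<omega> \<in> space R. \<eta> \<omega> \<inter> C q \<noteq> {}})"
      by auto
    also have "\<dots> \<in> sets R" using hits[OF q] by auto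
    finally show "{\<omega> \<in> space R. (\<eta> \<omega> \<inter> C q \<noteq> {}) = (q \<in> s)} \<in> sets R" .
  qed
  finally show "(\<lambda>\<omega>. occ J C (\<eta> \<omega>)) -` {s} \<inter> space R \<in> sets R" .
qed (use assms(1) in \<open>auto simp: occ_def\<close>)

text \<open>What a configuration must satisfy for its occupied cells to determine a functional approximately:
  below, \<open>B\<close> is the part of the strip above level \<open>t\<close> outside the cells, the sets \<open>D i\<close> are the rows or the
  columns of the grid, and \<open>As\<close> contains at most the strip itself.\<close>

definition good :: "'p set \<Rightarrow> nat \<Rightarrow> (nat \<Rightarrow> 'p set) \<Rightarrow> 'p set set \<Rightarrow> 'p set \<Rightarrow> bool" where
  "good B m D As \<kappa> \<longleftrightarrow> \<kappa> \<inter> B = {} \<and> (\<forall>i<m. simple_on \<kappa> (D i)) \<and> (\<forall>A\<in>As. \<kappa> \<inter> A \<noteq> {})"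

lemma exceptional_event:
  assumes R: "prob_space R" and As: "finite As"
    and B: "{\<omega> \<in> space R. \<eta> \<omega> \<inter> B \<noteq> {}} \<in> sets R" "measure R {\<omega> \<in> space R. \<eta> \<omega> \<inter> B \<noteq> {}} \<le> b"
    and D: "\<And>i. i < m \<Longrightarrow> {\<omega> \<in> space R. \<not> simple_on (\<eta> \<omega>) (D i)} \<in> sets R"
      "\<And>i. i < m \<Longrightarrow> measure R {\<omega> \<in> space R. \<not> simple_on (\<eta> \<omega>) (D i)} \<le> d i"
    and A: "\<And>A. A \<in> As \<Longrightarrow> {\<omega> \<in> space R. \<eta> \<omega> \<inter> A \<noteq> {}} \<in> sets R"
  shows "\<exists>E\<in>sets R. measure R E \<le> b + (\<Sum>i<m. d i) + (\<Sum>A\<in>As. measure R {\<omega> \<in> space R. \<eta> \<omega> \<inter> A = {}}) \<and>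
    (\<forall>\<omega>\<in>space R - E. good B m D As (\<eta> \<omega>))"
proof -
  interpret prob_space R by fact
  define E1 where "E1 = {\<omega> \<in> space R. \<eta> \<omega> \<inter> B \<noteq> {}}"
  define E2 where "E2 = (\<Union>i\<in>{..<m}. {\<omega> \<in> space R. \<not> simple_on (\<eta> \<omega>) (D i)})"
  define E3 where "E3 = (\<Union>A\<in>As. {\<omega> \<in> space R. \<eta> \<omega> \<inter> A = {}})"
  have avoid: "{\<omega> \<in> space R. \<eta> \<omega> \<inter> A = {}} \<in> sets R" if "A \<in> As" for A
  proof -
    have "{\<omega> \<in> space R. \<eta> \<omega> \<inter> A = {}} = space R - {\<omega> \<in> space R. \<eta> \<omega> \<inter> A \<noteq> {}}" by auto
    then show ?thesis using A[OF that] by (simp add: sets.compl_sets)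
  qed
  have E: "E1 \<in> sets R" "E2 \<in> sets R" "E3 \<in> sets R"
    unfolding E1_def E2_def E3_def using B(1) D(1) avoid As by (auto intro!: sets.finite_UN)
  have "prob E2 \<le> (\<Sum>i<m. prob {\<omega> \<in> space R. \<not> simple_on (\<eta> \<omega>) (D i)})"
    unfolding E2_def using D(1) by (intro finite_measure_subadditive_finite) auto
  also have "\<dots> \<le> (\<Sum>i<m. d i)" using D(2) by (intro sum_mono) auto
  finally have "prob E2 \<le> (\<Sum>i<m. d i)" .
  moreover have "prob E3 \<le> (\<Sum>A\<in>As. prob {\<omega> \<in> space R. \<eta> \<omega> \<inter> A = {}})"
    unfolding E3_def using avoid As by (intro finite_measure_subadditive_finite) auto
  moreover have "prob (E1 \<union> E2 \<union> E3) \<le> prob E1 + prob E2 + prob E3"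
    using measure_Un_le[of "E1 \<union> E2" R E3] measure_Un_le[of E1 R E2] E by auto
  ultimately have "prob (E1 \<union> E2 \<union> E3) \<le> b + (\<Sum>i<m. d i) + (\<Sum>A\<in>As. prob {\<omega> \<in> space R. \<eta> \<omega> \<inter> A = {}})"
    using B(2) by (simp add: E1_def)
  moreover have "good B m D As (\<eta> \<omega>)" if "\<omega> \<in> space R - (E1 \<union> E2 \<union> E3)" for \<omega>
    using that by (auto simp: good_def E1_def E2_def E3_def)
  ultimately show ?thesis using E by (intro bexI[of _ "E1 \<union> E2 \<union> E3"]) auto
qed

context triangular_array
begin

lemma \<xi>_occ_measurable:
  "finite J \<Longrightarrow> (\<And>q. q \<in> J \<Longrightarrow> regular (C q)) \<Longrightarrow> (\<lambda>\<omega>. occ J C (\<xi> n \<omega>)) \<in> M n \<rightarrow>\<^sub>M count_space (Pow J)"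
  by (intro occ_measurable \<xi>_hits_sets regularD)

lemma \<zeta>_occ_measurable:
  "finite J \<Longrightarrow> (\<And>q. q \<in> J \<Longrightarrow> regular (C q)) \<Longrightarrow> (\<lambda>\<omega>. occ J C (\<zeta> \<omega>)) \<in> N \<rightarrow>\<^sub>M count_space (Pow J)"
  by (intro occ_measurable \<zeta>_hits_sets regularD)

text \<open>The event that all occupied cells belong to \<open>s\<close> says that the union of the other cells is
  avoided; inclusion-exclusion recovers the law of the set of occupied cells.\<close>

lemma occ_convergence:
  assumes J: "finite J" and C: "\<And>q. q \<in> J \<Longrightarrow> regular (C q)" "disjoint_family_on C J" and s: "s \<in> Pow J"
  shows "(\<lambda>n. measure (M n) {\<omega> \<in> space (M n). occ J C (\<xi> n \<omega>) = s}) \<longlonglongrightarrow> measure N {\<omega> \<in> space N. occ J C (\<zeta> \<omega>) = s}"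
proof -
  have "finite s" "s \<subseteq> J" using s finite_subset[OF _ J] by auto
  then show ?thesis
  proof (induction s rule: finite_psubset_induct)
    case (psubset s)
    have inside: "occ J C \<kappa> \<subseteq> s \<longleftrightarrow> \<kappa> \<inter> (\<Union>q\<in>J - s. C q) = {}" for \<kappa> by (auto simp: occ_def)
    have "regular (\<Union>q\<in>J - s. C q)"
      using J C disjoint_family_on_mono[OF _ C(2)] by (intro regular_UN) auto
    then have lim: "(\<lambda>n. measure (M n) {\<omega> \<in> space (M n). occ J C (\<xi> n \<omega>) \<subseteq> s}) \<longlonglongrightarrow> measure N {\<omega> \<in> space N. occ J C (\<zeta> \<omega>) \<subseteq> s}"
      unfolding inside by (rule regular_avoids_limit)
    have meas: "(\<lambda>\<omega>. occ J C (\<xi> n \<omega>)) \<in> M n \<rightarrow>\<^sub>M count_space (Pow J)"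
      "(\<lambda>\<omega>. occ J C (\<zeta> \<omega>)) \<in> N \<rightarrow>\<^sub>M count_space (Pow J)" for n
      by (intro \<xi>_occ_measurable \<zeta>_occ_measurable J C; assumption)+
    have fin: "finite (Pow s)" and "s \<in> Pow s" using psubset.hyps by auto
    have "measure (M n) {\<omega> \<in> space (M n). occ J C (\<xi> n \<omega>) = s} =
        measure (M n) {\<omega> \<in> space (M n). occ J C (\<xi> n \<omega>) \<subseteq> s} -
        (\<Sum>s'\<in>Pow s - {s}. measure (M n) {\<omega> \<in> space (M n). occ J C (\<xi> n \<omega>) = s'})" for n
      using prob_subset_eq_sum[OF prob_M J meas(1) psubset.prems, of n]
        sum.remove[OF fin \<open>s \<in> Pow s\<close>, of "\<lambda>s'. measure (M n) {\<omega> \<in> space (M n). occ J C (\<xi> n \<omega>) = s'}"] by simp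
    moreover have "measure N {\<omega> \<in> space N. occ J C (\<zeta> \<omega>) = s} =
        measure N {\<omega> \<in> space N. occ J C (\<zeta> \<omega>) \<subseteq> s} -
        (\<Sum>s'\<in>Pow s - {s}. measure N {\<omega> \<in> space N. occ J C (\<zeta> \<omega>) = s'})"
      using prob_subset_eq_sum[OF prob_N J meas(2) psubset.prems]
        sum.remove[OF fin \<open>s \<in> Pow s\<close>, of "\<lambda>s'. measure N {\<omega> \<in> space N. occ J C (\<zeta> \<omega>) = s'}"] by simp
    moreover have "(\<lambda>n. measure (M n) {\<omega> \<in> space (M n). occ J C (\<xi> n \<omega>) = s'}) \<longlonglongrightarrow> measure N {\<omega> \<in> space N. occ J C (\<zeta> \<omega>) = s'}"
      if "s' \<in> Pow s - {s}" for s'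
      using that psubset.prems by (intro psubset.IH) auto
    ultimately show ?case using lim by (simp only:) (intro tendsto_diff tendsto_sum)
  qed
qed

lemma exceptional_events:
  assumes B: "regular B" and D: "\<forall>i<m. regular (D i)" and As: "finite As" "\<forall>A\<in>As. regular A"
    and small: "measure \<Lambda> B + (\<Sum>i<m. (measure \<Lambda> (D i))\<^sup>2) + (\<Sum>A\<in>As. measure N {\<omega> \<in> space N. \<zeta> \<omega> \<inter> A = {}}) < e"
  shows "\<forall>\<^sub>F n in sequentially. \<exists>E\<in>sets (M n). measure (M n) E \<le> e \<and> (\<forall>\<omega>\<in>space (M n) - E. good B m D As (\<xi> n \<omega>))"
    and "\<exists>E\<in>sets N. measure N E \<le> e \<and> (\<forall>\<omega>\<in>space N - E. good B m D As (\<zeta> \<omega>))"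
proof -
  define v where "v n = mean n B + (\<Sum>i<m. (mean n (D i))\<^sup>2) + (\<Sum>A\<in>As. measure (M n) {\<omega> \<in> space (M n). \<xi> n \<omega> \<inter> A = {}})" for n
  have "v \<longlonglongrightarrow> measure \<Lambda> B + (\<Sum>i<m. (measure \<Lambda> (D i))\<^sup>2) + (\<Sum>A\<in>As. measure N {\<omega> \<in> space N. \<zeta> \<omega> \<inter> A = {}})"
    unfolding v_def using B D As
    by (intro tendsto_add tendsto_sum tendsto_power regularD(3) regular_avoids_limit) auto
  from order_tendstoD(2)[OF this small]
  show "\<forall>\<^sub>F n in sequentially. \<exists>E\<in>sets (M n). measure (M n) E \<le> e \<and> (\<forall>\<omega>\<in>space (M n) - E. good B m D As (\<xi> n \<omega>))"
  proof eventually_elim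
    case (elim n)
    have "\<exists>E\<in>sets (M n). measure (M n) E \<le> v n \<and> (\<forall>\<omega>\<in>space (M n) - E. good B m D As (\<xi> n \<omega>))"
      unfolding v_def using B D As
      by (intro exceptional_event prob_M \<xi>_hits_sets \<xi>_hits_prob_le \<xi>_multiple regularD) auto
    then show ?case using elim by (meson less_imp_le order_trans)
  qed
  have "\<exists>E\<in>sets N. measure N E \<le> measure \<Lambda> B + (\<Sum>i<m. (measure \<Lambda> (D i))\<^sup>2) + (\<Sum>A\<in>As. measure N {\<omega> \<in> space N. \<zeta> \<omega> \<inter> A = {}})
      \<and> (\<forall>\<omega>\<in>space N - E. good B m D As (\<zeta> \<omega>))"
    using B D As by (intro exceptional_event prob_N \<zeta>_hits_sets \<zeta>_hits_prob_le \<zeta>_multiple regularD) auto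
  then show "\<exists>E\<in>sets N. measure N E \<le> e \<and> (\<forall>\<omega>\<in>space N - E. good B m D As (\<zeta> \<omega>))"
    using small by (meson less_imp_le order_trans)
qed

text \<open>Outside an event of small probability, \<open>Y n\<close> and \<open>Z\<close> are within \<open>e\<close> of one and the same function \<open>r\<close>
  of the set of occupied cells. For \<open>Z\<close> the bound on the probability is the displayed sum; for \<open>Y n\<close>
  the analogous sum converges to it.\<close>

definition cell_approximable ::
  "real \<Rightarrow> 'x set \<Rightarrow> ('x \<Rightarrow> 'x \<Rightarrow> real) \<Rightarrow> (nat \<Rightarrow> 'a \<Rightarrow> 'x) \<Rightarrow> ('b \<Rightarrow> 'x) \<Rightarrow> bool" where
  "cell_approximable e S d Y Z \<longleftrightarrow> (\<exists>(J :: (nat \<times> nat) set) C r B m D As.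
      finite J \<and> disjoint_family_on C J \<and> (\<forall>q\<in>J. regular (C q)) \<and> r ` Pow J \<subseteq> S \<and>
      regular B \<and> (\<forall>i<m. regular (D i)) \<and> finite As \<and> (\<forall>A\<in>As. regular A) \<and>
      measure \<Lambda> B + (\<Sum>i<m. (measure \<Lambda> (D i))\<^sup>2) + (\<Sum>A\<in>As. measure N {\<omega> \<in> space N. \<zeta> \<omega> \<inter> A = {}}) < e \<and>
      (\<forall>n\<ge>1. \<forall>\<omega>\<in>space (M n). good B m D As (\<xi> n \<omega>) \<longrightarrow> d (Y n \<omega>) (r (occ J C (\<xi> n \<omega>))) \<le> e) \<and>
      (\<forall>\<omega>\<in>space N. good B m D As (\<zeta> \<omega>) \<longrightarrow> d (Z \<omega>) (r (occ J C (\<zeta> \<omega>))) \<le> e))"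

lemma functional_convergence:
  fixes S :: "'x set" and d :: "'x \<Rightarrow> 'x \<Rightarrow> real"
  assumes metric: "Metric_space S d"
    and Y: "\<And>n. Y n \<in> M n \<rightarrow>\<^sub>M borel_of (Metric_space.mtopology S d)"
    and Z: "Z \<in> N \<rightarrow>\<^sub>M borel_of (Metric_space.mtopology S d)"
    and approx: "\<And>e. 0 < e \<Longrightarrow> cell_approximable e S d Y Z"
  shows "conv_in_distribution (Metric_space.mtopology S d) M Y N Z"
proof (rule Metric_space.conv_in_distribution_finite_approxI[OF metric prob_M prob_N Y Z])
  fix e :: real assume "0 < e"
  obtain J :: "(nat \<times> nat) set" and C r B m D As where J: "finite J" "disjoint_family_on C J" "\<forall>q\<in>J. regular (C q)"
    and r: "r ` Pow J \<subseteq> S"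
    and reg: "regular B" "\<forall>i<m. regular (D i)" "finite As" "\<forall>A\<in>As. regular A"
    and small: "measure \<Lambda> B + (\<Sum>i<m. (measure \<Lambda> (D i))\<^sup>2) + (\<Sum>A\<in>As. measure N {\<omega> \<in> space N. \<zeta> \<omega> \<inter> A = {}}) < e"
    and near: "\<forall>n\<ge>1. \<forall>\<omega>\<in>space (M n). good B m D As (\<xi> n \<omega>) \<longrightarrow> d (Y n \<omega>) (r (occ J C (\<xi> n \<omega>))) \<le> e"
      "\<forall>\<omega>\<in>space N. good B m D As (\<zeta> \<omega>) \<longrightarrow> d (Z \<omega>) (r (occ J C (\<zeta> \<omega>))) \<le> e"
    using approx[OF \<open>0 < e\<close>] unfolding cell_approximable_def by (elim exE conjE) (rule that)
  note exc = exceptional_events[OF reg small]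
  show "\<exists>(J :: (nat \<times> nat) set set) r S' T. finite J \<and> r ` J \<subseteq> S \<and>
      (\<forall>n. S' n \<in> M n \<rightarrow>\<^sub>M count_space J) \<and> T \<in> N \<rightarrow>\<^sub>M count_space J \<and>
      (\<forall>s\<in>J. (\<lambda>n. measure (M n) {\<omega>\<in>space (M n). S' n \<omega> = s}) \<longlonglongrightarrow> measure N {\<omega>\<in>space N. T \<omega> = s}) \<and>
      (\<forall>\<^sub>F n in sequentially. \<exists>E\<in>sets (M n). measure (M n) E \<le> e \<and>
         (\<forall>\<omega>\<in>space (M n) - E. d (Y n \<omega>) (r (S' n \<omega>)) \<le> e)) \<and>
      (\<exists>E\<in>sets N. measure N E \<le> e \<and> (\<forall>\<omega>\<in>space N - E. d (Z \<omega>) (r (T \<omega>)) \<le> e))"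
  proof (intro exI conjI allI ballI)
    show "finite (Pow J)" "r ` Pow J \<subseteq> S" using J r by auto
    show "(\<lambda>\<omega>. occ J C (\<xi> n \<omega>)) \<in> M n \<rightarrow>\<^sub>M count_space (Pow J)" for n
      using J by (intro \<xi>_occ_measurable) auto
    show "(\<lambda>\<omega>. occ J C (\<zeta> \<omega>)) \<in> N \<rightarrow>\<^sub>M count_space (Pow J)"
      using J by (intro \<zeta>_occ_measurable) auto
    show "(\<lambda>n. measure (M n) {\<omega> \<in> space (M n). occ J C (\<xi> n \<omega>) = s}) \<longlonglongrightarrow> measure N {\<omega> \<in> space N. occ J C (\<zeta> \<omega>) = s}"
      if "s \<in> Pow J" for s
      using J that by (intro occ_convergence) auto
    show "\<forall>\<^sub>F n in sequentially. \<exists>E\<in>sets (M n). measure (M n) E \<le> e \<and>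
         (\<forall>\<omega>\<in>space (M n) - E. d (Y n \<omega>) (r (occ J C (\<xi> n \<omega>))) \<le> e)"
      using exc(1) eventually_ge_at_top[of 1]
    proof eventually_elim
      case (elim n)
      then obtain E where "E \<in> sets (M n)" "measure (M n) E \<le> e" "\<forall>\<omega>\<in>space (M n) - E. good B m D As (\<xi> n \<omega>)" by blast
      then show ?case using near(1) elim(2) by (intro bexI[of _ E]) auto
    qed
    obtain E where "E \<in> sets N" "measure N E \<le> e" "\<forall>\<omega>\<in>space N - E. good B m D As (\<zeta> \<omega>)" using exc(2) by blast
    then show "\<exists>E\<in>sets N. measure N E \<le> e \<and> (\<forall>\<omega>\<in>space N - E. d (Z \<omega>) (r (occ J C (\<zeta> \<omega>))) \<le> e)"
      using near(2) by (intro bexI[of _ E]) auto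
  qed
qed

subsection \<open>Choice of the grid\<close>

lemma position_continuity_all: "position_continuity {0..1}"
proof -
  have "(\<lambda>n. position_mass c n {..2}) \<longlonglongrightarrow> measure \<mu> ({0..1} \<inter> {..2})"
    by (rule position_mass_half_lines(1)[OF c_pos sets_\<mu> finite_\<mu> weak_\<mu>]) auto
  moreover have "position_mass c n {..2} = position_mass c n {0..1}" for n
    by (intro antisym position_mass_mono[OF c_pos sets_\<mu> finite_\<mu> weak_\<mu>]) auto
  moreover have "{0..1} \<inter> {..2} = {0..1::real}" by auto
  ultimately show ?thesis by (simp add: position_continuity_def)
qed

lemma position_continuity_Diff:
  assumes "position_continuity I" "position_continuity I'" "I' \<subseteq> I"
  shows "position_continuity (I - I')"
proof -
  interpret finite_measure \<mu> by (rule finite_\<mu>)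
  have I: "I \<in> sets borel" "I \<subseteq> {0..1}" "I' \<in> sets borel" "I' \<subseteq> {0..1}" using assms by (auto simp: position_continuity_def)
  then have "I \<in> sets \<mu>" "I' \<in> sets \<mu>" unfolding sets_\<mu> by (auto simp: sets_restrict_space image_iff)
  then have "measure \<mu> (I - I') = measure \<mu> I - measure \<mu> I'" using assms(3) by (rule finite_measure_Diff)
  moreover have "position_mass c n (I - I') = position_mass c n I - position_mass c n I'" for n
    using position_mass_Un[of I' "I - I'" c n] assms(3) by (simp add: Un_absorb1)
  ultimately show ?thesis
    using assms(1,2) I by (auto simp: position_continuity_def intro!: tendsto_diff)
qed

lemma position_continuity_interval:
  assumes "x < y" "measure \<mu> ({0..1} \<inter> {x}) = 0" "measure \<mu> ({0..1} \<inter> {y}) = 0"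
  shows "position_continuity ({0..1} \<inter> {x<..<y})"
proof -
  interpret finite_measure \<mu> by (rule finite_\<mu>)
  have pset: "{0..1} \<inter> I \<in> sets \<mu>" if "I \<in> sets borel" for I
    using that unfolding sets_\<mu> by (auto simp: sets_restrict_space)
  have "position_mass c n ({0..1} \<inter> {x<..<y}) = position_mass c n {x<..<y}" for n
    by (intro antisym position_mass_mono[OF c_pos sets_\<mu> finite_\<mu> weak_\<mu>]) auto
  moreover have split: "{..<y} = {..x} \<union> {x<..<y}" and disj: "{..x} \<inter> {x<..<y} = {}" using assms(1) by auto
  have "position_mass c n {..<y} = position_mass c n {..x} + position_mass c n {x<..<y}" for n
    unfolding split by (rule position_mass_Un[OF disj])
  ultimately have mass: "position_mass c n ({0..1} \<inter> {x<..<y}) = position_mass c n {..<y} - position_mass c n {..x}" for n by simp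
  have "measure \<mu> ({0..1} \<inter> {..y}) = measure \<mu> (({0..1} \<inter> {..x}) \<union> (({0..1} \<inter> {x<..<y}) \<union> ({0..1} \<inter> {y})))"
    using assms(1) by (intro arg_cong[where f="measure \<mu>"]) auto
  also have "\<dots> = measure \<mu> ({0..1} \<inter> {..x}) + measure \<mu> (({0..1} \<inter> {x<..<y}) \<union> ({0..1} \<inter> {y}))"
    using assms(1) by (intro finite_measure_Union pset sets.Un) auto
  also have "measure \<mu> (({0..1} \<inter> {x<..<y}) \<union> ({0..1} \<inter> {y})) = measure \<mu> ({0..1} \<inter> {x<..<y}) + measure \<mu> ({0..1} \<inter> {y})"
    by (intro finite_measure_Union pset) auto
  finally have "measure \<mu> ({0..1} \<inter> {x<..<y}) = measure \<mu> ({0..1} \<inter> {..y}) - measure \<mu> ({0..1} \<inter> {..x})"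
    using assms(3) by simp
  moreover have "(\<lambda>n. position_mass c n {..<y}) \<longlonglongrightarrow> measure \<mu> ({0..1} \<inter> {..y})"
    by (rule position_mass_half_lines(2)[OF c_pos sets_\<mu> finite_\<mu> weak_\<mu> assms(3)])
  moreover have "(\<lambda>n. position_mass c n {..x}) \<longlonglongrightarrow> measure \<mu> ({0..1} \<inter> {..x})"
    by (rule position_mass_half_lines(1)[OF c_pos sets_\<mu> finite_\<mu> weak_\<mu> assms(2)])
  ultimately show ?thesis
    unfolding position_continuity_def mass by (simp only:) (intro conjI tendsto_diff; simp)
qed

lemma position_continuity_UN:
  assumes "finite J" "\<And>a. a \<in> J \<Longrightarrow> position_continuity (I a)" "disjoint_family_on I J"
  shows "position_continuity (\<Union>a\<in>J. I a)"
  using assms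
proof (induction J)
  case empty
  then show ?case by (simp add: position_continuity_def position_mass_def)
next
  case (insert a J)
  interpret finite_measure \<mu> by (rule finite_\<mu>)
  have U: "position_continuity (\<Union>a\<in>J. I a)"
    using insert.IH insert.prems(1) disjoint_family_on_mono[OF subset_insertI insert.prems(2)] by blast
  have a: "position_continuity (I a)" using insert.prems(1) by simp
  have dis: "I a \<inter> (\<Union>a\<in>J. I a) = {}"
    using insert.prems(2) insert.hyps(2) unfolding disjoint_family_on_def by auto
  have "I a \<in> sets \<mu>" "(\<Union>a\<in>J. I a) \<in> sets \<mu>"
    using a U unfolding sets_\<mu> position_continuity_def by (auto simp: sets_restrict_space image_iff)
  then have "measure \<mu> (I a \<union> (\<Union>a\<in>J. I a)) = measure \<mu> (I a) + measure \<mu> (\<Union>a\<in>J. I a)"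
    using dis by (rule finite_measure_Union)
  then have "position_continuity (I a \<union> (\<Union>a\<in>J. I a))"
    using a U unfolding position_continuity_def position_mass_Un[OF dis] by (auto intro!: tendsto_add)
  then show ?case by simp
qed

lemma position_continuity_sets: "position_continuity I \<Longrightarrow> I \<in> sets \<mu>"
  unfolding sets_\<mu> position_continuity_def by (auto simp: sets_restrict_space image_iff)

end

context triangular_array
begin

text \<open>Finite measures have countably many atoms, so only countably many offsets put a column boundary on
  an atom.\<close>

lemma offset_exists:
  assumes "0 < w"
  shows "\<exists>u. - w < u \<and> u < 0 \<and> (\<forall>a::nat. measure \<mu> ({0..1} \<inter> {u + real a * w}) = 0)"
proof -
  interpret finite_measure \<mu> by (rule finite_\<mu>)
  define D where "D = {x. measure \<mu> {x} \<noteq> 0}"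
  have "countable D" unfolding D_def by (rule countable_support)
  then have "countable (\<Union>a::nat. (\<lambda>x. x - real a * w) ` D)" by simp
  moreover have "uncountable {- w<..<0}" using assms by (simp add: uncountable_open_interval)
  ultimately obtain u where u: "u \<in> {- w<..<0}" "u \<notin> (\<Union>a::nat. (\<lambda>x. x - real a * w) ` D)"
    by (meson countable_subset subsetI)
  have "measure \<mu> ({0..1} \<inter> {u + real a * w}) = 0" for a :: nat
  proof (cases "u + real a * w \<in> {0..1}")
    case True
    have "u + real a * w \<notin> D"
    proof
      assume "u + real a * w \<in> D"
      then have "u \<in> (\<lambda>x. x - real a * w) ` D" by (rule image_eqI[rotated]) simp
      then show False using u(2) by blast
    qed
    then show ?thesis using True by (simp add: D_def)
  qed (auto simp: Int_absorb1)
  then show ?thesis using u(1) by auto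
qed

lemma \<gamma>_point: "0 < x \<Longrightarrow> emeasure \<gamma> {x} = 0"
proof -
  assume "0 < x"
  moreover have "space \<gamma> = Rplus" using sets_eq_imp_space_eq[OF sets_\<gamma>] by (simp add: space_restrict_space)
  ultimately show ?thesis using nonatomic_\<gamma> by (simp add: nonatomic_def Rplus_def)
qed

text \<open>The tails decrease to the point at infinity, which carries no mass.\<close>

lemma high_level_exists:
  assumes "0 < t" "0 < \<eta>"
  shows "\<exists>T>t. measure \<gamma> {ennreal T<..} < \<eta>"
proof -
  define A where "A n = {ennreal (t + real n)<..}" for n :: nat
  have "(\<lambda>n. measure \<gamma> (A n)) \<longlonglongrightarrow> measure \<gamma> (\<Inter>n. A n)"
  proof (rule Lim_measure_decseq)
    show "range A \<subseteq> sets \<gamma>" using tail_in_sets_\<gamma>(1) by (auto simp: A_def)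
    show "decseq A" unfolding A_def decseq_def
    proof (intro allI impI)
      fix m n :: nat assume "m \<le> n"
      then have "ennreal (t + real m) \<le> ennreal (t + real n)" by (intro ennreal_leI) simp
      then show "{ennreal (t + real n)<..} \<subseteq> {ennreal (t + real m)<..}" by auto
    qed
    show "emeasure \<gamma> (A n) \<noteq> \<infinity>" for n
      using finite_tail_\<gamma>[of "t + real n"] assms(1) by (simp add: A_def)
  qed
  moreover have "(\<Inter>n. A n) \<subseteq> {\<top>}"
  proof
    fix x assume x: "x \<in> (\<Inter>n. A n)"
    show "x \<in> {\<top>}"
    proof (cases x)
      case (real r)
      obtain n :: nat where "r < real n" using reals_Archimedean2 by blast
      then have "x \<le> ennreal (t + real n)" unfolding real using assms(1) by (intro ennreal_leI) simp
      moreover have "ennreal (t + real n) < x" using x by (auto simp: A_def)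
      ultimately show ?thesis by simp
    qed simp
  qed
  then have "measure \<gamma> (\<Inter>n. A n) = 0"
  proof -
    have "emeasure \<gamma> (\<Inter>n. A n) \<le> emeasure \<gamma> {\<top>}"
    proof (rule emeasure_mono)
      show "{\<top>} \<in> sets \<gamma>"
        unfolding sets_\<gamma> by (subst sets_restrict_space_iff) (auto simp: Rplus_def)
    qed fact
    then show ?thesis using \<gamma>_point[of \<top>] by (simp add: measure_def)
  qed
  ultimately have "\<forall>\<^sub>F n in sequentially. measure \<gamma> (A n) < \<eta>" using assms(2) by (auto intro: order_tendstoD(2))
  then obtain n0 where "\<And>n. n0 \<le> n \<Longrightarrow> measure \<gamma> (A n) < \<eta>" by (auto simp: eventually_sequentially)
  from this[of "Suc n0"] show ?thesis by (intro exI[of _ "t + real (Suc n0)"]) (simp add: A_def)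
qed

lemma fine_rows_exist:
  assumes t: "0 < t" and \<eta>: "0 < \<eta>"
  shows "\<exists>\<delta> l. 0 < \<delta> \<and> \<delta> \<le> \<eta> \<and> measure \<gamma> {ennreal (t + real l * \<delta>)<..} \<le> \<eta> \<and>
    (\<forall>b<l. measure \<gamma> {ennreal (t + real b * \<delta>)<..ennreal (t + (real b + 1) * \<delta>)} \<le> \<eta>)"
proof -
  obtain T where T: "t < T" "measure \<gamma> {ennreal T<..} < \<eta>" using high_level_exists[OF t \<eta>] by blast
  define W where "W = {ennreal t<..ennreal T}"
  have W: "W \<in> sets \<gamma>" unfolding W_def by (rule tail_in_sets_\<gamma>)
  have finW: "emeasure \<gamma> W < \<infinity>"
    by (rule le_less_trans[OF emeasure_mono finite_tail_\<gamma>[OF t]]) (auto simp: W_def intro: tail_in_sets_\<gamma>)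
  have sp: "space \<gamma> = Rplus" using sets_eq_imp_space_eq[OF sets_\<gamma>] by (simp add: space_restrict_space)
  have WR: "W \<inter> Rplus = W" using ennreal_tail_Rplus(2)[of "ennreal t"] by (auto simp: W_def)
  define \<nu> where "\<nu> = distr (restrict_space \<gamma> W) borel enn2real"
  have m: "enn2real \<in> restrict_space \<gamma> W \<rightarrow>\<^sub>M borel"
  proof (rule measurable_restrict_space1)
    have "enn2real \<in> Rplus_borel \<rightarrow>\<^sub>M borel" by (intro measurable_restrict_space1) measurable
    then show "enn2real \<in> \<gamma> \<rightarrow>\<^sub>M borel" using measurable_cong_sets[OF sets_\<gamma> refl] by blast
  qed
  have \<nu>: "measure \<nu> A = measure \<gamma> (enn2real -` A \<inter> W)" if "A \<in> sets borel" for A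
  proof -
    have "measure \<nu> A = measure (restrict_space \<gamma> W) (enn2real -` A \<inter> W)"
      unfolding \<nu>_def using m that by (subst measure_distr) (auto simp: space_restrict_space sp WR)
    also have "\<dots> = measure \<gamma> (enn2real -` A \<inter> W)"
      using W by (intro measure_restrict_space) (auto simp: sp WR)
    finally show ?thesis .
  qed
  have fin: "finite_measure \<nu>"
    unfolding \<nu>_def
  proof (rule finite_measure.finite_measure_distr[OF _ m])
    show "finite_measure (restrict_space \<gamma> W)"
    proof (rule finite_measureI)
      have "space (restrict_space \<gamma> W) = W" using WR by (auto simp: space_restrict_space sp)
      moreover have "emeasure (restrict_space \<gamma> W) W = emeasure \<gamma> W"
        using W by (intro emeasure_restrict_space) (auto simp: sp WR)
      ultimately show "emeasure (restrict_space \<gamma> W) (space (restrict_space \<gamma> W)) \<noteq> \<infinity>" using finW by simp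
    qed
  qed
  have atomless: "measure \<nu> {x} = 0" for x
  proof -
    have "enn2real -` {x} \<inter> W \<subseteq> {ennreal x}"
    proof
      fix y assume "y \<in> enn2real -` {x} \<inter> W"
      then have "enn2real y = x" "y < \<top>" by (auto simp: W_def intro: le_less_trans)
      then show "y \<in> {ennreal x}" by (auto simp: ennreal_enn2real)
    qed
    moreover have "emeasure \<gamma> (enn2real -` {x} \<inter> W) = 0"
    proof (cases "0 < ennreal x")
      case True
      then have "{ennreal x} \<in> sets \<gamma>"
        unfolding sets_\<gamma> by (subst sets_restrict_space_iff) (auto simp: Rplus_def)
      then have "emeasure \<gamma> (enn2real -` {x} \<inter> W) \<le> emeasure \<gamma> {ennreal x}"
        using \<open>enn2real -` {x} \<inter> W \<subseteq> {ennreal x}\<close> by (intro emeasure_mono)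
      then show ?thesis using \<gamma>_point[OF True] by simp
    next
      case False
      then have "ennreal x = 0" by (simp only: zero_less_iff_neq_zero not_not)
      then have "enn2real -` {x} \<inter> W \<subseteq> {0} \<inter> W"
        using \<open>enn2real -` {x} \<inter> W \<subseteq> {ennreal x}\<close> by simp
      moreover have "0 \<notin> W" by (simp add: W_def)
      ultimately have "enn2real -` {x} \<inter> W = {}" by blast
      then show ?thesis by simp
    qed
    ultimately show ?thesis using \<nu>[of "{x}"] by (simp add: measure_def)
  qed
  obtain r where r: "0 < r" "\<And>x y. x \<in> {t..T} \<Longrightarrow> y \<in> {t..T} \<Longrightarrow> x < y \<Longrightarrow> y \<le> x + r \<Longrightarrow> measure \<nu> {x<..y} \<le> \<eta>"
    using atomless_increments_small[OF fin _ atomless \<eta>, of t T] by (auto simp: \<nu>_def)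
  obtain l' :: nat where l': "(T - t) / min r \<eta> < real l'" using reals_Archimedean2 by blast
  define l where "l = Suc l'"
  \<comment> \<open>The top of the grid is exactly \<open>T\<close>.\<close>
  define \<delta> where "\<delta> = (T - t) / l"
  have l: "0 < l" "(T - t) / min r \<eta> \<le> l" using l' by (auto simp: l_def)
  have \<delta>: "0 < \<delta>" "\<delta> \<le> min r \<eta>"
  proof -
    show "0 < \<delta>" using T l by (simp add: \<delta>_def)
    have "(T - t) \<le> l * min r \<eta>" using l(2) r(1) \<eta> by (subst (asm) pos_divide_le_eq) auto
    then show "\<delta> \<le> min r \<eta>" unfolding \<delta>_def using l(1) by (subst pos_divide_le_eq) (auto simp: mult.commute)
  qed
  have top: "t + real l * \<delta> = T" using l(1) by (simp add: \<delta>_def)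
  have "measure \<gamma> {ennreal (t + real b * \<delta>)<..ennreal (t + (real b + 1) * \<delta>)} \<le> \<eta>" if "b < l" for b
  proof -
    define x y where "x = t + real b * \<delta>" and "y = t + (real b + 1) * \<delta>"
    have "(real b + 1) * \<delta> \<le> real l * \<delta>" using that \<delta>(1) by (intro mult_right_mono) auto
    then have xy: "x \<in> {t..T}" "y \<in> {t..T}" "x < y" "y \<le> x + r"
      using top \<delta> by (auto simp: x_def y_def algebra_simps)
    have "enn2real -` {x<..y} \<inter> W = {ennreal x<..ennreal y}"
    proof (intro set_eqI iffI)
      fix z assume z: "z \<in> enn2real -` {x<..y} \<inter> W"
      then have "z < \<top>" by (auto simp: W_def intro: le_less_trans)
      then obtain s where "z = ennreal s" "0 \<le> s" by (cases z) auto
      then show "z \<in> {ennreal x<..ennreal y}" using z xy t by (auto simp: ennreal_less_iff ennreal_leI)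
    next
      fix z assume z: "z \<in> {ennreal x<..ennreal y}"
      then have "z < \<top>" by (auto intro: le_less_trans)
      then obtain s where s: "z = ennreal s" "0 \<le> s" by (cases z) auto
      have "0 \<le> x" "0 \<le> y" using xy(1,2) t by auto
      then have "x < s" "s \<le> y" using z s by (auto simp: ennreal_less_iff)
      then show "z \<in> enn2real -` {x<..y} \<inter> W"
        using s xy t by (auto simp: W_def ennreal_less_iff ennreal_leI)
    qed
    then have "measure \<gamma> {ennreal x<..ennreal y} = measure \<nu> {x<..y}" using \<nu>[of "{x<..y}"] by simp
    also have "\<dots> \<le> \<eta>" by (rule r(2)[OF xy])
    finally show ?thesis by (simp add: x_def y_def)
  qed
  then show ?thesis using \<delta> top T(2) by (intro exI[of _ \<delta>] exI[of _ l]) auto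
qed

lemma fine_columns_exist:
  assumes "nonatomic \<mu>" "0 < \<eta>"
  shows "\<exists>K::nat. 0 < K \<and> 1 / K \<le> \<eta> \<and> (\<forall>a<K. measure \<mu> ({0..1} \<inter> {real a * (1 / K)<..<(real a + 1) * (1 / K)}) \<le> \<eta>)"
proof -
  interpret finite_measure \<mu> by (rule finite_\<mu>)
  have sp: "space \<mu> = {0..1}" using sets_eq_imp_space_eq[OF sets_\<mu>] by (simp add: space_restrict_space)
  define \<nu> where "\<nu> = distr \<mu> borel (\<lambda>x. x)"
  have m: "(\<lambda>x. x) \<in> \<mu> \<rightarrow>\<^sub>M borel"
    using measurable_cong_sets[OF sets_\<mu> refl, of borel] measurable_restrict_space1[of "\<lambda>x. x" borel borel "{0..1}"] by auto
  have \<nu>: "measure \<nu> A = measure \<mu> ({0..1} \<inter> A)" if "A \<in> sets borel" for A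
    unfolding \<nu>_def using m that by (subst measure_distr) (auto simp: sp Int_commute)
  have fin: "finite_measure \<nu>" unfolding \<nu>_def by (rule finite_measure_distr[OF m])
  have atomless: "measure \<nu> {x} = 0" for x
  proof (cases "x \<in> {0..1}")
    case True
    then show ?thesis using assms(1) \<nu>[of "{x}"] by (simp add: nonatomic_def sp measure_def)
  next
    case False
    then have "{0..1} \<inter> {x} = {}" by auto
    then show ?thesis using \<nu>[of "{x}"] by simp
  qed
  obtain r where r: "0 < r" "\<And>x y. x \<in> {0..1} \<Longrightarrow> y \<in> {0..1} \<Longrightarrow> x < y \<Longrightarrow> y \<le> x + r \<Longrightarrow> measure \<nu> {x<..y} \<le> \<eta>"
    using atomless_increments_small[OF fin _ atomless assms(2), of 0 1] by (auto simp: \<nu>_def)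
  obtain K' :: nat where K': "1 / min r \<eta> < real K'" using reals_Archimedean2 by blast
  define K where "K = Suc K'"
  have "1 / min r \<eta> < K" using K' by (simp add: K_def)
  then have "1 \<le> K * min r \<eta>" using r(1) assms(2) by (subst (asm) pos_divide_less_eq) auto
  moreover have K0: "0 < K" by (simp add: K_def)
  ultimately have "1 / K \<le> min r \<eta>" by (subst pos_divide_le_eq) (simp_all only: of_nat_0_less_iff mult.commute)
  note K = K0 this
  have "measure \<mu> ({0..1} \<inter> {real a * (1 / K)<..<(real a + 1) * (1 / K)}) \<le> \<eta>" if "a < K" for a
  proof -
    define x y where "x = real a * (1 / K)" and "y = (real a + 1) * (1 / K)"
    have "(real a + 1) * (1 / K) \<le> real K * (1 / K)" using that by (intro mult_right_mono) auto
    then have "y \<le> 1" using K0 by (simp add: y_def)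
    moreover have "y = x + 1 / K" by (simp add: x_def y_def add_divide_distrib)
    moreover have "0 < 1 / K" "0 \<le> x" using K0 by (simp_all add: x_def)
    ultimately have xy: "x \<in> {0..1}" "y \<in> {0..1}" "x < y" "y \<le> x + r"
      using K(2) unfolding atLeastAtMost_iff min.bounded_iff by linarith+
    have "measure \<mu> ({0..1} \<inter> {x<..<y}) \<le> measure \<mu> ({0..1} \<inter> {x<..y})"
      unfolding sets_\<mu> by (intro finite_measure_mono) (auto simp: sets_\<mu> sets_restrict_space)
    also have "\<dots> = measure \<nu> {x<..y}" using \<nu>[of "{x<..y}"] by simp
    also have "\<dots> \<le> \<eta>" by (rule r(2)[OF xy])
    finally show ?thesis by (simp add: x_def y_def)
  qed
  then show ?thesis using K by (intro exI[of _ K]) auto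
qed

text \<open>A configuration that avoids the part of the strip above level \<open>t\<close> outside all cells is covered
  by the cells; this part has small intensity because the column boundaries carry no mass.\<close>

lemma grid_cover:
  assumes grid: "grid w t \<delta>" and u: "u \<le> 0" "1 \<le> u + real K * w"
    and null: "\<And>a::nat. measure \<mu> ({0..1} \<inter> {u + real a * w}) = 0"
  shows "position_continuity (grid.col u w a)" "regular (grid.cell u w t \<delta> q)"
    and "\<exists>B. regular B \<and> measure \<Lambda> B \<le> measure \<mu> {0..1} * measure \<gamma> {ennreal (t + real l * \<delta>)<..} \<and>
      (\<forall>\<kappa>\<in>configs. \<kappa> \<inter> B = {} \<longrightarrow> grid.covered u w t \<delta> K l \<kappa>)"
proof -
  interpret grid u w t \<delta> K l by (rule grid)
  interpret finite_measure \<mu> by (rule finite_\<mu>)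
  have colc: "position_continuity (col a)" for a
  proof -
    have "u + real a * w < u + (real a + 1) * w" using w by simp
    moreover have "measure \<mu> ({0..1} \<inter> {u + (real a + 1) * w}) = 0" using null[of "Suc a"] by (simp add: add.commute)
    ultimately show ?thesis unfolding col_def by (intro position_continuity_interval null)
  qed
  then show "position_continuity (col a)" .
  have pos: "0 < t + real b * \<delta>" for b using t \<delta> by (simp add: add_pos_nonneg)
  show "regular (cell q)"
    unfolding cell_def row_def using \<delta> pos
    by (intro regular_rectangle[where h="t + real (snd q) * \<delta>" and h'="t + (real (snd q) + 1) * \<delta>"] colc) (auto intro: mult_right_mono)
  define C where "C = (\<Union>a\<in>{..<K}. col a)"
  have C: "position_continuity C" unfolding C_def
  proof (rule position_continuity_UN)
    show "disjoint_family_on col {..<K}" unfolding disjoint_family_on_def using col_disjoint by blast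
  qed (use colc in auto)
  have C1: "C \<subseteq> {0..1}" by (auto simp: C_def col_def)
  have rest: "position_continuity ({0..1} - C)"
    by (intro position_continuity_Diff position_continuity_all C C1)
  have "measure \<mu> ({0..1} - C) = 0"
  proof -
    have "{0..1} - C \<subseteq> (\<Union>a\<in>{..K}. {0..1} \<inter> {u + real a * w})"
    proof
      fix s assume s: "s \<in> {0..1} - C"
      define k where "k = \<lceil>(s - u) / w\<rceil>"
      have "0 \<le> (s - u) / w" using s u(1) w by auto
      then have k0: "0 \<le> k" unfolding k_def by (auto simp: le_ceiling_iff)
      have "(s - u) / w \<le> real K" using s u(2) w by (auto simp: field_simps)
      then have kK: "k \<le> int K" by (simp add: k_def ceiling_le_iff)
      have k: "real_of_int k - 1 < (s - u) / w" "(s - u) / w \<le> real_of_int k" unfolding k_def by linarith+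
      then have k': "u + (real_of_int k - 1) * w < s" "s \<le> u + real_of_int k * w" using w by (simp_all add: field_simps)
      have "s = u + real_of_int k * w"
      proof (rule ccontr)
        assume ne: "s \<noteq> u + real_of_int k * w"
        have "k \<noteq> 0"
        proof
          assume "k = 0"
          then show False using k'(2) ne s u(1) by auto
        qed
        define a where "a = nat (k - 1)"
        have a: "real a = real_of_int k - 1" "a < K" using k0 \<open>k \<noteq> 0\<close> kK by (auto simp: a_def)
        have "s \<in> col a" unfolding col_def using s k' ne a(1) by auto
        then show False using s a(2) by (auto simp: C_def)
      qed
      moreover have "real_of_int k = real (nat k)" "nat k \<le> K" using k0 kK by auto
      ultimately have "s = u + real (nat k) * w" by (simp only:)
      then have "s \<in> {0..1} \<inter> {u + real (nat k) * w}" using s by simp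
      then show "s \<in> (\<Union>a\<in>{..K}. {0..1} \<inter> {u + real a * w})"
        using \<open>nat k \<le> K\<close> by (intro UN_I[of "nat k"]) simp_all
    qed
    moreover have S: "{0..1} \<inter> {x} \<in> sets \<mu>" for x unfolding sets_\<mu> by (auto simp: sets_restrict_space)
    ultimately have "measure \<mu> ({0..1} - C) \<le> measure \<mu> (\<Union>a\<in>{..K}. {0..1} \<inter> {u + real a * w})"
      by (intro finite_measure_mono sets.finite_UN) auto
    also have "\<dots> \<le> (\<Sum>a\<in>{..K}. measure \<mu> ({0..1} \<inter> {u + real a * w}))"
      using S by (intro finite_measure_subadditive_finite) auto
    also have "\<dots> = 0" by (simp only: null sum.neutral_const)
    finally show ?thesis using measure_nonneg[of \<mu> "{0..1} - C"] by linarith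
  qed
  define B1 where "B1 = ({0..1} - C) \<times> {ennreal t<..}"
  define B2 where "B2 = C \<times> {ennreal (t + real l * \<delta>)<..}"
  have B1: "regular B1" unfolding B1_def by (rule regular_rectangle[OF rest t disjI1[OF refl]])
  have B2: "regular B2" unfolding B2_def by (rule regular_rectangle[OF C pos disjI1[OF refl]])
  have dis: "B1 \<inter> B2 = {}" by (auto simp: B1_def B2_def)
  have "measure \<Lambda> (B1 \<union> B2) = measure \<mu> ({0..1} - C) * measure \<gamma> {ennreal t<..} + measure \<mu> C * measure \<gamma> {ennreal (t + real l * \<delta>)<..}"
    unfolding regular_Un(2)[OF B1 B2 dis] unfolding B1_def B2_def
    by (simp only: measure_\<Lambda>_Times position_continuity_sets[OF rest] position_continuity_sets[OF C] tail_in_sets_\<gamma>)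
  also have "\<dots> \<le> measure \<mu> {0..1} * measure \<gamma> {ennreal (t + real l * \<delta>)<..}"
    using \<open>measure \<mu> ({0..1} - C) = 0\<close> C1 position_continuity_sets[OF position_continuity_all]
    by (auto intro!: mult_right_mono finite_measure_mono)
  finally have "measure \<Lambda> (B1 \<union> B2) \<le> measure \<mu> {0..1} * measure \<gamma> {ennreal (t + real l * \<delta>)<..}" .
  moreover have "covered \<kappa>" if \<kappa>: "\<kappa> \<in> configs" "\<kappa> \<inter> (B1 \<union> B2) = {}" for \<kappa>
    unfolding covered_def
  proof (intro ballI impI)
    fix p assume p: "p \<in> \<kappa>" "ennreal t < snd p"
    have "fst p \<in> {0..1}" using configs_point[OF \<kappa>(1) p(1)] by simp
    moreover have "p \<notin> B1" "p \<notin> B2" using \<kappa>(2) p(1) by auto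
    ultimately have "fst p \<in> C" "snd p \<le> ennreal (t + real l * \<delta>)"
      using p(2) by (auto simp: B1_def B2_def mem_Times_iff not_less)
    then obtain a b where "a < K" "fst p \<in> col a" "b < l" "snd p \<in> row b"
      using row_cover[OF p(2)] by (auto simp: C_def)
    then show "\<exists>q\<in>cells. p \<in> cell q"
      by (intro bexI[of _ "(a, b)"]) (auto simp: cells_def cell_def mem_Times_iff)
  qed
  ultimately show "\<exists>B. regular B \<and> measure \<Lambda> B \<le> measure \<mu> {0..1} * measure \<gamma> {ennreal (t + real l * \<delta>)<..} \<and>
      (\<forall>\<kappa>\<in>configs. \<kappa> \<inter> B = {} \<longrightarrow> covered \<kappa>)"
    using regular_Un(1)[OF B1 B2 dis] by (intro exI[of _ "B1 \<union> B2"]) auto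
qed

end

section \<open>The three limits\<close>

lemma max_config_row_config:
  assumes n: "1 \<le> n" and x: "\<And>j. j \<in> {1..n} \<Longrightarrow> 0 \<le> x j"
  shows "max_config (row_config n x) = (MAX j\<in>{1..n}. x j)"
proof -
  define m where "m = (MAX j\<in>{1..n}. x j)"
  have "m \<in> x ` {1..n}" unfolding m_def using n by (intro Max_in) auto
  then obtain j where j: "j \<in> {1..n}" "x j = m" by auto
  have le: "x i \<le> m" if "i \<in> {1..n}" for i unfolding m_def using that by (intro Max_ge) auto
  have m0: "0 \<le> m" using x[OF j(1)] j(2) by simp
  have "Sup {y. \<exists>s. (s, y) \<in> row_config n x} = ennreal m"
  proof (rule antisym)
    show "Sup {y. \<exists>s. (s, y) \<in> row_config n x} \<le> ennreal m"
      by (rule Sup_least) (auto simp: row_config_def intro!: ennreal_leI le)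
    show "ennreal m \<le> Sup {y. \<exists>s. (s, y) \<in> row_config n x}"
    proof (cases "m = 0")
      case False
      then have "(real j / real n, ennreal m) \<in> row_config n x"
        using j m0 by (auto simp: row_config_def Rplus_def image_iff intro!: bexI[of _ j])
      then show ?thesis by (intro Sup_upper) auto
    qed simp
  qed
  then show ?thesis using m0 by (simp add: max_config_def m_def)
qed

text \<open>\<open>arg_max_on\<close> picks an index by a fixed choice that depends on the set of maximising indices only, so
  ties do not affect measurability.\<close>

lemma argmax_index_measurable:
  fixes X :: "nat \<Rightarrow> 'a \<Rightarrow> real"
  assumes X: "\<And>j. j \<in> {1..n} \<Longrightarrow> X j \<in> borel_measurable R"
  shows "(\<lambda>\<omega>. real (arg_max_on (\<lambda>j. X j \<omega>) {1..n}) / real n) \<in> borel_measurable R"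
proof -
  define A where "A \<omega> = {i. is_arg_max (\<lambda>j. X j \<omega>) (\<lambda>j. j \<in> {1..n}) i}" for \<omega>
  define C where "C i = space R - (\<Union>k\<in>{1..n}. {\<omega> \<in> space R. X i \<omega> < X k \<omega>})" for i
  have C: "C i \<in> sets R" if "i \<in> {1..n}" for i
    unfolding C_def by (intro sets.Diff sets.top sets.finite_UN borel_measurable_less X that) auto
  have "(\<lambda>\<omega>. occ {1..n} C {\<omega>}) \<in> R \<rightarrow>\<^sub>M count_space (Pow {1..n})"
  proof (rule occ_measurable)
    fix i assume "i \<in> {1..n}"
    have "{\<omega> \<in> space R. {\<omega>} \<inter> C i \<noteq> {}} = C i" by (auto simp: C_def)
    then show "{\<omega> \<in> space R. {\<omega>} \<inter> C i \<noteq> {}} \<in> sets R" using C[OF \<open>i \<in> {1..n}\<close>] by simp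
  qed simp
  moreover have "A \<omega> = occ {1..n} C {\<omega>}" if "\<omega> \<in> space R" for \<omega>
    using that by (auto simp: A_def occ_def C_def is_arg_max_def)
  ultimately have "A \<in> R \<rightarrow>\<^sub>M count_space (Pow {1..n})" by (simp cong: measurable_cong)
  then have "(\<lambda>\<omega>. real (SOME i. i \<in> A \<omega>) / real n) \<in> borel_measurable R"
    by (rule measurable_compose) simp
  then show ?thesis by (simp add: A_def arg_max_on_def arg_max_def)
qed

context triangular_array
begin

lemma grid_occ: "grid.occupied u w t \<delta> K l \<kappa> = occ (grid.cells K l) (grid.cell u w t \<delta>) \<kappa>"
  if "grid w t \<delta>"
proof -
  interpret grid u w t \<delta> K l by fact
  show ?thesis by (simp add: occupied_def occ_def)
qed

abbreviation total :: real where
  "total \<equiv> measure \<mu> {0..1}"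

text \<open>The maximum is determined by the occupied cells up to \<open>t + \<delta>\<close>, provided that all points above \<open>t\<close> lie in
  cells.\<close>

lemma max_convergence:
  "conv_in_distribution euclideanreal M (\<lambda>n \<omega>. MAX j\<in>{1..n}. X n j \<omega>) N (\<lambda>\<omega>. max_config (\<zeta> \<omega>))"
proof -
  have eq: "(MAX j\<in>{1..n}. X n j \<omega>) = max_config (\<xi> n \<omega>)" if "1 \<le> n" "\<omega> \<in> space (M n)" for n \<omega>
    unfolding \<xi>_def using max_config_row_config[OF that(1)] X_nonneg that(2) by metis
  have "conv_in_distribution Met_TC.mtopology M (\<lambda>n \<omega>. MAX j\<in>{1..n}. X n j \<omega>) N (\<lambda>\<omega>. max_config (\<zeta> \<omega>))"
  proof (rule functional_convergence)
    show "Metric_space (UNIV :: real set) dist" by (rule Met_TC.Metric_space_axioms)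
    show "(\<lambda>\<omega>. MAX j\<in>{1..n}. X n j \<omega>) \<in> M n \<rightarrow>\<^sub>M borel_of Met_TC.mtopology" for n
    proof (cases "n = 0")
      case False
      then have "(\<lambda>\<omega>. MAX j\<in>{1..n}. X n j \<omega>) \<in> borel_measurable (M n) \<longleftrightarrow> (\<lambda>\<omega>. max_config (\<xi> n \<omega>)) \<in> borel_measurable (M n)"
        by (intro measurable_cong eq) auto
      then show ?thesis
        using max_config_measurable[OF \<xi>_configs \<xi>_hits_sets] by (simp add: borel_of_euclidean)
    qed (simp add: borel_of_euclidean)
    show "(\<lambda>\<omega>. max_config (\<zeta> \<omega>)) \<in> N \<rightarrow>\<^sub>M borel_of Met_TC.mtopology"
      using max_config_measurable[OF \<zeta>_configs \<zeta>_hits_sets] by (simp add: borel_of_euclidean)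
  next
    fix e :: real assume "0 < e"
    \<comment> \<open>\<open>\<eta>\<close> bounds \<open>\<delta>\<close> and the mass above the grid.\<close>
    define k where "k = total + 1"
    define \<eta> where "\<eta> = e / (2 * k)"
    have "0 < k" by (simp add: k_def add_nonneg_pos)
    then have \<eta>: "0 < \<eta>" "k * \<eta> = e / 2" using \<open>0 < e\<close> by (simp_all add: \<eta>_def)
    have \<eta>2: "\<eta> \<le> e / 2" "total * \<eta> < e"
      using \<eta> \<open>0 < e\<close> mult_nonneg_nonneg[OF measure_nonneg less_imp_le[OF \<eta>(1)], of \<mu> "{0..1}"]
      unfolding k_def distrib_right by linarith+
    define t where "t = e / 2"
    have t_props: "0 < t" using \<open>0 < e\<close> by (simp add: t_def)
    obtain \<delta> l where \<delta>_props: "0 < \<delta>" "\<delta> \<le> \<eta>" "measure \<gamma> {ennreal (t + real l * \<delta>)<..} \<le> \<eta>"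
      using fine_rows_exist[OF t_props \<eta>(1)] by blast
    obtain u where u: "- 1 < u" "u < 0" "\<And>a::nat. measure \<mu> ({0..1} \<inter> {u + real a * 1}) = 0"
      using offset_exists[of 1] by auto
    have g: "grid 1 t \<delta>" using t_props \<delta>_props by unfold_locales auto
    interpret grid u 1 t \<delta> 2 l by (rule g)
    have u': "u \<le> 0" "1 \<le> u + real 2 * 1" using u by auto
    obtain B where B: "regular B" "measure \<Lambda> B \<le> total * measure \<gamma> {ennreal (t + real l * \<delta>)<..}"
      "\<forall>\<kappa>\<in>configs. \<kappa> \<inter> B = {} \<longrightarrow> covered \<kappa>"
      using grid_cover(3)[OF g u' u(3), where l=l] by (elim exE conjE) (rule that)
    have "measure \<Lambda> B \<le> total * \<eta>" using B(2) \<delta>_props(3) by (meson measure_nonneg mult_left_mono order_trans)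
    then have small: "measure \<Lambda> B < e" using \<eta>2(2) by simp
    have close: "dist (max_config \<kappa>) (enn2real (tail_height (snap ` occ cells cell \<kappa>) u)) \<le> e"
      if "\<kappa> \<in> configs" "\<kappa> \<inter> B = {}" for \<kappa>
      using max_config_snap[OF that(1) B(3)[rule_format, OF that]] \<delta>_props(2) \<eta>2(1) t_def
      unfolding grid_occ[OF g] dist_real_def by linarith
    show "cell_approximable e UNIV dist (\<lambda>n \<omega>. MAX j\<in>{1..n}. X n j \<omega>) (\<lambda>\<omega>. max_config (\<zeta> \<omega>))"
      unfolding cell_approximable_def
    proof (intro exI conjI)
      show "finite cells" "disjoint_family_on cell cells" by (fact finite_cells, fact cell_disjoint)
      show "\<forall>q\<in>cells. regular (cell q)" using grid_cover(2)[OF g u' u(3)] by blast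
      show "measure \<Lambda> B + (\<Sum>i<0. (measure \<Lambda> ((\<lambda>_. {}) i))\<^sup>2) + (\<Sum>A\<in>{}. measure N {\<omega> \<in> space N. \<zeta> \<omega> \<inter> A = {}}) < e"
        using small by simp
      show "\<forall>n\<ge>1. \<forall>\<omega>\<in>space (M n). good B 0 (\<lambda>_. {}) {} (\<xi> n \<omega>) \<longrightarrow>
          dist (MAX j\<in>{1..n}. X n j \<omega>) ((\<lambda>S. enn2real (tail_height (snap ` S) u)) (occ cells cell (\<xi> n \<omega>))) \<le> e"
      proof (intro allI ballI impI)
        fix n :: nat and \<omega> assume n: "1 \<le> n" and \<omega>: "\<omega> \<in> space (M n)" and gd: "good B 0 (\<lambda>_. {}) {} (\<xi> n \<omega>)"
        have "\<xi> n \<omega> \<inter> B = {}" using gd by (simp add: good_def)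
        then show "dist (MAX j\<in>{1..n}. X n j \<omega>) (enn2real (tail_height (snap ` occ cells cell (\<xi> n \<omega>)) u)) \<le> e"
          unfolding eq[OF n \<omega>] by (rule close[OF \<xi>_configs])
      qed
      show "\<forall>\<omega>\<in>space N. good B 0 (\<lambda>_. {}) {} (\<zeta> \<omega>) \<longrightarrow>
          dist (max_config (\<zeta> \<omega>)) ((\<lambda>S. enn2real (tail_height (snap ` S) u)) (occ cells cell (\<zeta> \<omega>))) \<le> e"
        using close[OF \<zeta>_configs] by (simp add: good_def)
    qed (use B(1) in auto)
  qed
  then show ?thesis by simp
qed

text \<open>As the level decreases to 0, the event of no point above the level decreases to the event of no point
  at all.\<close>

lemma low_level_exists:
  assumes ne: "AE \<omega> in N. \<zeta> \<omega> \<noteq> {}" and "0 < e"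
  shows "\<exists>t>0. measure N {\<omega> \<in> space N. \<zeta> \<omega> \<inter> {0..1} \<times> {ennreal t<..} = {}} < e"
proof -
  interpret prob_space N by (rule prob_N)
  define A where "A k = {\<omega> \<in> space N. \<zeta> \<omega> \<inter> {0..1} \<times> {ennreal (1 / Suc k)<..} = {}}" for k
  have A: "A k \<in> sets N" for k
  proof -
    have "{0..1} \<times> {ennreal (1 / Suc k)<..} \<in> sets config_space"
      by (intro rectangle_sets ennreal_tail_Rplus) auto
    from \<zeta>_hits_sets[OF this] have "space N - {\<omega> \<in> space N. \<zeta> \<omega> \<inter> {0..1} \<times> {ennreal (1 / Suc k)<..} \<noteq> {}} \<in> sets N" by simp
    moreover have "A k = space N - {\<omega> \<in> space N. \<zeta> \<omega> \<inter> {0..1} \<times> {ennreal (1 / Suc k)<..} \<noteq> {}}" by (auto simp: A_def)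
    ultimately show ?thesis by simp
  qed
  have "(\<lambda>k. prob (A k)) \<longlonglongrightarrow> prob (\<Inter>k. A k)"
  proof (rule finite_Lim_measure_decseq)
    show "range A \<subseteq> sets N" using A by auto
    show "decseq A" unfolding decseq_def
    proof (intro allI impI subsetI)
      fix m n \<omega> assume mn: "m \<le> n" and \<omega>: "\<omega> \<in> A n"
      have "1 / real (Suc n) \<le> 1 / real (Suc m)" using mn by (simp add: frac_le)
      then have "{ennreal (1 / Suc m)<..} \<subseteq> {ennreal (1 / Suc n)<..}" by (auto intro: le_less_trans ennreal_leI)
      then have "{0..1::real} \<times> {ennreal (1 / Suc m)<..} \<subseteq> {0..1} \<times> {ennreal (1 / Suc n)<..}" by (intro Sigma_mono) auto
      then show "\<omega> \<in> A m" using \<omega> unfolding A_def by blast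
    qed
  qed
  moreover have "prob (\<Inter>k. A k) = 0"
  proof -
    have "\<zeta> \<omega> = {}" if "\<omega> \<in> (\<Inter>k. A k)" for \<omega>
    proof (rule ccontr)
      assume "\<zeta> \<omega> \<noteq> {}"
      then obtain p where p: "p \<in> \<zeta> \<omega>" by auto
      have \<omega>: "\<omega> \<in> space N" using that by (auto simp: A_def)
      have p': "fst p \<in> {0..1}" "0 < snd p" using configs_point[OF \<zeta>_configs[OF \<omega>] p] by auto
      then obtain y where "0 < y" "y < snd p" using dense by blast
      then obtain r where r: "0 < r" "ennreal r < snd p" by (cases y) auto
      obtain k :: nat where "1 / r < real k" using reals_Archimedean2 by blast
      then have "1 / Suc k \<le> r" using r(1) by (simp add: field_simps)
      then have "ennreal (1 / Suc k) < snd p" using r(2) by (meson ennreal_leI le_less_trans)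
      then have "p \<in> \<zeta> \<omega> \<inter> {0..1} \<times> {ennreal (1 / Suc k)<..}" using p p'(1) by (simp add: mem_Times_iff)
      then show False using that by (auto simp: A_def)
    qed
    then have "AE \<omega> in N. \<omega> \<notin> (\<Inter>k. A k)" using ne by (auto elim!: eventually_mono)
    moreover have "(\<Inter>k. A k) \<in> sets N" using A by (intro sets.countable_INT) auto
    ultimately show ?thesis by (simp add: prob_eq_0 del: INT_iff)
  qed
  ultimately have "\<forall>\<^sub>F k in sequentially. prob (A k) < e" using \<open>0 < e\<close> by (auto intro: order_tendstoD(2))
  then obtain k where "prob (A k) < e" by (auto simp: eventually_sequentially)
  then show ?thesis by (intro exI[of _ "1 / Suc k"]) (simp add: A_def)
qed

text \<open>Two points in one row would leave the position of the highest point undecided. The rows of the grid have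
  \<open>\<gamma>\<close>-mass at most \<open>\<eta>\<close>, so this happens with probability of order \<open>\<eta>\<close>. The level \<open>t\<close> is chosen first, so
  low that points above \<open>t\<close> exist with high probability.\<close>

lemma argmax_convergence:
  assumes ne: "AE \<omega> in N. \<zeta> \<omega> \<noteq> {}"
  shows "conv_in_distribution euclideanreal M (\<lambda>n \<omega>. real (arg_max_on (\<lambda>j. X n j \<omega>) {1..n}) / real n) N (\<lambda>\<omega>. argmax_config (\<zeta> \<omega>))"
proof -
  have "conv_in_distribution Met_TC.mtopology M (\<lambda>n \<omega>. real (arg_max_on (\<lambda>j. X n j \<omega>) {1..n}) / real n) N (\<lambda>\<omega>. argmax_config (\<zeta> \<omega>))"
  proof (rule functional_convergence)
    show "Metric_space (UNIV :: real set) dist" by (rule Met_TC.Metric_space_axioms)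
    show "(\<lambda>\<omega>. real (arg_max_on (\<lambda>j. X n j \<omega>) {1..n}) / real n) \<in> M n \<rightarrow>\<^sub>M borel_of Met_TC.mtopology" for n
      using argmax_index_measurable[of n "X n" "M n"] X_measurable by (simp add: borel_of_euclidean)
    show "(\<lambda>\<omega>. argmax_config (\<zeta> \<omega>)) \<in> N \<rightarrow>\<^sub>M borel_of Met_TC.mtopology"
      using argmax_config_measurable[OF \<zeta>_configs npoints_measurable] by (simp add: borel_of_euclidean)
  next
    fix e :: real assume "0 < e"
    obtain t where t_props: "0 < t" "measure N {\<omega> \<in> space N. \<zeta> \<omega> \<inter> {0..1} \<times> {ennreal t<..} = {}} < e / 3"
      using low_level_exists[OF ne, of "e / 3"] \<open>0 < e\<close> by auto
    define G where "G = measure \<gamma> {ennreal t<..}"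
    \<comment> \<open>The first two summands of \<open>k\<close> serve the mass above the grid and the pairs of points in one row.\<close>
    define k where "k = total + total\<^sup>2 * G + 1"
    define \<eta> where "\<eta> = e / (3 * k)"
    have k: "0 < k" "total \<le> k" "total\<^sup>2 * G \<le> k" by (auto simp: k_def G_def add_nonneg_pos)
    have \<eta>: "0 < \<eta>" "k * \<eta> = e / 3" using k \<open>0 < e\<close> by (auto simp: \<eta>_def)
    obtain \<delta> l where \<delta>_props: "0 < \<delta>" "measure \<gamma> {ennreal (t + real l * \<delta>)<..} \<le> \<eta>"
      and rows: "\<And>b. b < l \<Longrightarrow> measure \<gamma> {ennreal (t + real b * \<delta>)<..ennreal (t + (real b + 1) * \<delta>)} \<le> \<eta>"
      using fine_rows_exist[OF t_props(1) \<eta>(1)] by blast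
    obtain u where u: "- e < u" "u < 0" "\<And>a::nat. measure \<mu> ({0..1} \<inter> {u + real a * e}) = 0"
      using offset_exists[OF \<open>0 < e\<close>] by auto
    obtain K :: nat where K: "(1 - u) / e \<le> real K" using real_arch_simple by blast
    have g: "grid e t \<delta>" using t_props \<delta>_props \<open>0 < e\<close> by unfold_locales auto
    interpret grid u e t \<delta> K l by (rule g)
    have u': "u \<le> 0" "1 \<le> u + real K * e" using u K \<open>0 < e\<close> by (auto simp: field_simps)
    obtain B where B: "regular B" "measure \<Lambda> B \<le> total * measure \<gamma> {ennreal (t + real l * \<delta>)<..}"
      "\<forall>\<kappa>\<in>configs. \<kappa> \<inter> B = {} \<longrightarrow> covered \<kappa>"
      using grid_cover(3)[OF g u' u(3), where l=l] by (elim exE conjE) (rule that)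
    have "measure \<Lambda> B \<le> total * \<eta>" using B(2) \<delta>_props(2) by (meson measure_nonneg mult_left_mono order_trans)
    also have "\<dots> \<le> k * \<eta>" using k \<eta> by (intro mult_right_mono) auto
    finally have smallB: "measure \<Lambda> B \<le> e / 3" using \<eta>(2) by simp
    define D where "D b = {0..1::real} \<times> row b" for b
    define A where "A = {0..1::real} \<times> {ennreal t<..}"
    have pos: "0 < t + real b * \<delta>" for b using t \<delta> by (simp add: add_pos_nonneg)
    have regD: "regular (D b)" for b
      unfolding D_def row_def using \<delta>_props(1)
      by (intro regular_rectangle[OF position_continuity_all pos, where h'="t + (real b + 1) * \<delta>"]) (auto intro: mult_right_mono)
    have regA: "regular A"
      unfolding A_def by (rule regular_rectangle[OF position_continuity_all t_props(1) disjI1[OF refl]])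
    define H where "H b = measure \<gamma> {ennreal (t + real b * \<delta>)<..}" for b
    have row_mass: "measure \<gamma> (row b) = H b - H (Suc b)" for b
    proof -
      have le: "ennreal (t + real b * \<delta>) \<le> ennreal (t + real (Suc b) * \<delta>)"
        using \<delta>_props(1) by (intro ennreal_leI) (simp add: mult_right_mono)
      have "row b = {ennreal (t + real b * \<delta>)<..} - {ennreal (t + real (Suc b) * \<delta>)<..}"
        unfolding row_def by (auto simp: add.commute not_less)
      also have "measure \<gamma> \<dots> = H b - H (Suc b)"
        unfolding H_def using finite_tail_\<gamma>[OF pos[of b]] tail_in_sets_\<gamma>(1) le
        by (intro measure_Diff) (auto intro: le_less_trans)
      finally show ?thesis .
    qed
    have "(\<Sum>b<l. (measure \<Lambda> (D b))\<^sup>2) = (\<Sum>b<l. total\<^sup>2 * (measure \<gamma> (row b))\<^sup>2)"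
      unfolding D_def row_def
      by (intro sum.cong refl) (simp add: measure_\<Lambda>_Times position_continuity_sets[OF position_continuity_all] tail_in_sets_\<gamma> power_mult_distrib)
    also have "\<dots> \<le> (\<Sum>b<l. total\<^sup>2 * (\<eta> * measure \<gamma> (row b)))"
      using rows by (intro sum_mono mult_left_mono) (auto simp: power2_eq_square row_def intro!: mult_right_mono)
    also have "\<dots> = total\<^sup>2 * \<eta> * (\<Sum>b<l. measure \<gamma> (row b))" by (simp add: sum_distrib_left mult.assoc)
    also have "(\<Sum>b<l. measure \<gamma> (row b)) = H 0 - H l" unfolding row_mass by (rule sum_lessThan_telescope')
    also have "total\<^sup>2 * \<eta> * (H 0 - H l) \<le> total\<^sup>2 * \<eta> * G"
      using \<eta>(1) by (intro mult_left_mono) (auto simp: H_def G_def)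
    also have "\<dots> = (total\<^sup>2 * G) * \<eta>" by simp
    also have "\<dots> \<le> k * \<eta>" using k \<eta> by (intro mult_right_mono) auto
    finally have smallD: "(\<Sum>b<l. (measure \<Lambda> (D b))\<^sup>2) \<le> e / 3" using \<eta>(2) by simp
    have close: "\<exists>p. is_top \<kappa> p \<and> (\<forall>q. is_top \<kappa> q \<longrightarrow> q = p) \<and> dist (fst p) (argmax_config (snap ` occ cells cell \<kappa>)) \<le> e"
      if "\<kappa> \<in> configs" "good B l D {A} \<kappa>" for \<kappa>
    proof -
      have cov: "covered \<kappa>" using that B(3) by (simp add: good_def)
      have simple: "simple_on \<kappa> ({0..1} \<times> row b)" if "b < l" for b
        using \<open>good B l D {A} \<kappa>\<close> that by (simp add: good_def D_def)
      have ne: "\<kappa> \<inter> {0..1} \<times> {ennreal t<..} \<noteq> {}"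
        using that(2) by (simp add: good_def A_def)
      obtain p where "is_top \<kappa> p" "\<And>q. is_top \<kappa> q \<Longrightarrow> q = p" "\<bar>fst p - argmax_config (snap ` occupied \<kappa>)\<bar> \<le> e"
        using argmax_config_snap[OF \<open>\<kappa> \<in> configs\<close> cov _ ne] simple by metis
      then show ?thesis unfolding grid_occ[OF \<open>grid e t \<delta>\<close>] dist_real_def by blast
    qed
    show "cell_approximable e UNIV dist (\<lambda>n \<omega>. real (arg_max_on (\<lambda>j. X n j \<omega>) {1..n}) / real n) (\<lambda>\<omega>. argmax_config (\<zeta> \<omega>))"
      unfolding cell_approximable_def
    proof (intro exI conjI)
      show "finite cells" "disjoint_family_on cell cells" by (fact finite_cells, fact cell_disjoint)
      show "\<forall>q\<in>cells. regular (cell q)" using grid_cover(2)[OF g u' u(3)] by blast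
      show "measure \<Lambda> B + (\<Sum>i<l. (measure \<Lambda> (D i))\<^sup>2) + (\<Sum>A\<in>{A}. measure N {\<omega> \<in> space N. \<zeta> \<omega> \<inter> A = {}}) < e"
        using smallB smallD t_props(2) by (simp add: A_def)
      show "\<forall>n\<ge>1. \<forall>\<omega>\<in>space (M n). good B l D {A} (\<xi> n \<omega>) \<longrightarrow>
          dist (real (arg_max_on (\<lambda>j. X n j \<omega>) {1..n}) / real n) ((\<lambda>S. argmax_config (snap ` S)) (occ cells cell (\<xi> n \<omega>))) \<le> e"
      proof (intro allI ballI impI)
        fix n :: nat and \<omega> assume n: "1 \<le> n" and \<omega>: "\<omega> \<in> space (M n)" and gd: "good B l D {A} (\<xi> n \<omega>)"
        obtain p where p: "is_top (\<xi> n \<omega>) p" "\<And>q. is_top (\<xi> n \<omega>) q \<Longrightarrow> q = p"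
          "dist (fst p) (argmax_config (snap ` occ cells cell (\<xi> n \<omega>))) \<le> e"
          using close[OF \<xi>_configs gd] by blast
        have "real (arg_max_on (\<lambda>j. X n j \<omega>) {1..n}) / real n = fst p"
        proof (rule arg_max_on_row_config)
          show "0 \<le> X n j \<omega>" if "j \<in> {1..n}" for j using X_nonneg[OF that \<omega>] .
          show "is_top (row_config n (\<lambda>j. X n j \<omega>)) p" using p(1) unfolding \<xi>_def .
          show "q = p" if "is_top (row_config n (\<lambda>j. X n j \<omega>)) q" for q
            using p(2) that unfolding \<xi>_def .
        qed
        then show "dist (real (arg_max_on (\<lambda>j. X n j \<omega>) {1..n}) / real n) (argmax_config (snap ` occ cells cell (\<xi> n \<omega>))) \<le> e"
          using p(3) by simp
      qed
      show "\<forall>\<omega>\<in>space N. good B l D {A} (\<zeta> \<omega>) \<longrightarrow>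
          dist (argmax_config (\<zeta> \<omega>)) ((\<lambda>S. argmax_config (snap ` S)) (occ cells cell (\<zeta> \<omega>))) \<le> e"
      proof (intro ballI impI)
        fix \<omega> assume \<omega>: "\<omega> \<in> space N" and gd: "good B l D {A} (\<zeta> \<omega>)"
        obtain p where p: "is_top (\<zeta> \<omega>) p" "\<And>q. is_top (\<zeta> \<omega>) q \<Longrightarrow> q = p"
          "dist (fst p) (argmax_config (snap ` occ cells cell (\<zeta> \<omega>))) \<le> e"
          using close[OF \<zeta>_configs[OF \<omega>] gd] by blast
        have "argmax_config (\<zeta> \<omega>) = fst p" using p(1,2) by (rule argmax_config_unique)
        then show "dist (argmax_config (\<zeta> \<omega>)) (argmax_config (snap ` occ cells cell (\<zeta> \<omega>))) \<le> e"
          using p(3) by simp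
      qed
    qed (use B(1) regD regA in auto)
  qed
  then show ?thesis by simp
qed

text \<open>The Skorokhod metric separates a single jump from two jumps close together, so here no column may
  contain two points above \<open>t\<close>. As \<open>\<mu>\<close> is atomless the columns can be given mass at most \<open>\<eta>\<close>, and the
  probability of a column with two points is of order \<open>\<eta>\<close>.\<close>

lemma path_convergence:
  assumes "nonatomic \<mu>"
  shows "conv_in_distribution skorokhod_top M (\<lambda>n \<omega>. path_config (row_config n (\<lambda>j. X n j \<omega>))) N (\<lambda>\<omega>. path_config (\<zeta> \<omega>))"
  unfolding \<xi>_def[symmetric]
proof (rule functional_convergence[OF Metric_space_skorokhod])
  show "(\<lambda>\<omega>. path_config (\<xi> n \<omega>)) \<in> M n \<rightarrow>\<^sub>M borel_of skorokhod_top" for n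
    by (rule path_config_measurable[OF \<xi>_configs \<xi>_hits_sets])
  show "(\<lambda>\<omega>. path_config (\<zeta> \<omega>)) \<in> N \<rightarrow>\<^sub>M borel_of skorokhod_top"
    by (rule path_config_measurable[OF \<zeta>_configs \<zeta>_hits_sets])
next
  interpret finite_measure \<mu> by (rule finite_\<mu>)
  fix e :: real assume "0 < e"
  define t where "t = e / 3"
  have t_props: "0 < t" using \<open>0 < e\<close> by (simp add: t_def)
  define G where "G = measure \<gamma> {ennreal t<..}"
  \<comment> \<open>The first two summands of \<open>k\<close> serve the mass above the grid and the pairs of points in one column.\<close>
  define k where "k = total + G\<^sup>2 * total + 1"
  define \<eta> where "\<eta> = e / (3 * k)"
  have k: "1 \<le> k" "total \<le> k" "G\<^sup>2 * total \<le> k" by (auto simp: k_def G_def)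
  have \<eta>: "0 < \<eta>" "k * \<eta> = e / 3" using k \<open>0 < e\<close> by (auto simp: \<eta>_def)
  have \<eta>3: "\<eta> \<le> e / 3" using mult_right_mono[OF k(1), of \<eta>] \<eta> by simp
  obtain \<delta> l where \<delta>_props: "0 < \<delta>" "\<delta> \<le> \<eta>" "measure \<gamma> {ennreal (t + real l * \<delta>)<..} \<le> \<eta>"
    using fine_rows_exist[OF t_props \<eta>(1)] by blast
  obtain K :: nat where K: "0 < K" "1 / K \<le> \<eta>"
    and cols: "\<And>a. a < K \<Longrightarrow> measure \<mu> ({0..1} \<inter> {real a * (1 / K)<..<(real a + 1) * (1 / K)}) \<le> \<eta>"
    using fine_columns_exist[OF assms \<eta>(1)] by blast
  define w where "w = 1 / real K"
  have w_props: "0 < w" "w \<le> \<eta>" "w * K = 1" using K by (auto simp: w_def)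
  have null: "measure \<mu> ({0..1} \<inter> {x}) = 0" for x
  proof (cases "x \<in> {0..1}")
    case True
    have "space \<mu> = {0..1}" using sets_eq_imp_space_eq[OF sets_\<mu>] by (simp add: space_restrict_space)
    then show ?thesis using True assms by (simp add: nonatomic_def measure_def)
  qed (auto simp: Int_absorb1)
  have g: "grid w t \<delta>" using t_props \<delta>_props w_props by unfold_locales auto
  interpret grid 0 w t \<delta> K l by (rule g)
  have u': "(0::real) \<le> 0" "1 \<le> 0 + real K * w" using w_props by (auto simp: mult.commute)
  obtain B where B: "regular B" "measure \<Lambda> B \<le> total * measure \<gamma> {ennreal (t + real l * \<delta>)<..}"
    "\<forall>\<kappa>\<in>configs. \<kappa> \<inter> B = {} \<longrightarrow> covered \<kappa>"
    using grid_cover(3)[OF g u' null, where l=l] by (elim exE conjE) (rule that)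
  have "measure \<Lambda> B \<le> total * \<eta>" using B(2) \<delta>_props(3) by (meson measure_nonneg mult_left_mono order_trans)
  also have "\<dots> \<le> k * \<eta>" using k \<eta> by (intro mult_right_mono) auto
  finally have smallB: "measure \<Lambda> B \<le> e / 3" using \<eta>(2) by simp
  define D where "D a = col a \<times> {ennreal t<..}" for a
  have colc: "position_continuity (col a)" for a using grid_cover(1)[OF g u' null] .
  have regD: "regular (D a)" for a
    unfolding D_def by (rule regular_rectangle[OF colc t disjI1[OF refl]])
  have col_mass: "measure \<mu> (col a) \<le> \<eta>" if "a < K" for a
    using cols[OF that] unfolding col_def w_def[symmetric] by simp
  have "(\<Sum>a<K. (measure \<Lambda> (D a))\<^sup>2) = (\<Sum>a<K. (measure \<mu> (col a))\<^sup>2 * G\<^sup>2)"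
    unfolding D_def G_def
    by (intro sum.cong refl) (simp add: measure_\<Lambda>_Times position_continuity_sets[OF colc] tail_in_sets_\<gamma> power_mult_distrib)
  also have "\<dots> \<le> (\<Sum>a<K. (\<eta> * measure \<mu> (col a)) * G\<^sup>2)"
    using col_mass by (intro sum_mono mult_right_mono) (auto simp: power2_eq_square intro!: mult_right_mono)
  also have "\<dots> = \<eta> * G\<^sup>2 * (\<Sum>a<K. measure \<mu> (col a))" by (simp add: sum_distrib_left mult_ac)
  also have "(\<Sum>a<K. measure \<mu> (col a)) = measure \<mu> (\<Union>a<K. col a)"
  proof (rule finite_measure_finite_Union[symmetric])
    show "disjoint_family_on col {..<K}" unfolding disjoint_family_on_def using col_disjoint by blast
    show "col ` {..<K} \<subseteq> sets \<mu>" using position_continuity_sets[OF colc] by blast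
  qed simp
  also have "\<eta> * G\<^sup>2 * measure \<mu> (\<Union>a<K. col a) \<le> \<eta> * G\<^sup>2 * total"
    using \<eta>(1) position_continuity_sets[OF position_continuity_all]
    by (intro mult_left_mono finite_measure_mono) (auto simp: col_def)
  also have "\<dots> = (G\<^sup>2 * total) * \<eta>" by simp
  also have "\<dots> \<le> k * \<eta>" using k \<eta> by (intro mult_right_mono) auto
  finally have smallD: "(\<Sum>a<K. (measure \<Lambda> (D a))\<^sup>2) \<le> e / 3" using \<eta>(2) by simp
  have close: "skorokhod_dist (path_config \<kappa>) (path_config (snap ` occ cells cell \<kappa>)) \<le> e"
    if "\<kappa> \<in> configs" "good B K D {} \<kappa>" for \<kappa>
  proof -
    have "\<kappa> \<inter> B = {}" "\<And>a. a < K \<Longrightarrow> simple_on \<kappa> (col a \<times> {ennreal t<..})"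
      using that(2) by (auto simp: good_def D_def)
    then have "skorokhod_dist (path_config \<kappa>) (path_config (snap ` occupied \<kappa>)) \<le> w + t + \<delta>"
      by (intro path_config_snap[OF that(1) B(3)[rule_format, OF that(1)] refl w_props(3)])
    then show ?thesis unfolding grid_occ[OF g] using w_props(2) \<delta>_props(2) \<eta>3 t_def by linarith
  qed
  show "cell_approximable e D01 skorokhod_dist (\<lambda>n \<omega>. path_config (\<xi> n \<omega>)) (\<lambda>\<omega>. path_config (\<zeta> \<omega>))"
    unfolding cell_approximable_def
  proof (intro exI conjI)
    show "finite cells" "disjoint_family_on cell cells" by (fact finite_cells, fact cell_disjoint)
    show "\<forall>q\<in>cells. regular (cell q)" using grid_cover(2)[OF g u' null] by blast
    show "(\<lambda>S. path_config (snap ` S)) ` Pow cells \<subseteq> D01"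
      using path_config_D01 snap_in_configs[OF refl w_props(3)] by blast
    show "measure \<Lambda> B + (\<Sum>i<K. (measure \<Lambda> (D i))\<^sup>2) + (\<Sum>A\<in>{}. measure N {\<omega> \<in> space N. \<zeta> \<omega> \<inter> A = {}}) < e"
      using smallB smallD \<open>0 < e\<close> by simp
  qed (use B(1) regD close \<xi>_configs \<zeta>_configs in auto)
qed

end

theorem corollary3:
  fixes M :: "nat \<Rightarrow> 'a measure" and X :: "nat \<Rightarrow> nat \<Rightarrow> 'a \<Rightarrow> real"
    and c :: "nat \<Rightarrow> nat \<Rightarrow> real"
    and \<mu> :: "real measure" and \<gamma> :: "ennreal measure"
    and N :: "'b measure" and \<zeta> :: "'b \<Rightarrow> (real \<times> ennreal) set"
  assumes "\<And>n. prob_space (M n)"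
    and "\<And>n. prob_space.indep_vars (M n) (\<lambda>_. borel) (X n) {1..n}"
    and "\<And>n j \<omega>. j \<in> {1..n} \<Longrightarrow> \<omega> \<in> space (M n) \<Longrightarrow> 0 \<le> X n j \<omega>"
    and "\<And>n j. j \<in> {1..n} \<Longrightarrow> nonatomic (distr (M n) borel (X n j))"
    and "\<And>n j. j \<in> {1..n} \<Longrightarrow> 0 < c n j"
    and "filterlim (row_sum c) at_top sequentially"
    and "(\<lambda>n. (MAX j\<in>{1..n}. c n j) / row_sum c n) \<longlonglongrightarrow> 0"
    and "sets \<mu> = sets (restrict_space borel {0..1})" and "finite_measure \<mu>"
    and "weak_conv_top (top_of_set {0..1}) (position_measure c) \<mu>"
    and "sets \<gamma> = sets Rplus_borel"
    and "\<And>t::real. 0 < t \<Longrightarrow> emeasure \<gamma> {ennreal t..} < \<infinity>"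
    and "nonatomic \<gamma>"
    and "\<And>j. 1 \<le> j \<Longrightarrow>
           vague_conv (\<lambda>n. scale_measure (ennreal (row_sum c n / c n j)) (Rplus_law (M n) (X n j))) \<gamma>"
    and "\<And>t::real. 0 < t \<Longrightarrow> (\<lambda>n. Delta M X c \<gamma> n t) \<longlonglongrightarrow> 0"
    and "prob_space N" and "poisson_process N (\<mu> \<Otimes>\<^sub>M \<gamma>) \<zeta>"
  shows "((AE \<omega> in N. \<zeta> \<omega> \<noteq> {}) \<longrightarrow>
           conv_in_distribution euclideanreal M
             (\<lambda>n \<omega>. real (arg_max_on (\<lambda>j. X n j \<omega>) {1..n}) / real n)
             N (\<lambda>\<omega>. argmax_config (\<zeta> \<omega>)))
       \<and> conv_in_distribution euclideanreal M
             (\<lambda>n \<omega>. MAX j\<in>{1..n}. X n j \<omega>)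
             N (\<lambda>\<omega>. max_config (\<zeta> \<omega>))
       \<and> (nonatomic \<mu> \<longrightarrow>
           conv_in_distribution skorokhod_top M
             (\<lambda>n \<omega>. path_config (row_config n (\<lambda>j. X n j \<omega>)))
             N (\<lambda>\<omega>. path_config (\<zeta> \<omega>)))"
proof -
  have "triangular_array M X c \<mu> \<gamma> N \<zeta>"
    using assms(1-3,5,7-13,15-17) by (rule triangular_array.intro)
  then interpret triangular_array M X c \<mu> \<gamma> N \<zeta> .
  show ?thesis
    by (intro conjI impI argmax_convergence max_convergence path_convergence)
qed

end
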